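(* Let $R$ be a Stanley-Reisner ring over a field and let $j\ge 0$ be an integer. Then $R$ satisfies $(S_2^j)$ if and only if $R$ is $(j+1)$-locally connected.
   Context: A commutative Noetherian ring $A$ satisfies $(S_\ell^j)$ if $\operatorname{depth}A_{\mathfrak{p}}\ge\min\{\ell,\dim A_{\mathfrak{p}}-j\}$ for all $\mathfrak{p}\in\operatorname{Spec}A$. A Stanley-Reisner ring is $\mathbb{K}[x_1,\dots,x_n]/I$ with $\mathbb{K}$ a field and $I$ a square-free monomial ideal. For a ring $A$ and an integer $k\ge 1$, $G^k(A)$ is the graph whose vertices are the minimal primes of $A$, with two minimal primes $P,P'$ joined by an edge if $1\le\operatorname{height}(P+P')\le k$, where height is taken in $A$. The ring $A$ is $k$-locally connected if $G^k(A_{\mathfrak{p}})$ is connected for every $\mathfrak{p}\in\operatorname{Spec}A$. *)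

theory Defs
  imports
    "HOL-Library.Extended_Nat"
    "HOL-Library.Poly_Mapping"
    "Graph_Theory.Digraph_Component"
    "HOL-Algebra.Algebra"
    "HOL-Algebra.Algebraic_Closure_Type"
begin

section \<open>Localization\<close>

definition loc_rel :: "('a, 'b) ring_scheme \<Rightarrow> 'a set \<Rightarrow> (('a \<times> 'a) \<times> ('a \<times> 'a)) set" where
  "loc_rel A S = {((a, s), (b, t)). a \<in> carrier A \<and> b \<in> carrier A \<and> s \<in> S \<and> t \<in> S \<and>
     (\<exists>u\<in>S. u \<otimes>\<^bsub>A\<^esub> (a \<otimes>\<^bsub>A\<^esub> t \<ominus>\<^bsub>A\<^esub> b \<otimes>\<^bsub>A\<^esub> s) = \<zero>\<^bsub>A\<^esub>)}"

definition loc_frac :: "('a, 'b) ring_scheme \<Rightarrow> 'a set \<Rightarrow> 'a \<Rightarrow> 'a \<Rightarrow> ('a \<times> 'a) set" where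
  "loc_frac A S a s = loc_rel A S `` {(a, s)}"

text \<open>The unions range over representatives of the two classes; all of them give the same
  class when \<open>S\<close> is a submonoid of a commutative ring.\<close>

definition localization :: "('a, 'b) ring_scheme \<Rightarrow> 'a set \<Rightarrow> ('a \<times> 'a) set ring" where
  "localization A S = \<lparr>
     carrier = (carrier A \<times> S) // loc_rel A S,
     mult = (\<lambda>x y.
       \<Union>(a, s)\<in>x. \<Union>(b, t)\<in>y. loc_frac A S (a \<otimes>\<^bsub>A\<^esub> b) (s \<otimes>\<^bsub>A\<^esub> t)),
     one = loc_frac A S \<one>\<^bsub>A\<^esub> \<one>\<^bsub>A\<^esub>,
     ring.zero = loc_frac A S \<zero>\<^bsub>A\<^esub> \<one>\<^bsub>A\<^esub>,
     add = (\<lambda>x y.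
       \<Union>(a, s)\<in>x. \<Union>(b, t)\<in>y. loc_frac A S (a \<otimes>\<^bsub>A\<^esub> t \<oplus>\<^bsub>A\<^esub> b \<otimes>\<^bsub>A\<^esub> s) (s \<otimes>\<^bsub>A\<^esub> t))\<rparr>"

definition localization_at :: "('a, 'b) ring_scheme \<Rightarrow> 'a set \<Rightarrow> ('a \<times> 'a) set ring" where
  "localization_at A p = localization A (carrier A - p)"

section \<open>Krull dimension and height\<close>

definition prime_chain :: "('a, 'b) ring_scheme \<Rightarrow> nat \<Rightarrow> (nat \<Rightarrow> 'a set) \<Rightarrow> bool" where
  "prime_chain A n c \<longleftrightarrow> (\<forall>i\<le>n. primeideal (c i) A) \<and> (\<forall>i<n. c i \<subset> c (Suc i))"

text \<open>The zero ring gets dimension 0 here. Below, the dimension is only taken of local rings.\<close>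

definition krull_dim :: "('a, 'b) ring_scheme \<Rightarrow> enat" where
  "krull_dim A = Sup {enat n | n. \<exists>c. prime_chain A n c}"

definition prime_height :: "('a, 'b) ring_scheme \<Rightarrow> 'a set \<Rightarrow> enat" where
  "prime_height A p = Sup {enat n | n. \<exists>c. prime_chain A n c \<and> c n = p}"

definition height :: "('a, 'b) ring_scheme \<Rightarrow> 'a set \<Rightarrow> enat" where
  "height A I = Inf {prime_height A p | p. primeideal p A \<and> I \<subseteq> p}"

section \<open>Depth and the Serre-type conditions\<close>

text \<open>The element \<open>xs ! i\<close> is a nonzerodivisor modulo the ideal generated by its predecessors.\<close>

definition regular_sequence :: "('a, 'b) ring_scheme \<Rightarrow> 'a list \<Rightarrow> bool" where
  "regular_sequence A xs \<longleftrightarrow>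
     set xs \<subseteq> carrier A \<and>
     (\<forall>i<length xs. \<forall>a\<in>carrier A.
        xs ! i \<otimes>\<^bsub>A\<^esub> a \<in> Idl\<^bsub>A\<^esub> (set (take i xs)) \<longrightarrow> a \<in> Idl\<^bsub>A\<^esub> (set (take i xs))) \<and>
     Idl\<^bsub>A\<^esub> (set xs) \<noteq> carrier A"

text \<open>The description \<open>THE m\<close> is meaningful because the depth is only taken of local rings.\<close>

definition local_depth :: "('a, 'b) ring_scheme \<Rightarrow> enat" where
  "local_depth A =
     Sup {enat (length xs) | xs. regular_sequence A xs \<and> set xs \<subseteq> (THE m. maximalideal m A)}"

text \<open>Subtraction on \<^typ>\<open>enat\<close> truncates at 0. This does not matter, since depths are
  nonnegative.\<close>

definition serre_condition :: "nat \<Rightarrow> nat \<Rightarrow> ('a, 'b) ring_scheme \<Rightarrow> bool" where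
  "serre_condition l j A \<longleftrightarrow> (\<forall>p. primeideal p A \<longrightarrow>
     local_depth (localization_at A p) \<ge> min (enat l) (krull_dim (localization_at A p) - enat j))"

section \<open>Local connectedness\<close>

definition minimal_primes :: "('a, 'b) ring_scheme \<Rightarrow> 'a set set" where
  "minimal_primes A = {P. primeideal P A \<and> (\<forall>Q. primeideal Q A \<longrightarrow> Q \<subseteq> P \<longrightarrow> Q = P)}"

text \<open>The undirected graph is given by its symmetric set of arcs.\<close>

definition min_prime_graph :: "nat \<Rightarrow> ('a, 'b) ring_scheme \<Rightarrow> 'a set pair_pre_digraph" where
  "min_prime_graph k A = \<lparr>
     pverts = minimal_primes A,
     parcs = {(P, Q). P \<in> minimal_primes A \<and> Q \<in> minimal_primes A \<and> P \<noteq> Q \<and>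
       1 \<le> height A (P <+>\<^bsub>A\<^esub> Q) \<and> height A (P <+>\<^bsub>A\<^esub> Q) \<le> enat k}\<rparr>"

definition locally_connected :: "nat \<Rightarrow> ('a, 'b) ring_scheme \<Rightarrow> bool" where
  "locally_connected k A \<longleftrightarrow> (\<forall>p. primeideal p A \<longrightarrow>
     Digraph_Component.connected (min_prime_graph k (localization_at A p)))"

section \<open>Stanley-Reisner rings\<close>

text \<open>The ring in the variables \<open>x\<^sub>0, \<dots>, x\<^sub>n\<^sub>-\<^sub>1\<close>: a monomial is an exponent vector of type
  \<^typ>\<open>nat \<Rightarrow>\<^sub>0 nat\<close>, a polynomial a finitely supported family of coefficients indexed by
  monomials, and \<open>*\<close> on \<^typ>\<open>_ \<Rightarrow>\<^sub>0 _\<close> is convolution.\<close>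

definition mpoly_ring :: "nat \<Rightarrow> ((nat \<Rightarrow>\<^sub>0 nat) \<Rightarrow>\<^sub>0 'k::field) ring" where
  "mpoly_ring n = ring_of_type_algebra
     \<lparr>carrier := {f. \<forall>m\<in>Poly_Mapping.keys f. Poly_Mapping.keys m \<subseteq> {..<n}}\<rparr>"

definition squarefree_monomials :: "nat \<Rightarrow> ((nat \<Rightarrow>\<^sub>0 nat) \<Rightarrow>\<^sub>0 'k::field) set" where
  "squarefree_monomials n = {Poly_Mapping.single m 1 | m.
     Poly_Mapping.keys m \<subseteq> {..<n} \<and> (\<forall>i. Poly_Mapping.lookup m i \<le> 1)}"

definition squarefree_monomial_ideal :: "nat \<Rightarrow> ((nat \<Rightarrow>\<^sub>0 nat) \<Rightarrow>\<^sub>0 'k::field) set \<Rightarrow> bool" where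
  "squarefree_monomial_ideal n I \<longleftrightarrow>
     (\<exists>M \<subseteq> squarefree_monomials n. I = Idl\<^bsub>mpoly_ring n\<^esub> M)"

end

theory Submission
  imports Defs
begin

text \<open>
  A prime \<open>P\<close> of \<open>k[x]\<close> that contains \<open>I\<close> contains exactly the minimal primes
  \<open>P\<^sub>C = (x\<^sub>i : i \<in> C)\<close> of \<open>I\<close> with \<open>C\<close> a minimal cover inside the set \<open>A\<close> of variables
  in \<open>P\<close>, and \<open>P\<^sub>C + P\<^sub>C\<^sub>' = P\<^sub>C\<^sub>\<union>\<^sub>C\<^sub>'\<close> is prime. So the graph of the localization at \<open>P\<close> depends
  on \<open>A\<close> only. Depth at least 1 is automatic in positive dimension, so \<open>(S\<^sub>2\<^sup>j)\<close> says that depth at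
  least 2 holds in dimension at least \<open>j + 2\<close>. If \<open>P\<close> is not generated by variables, depth at least 2
  is automatic in dimension at least 2. If \<open>P = P\<^sub>A\<close>, depth at least 2 amounts to connectedness of the
  graph in which \<open>C\<close> and \<open>C'\<close> are joined when \<open>C \<union> C' \<noteq> A\<close>. An edge of height at most \<open>j + 1\<close>
  has \<open>C \<union> C' \<noteq> A\<close> as soon as \<open>P\<^sub>A\<close> has height at least \<open>j + 2\<close>. Conversely, an edge with
  \<open>C \<union> C' \<noteq> A\<close> is replaced by a path of edges of height at most \<open>j + 1\<close> inside \<open>C \<union> C'\<close>,
  by induction on \<open>A\<close>.
\<close>

section \<open>Localization at a prime ideal\<close>

text \<open>Why depth at least 2 reduces to a graph: modulo the minimal primes inside
  \<open>P\<close>, an element is a family of polynomials on the facets \<open>A - C\<close> that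
  agree on pairwise intersections. With the facet sum as first element of a regular sequence and
  some \<open>b\<close> in \<open>P\<close> as second, the required quotients exist on each facet
  separately, and the only obstruction to gluing them sits on intersections where \<open>b\<close>
  restricts to 0. If \<open>P\<close> is not \<open>P_A\<close>, an element of \<open>P\<close>
  outside \<open>P_A\<close> survives even on the empty face, so nothing obstructs. If
  \<open>P = P_A\<close>, the sum of the variables in \<open>A\<close> vanishes on the empty face
  alone, and connectedness bridges exactly the pairs of facets that meet nowhere else. With a single
  facet the facet sum can be 1; the ring is then a localized polynomial ring, and a regular pair has
  to come from polynomial rings over a field instead. The two conditions do not match prime by
  prime: the path that replaces an edge uses the depth at smaller primes \<open>P_B\<close>, which
  is why the equivalence is proved with the quantifiers over all primes in place.\<close>

lemma (in primeideal) compl_submonoid: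
  "\<one> \<in> carrier R - I"
  "\<lbrakk>s \<in> carrier R - I; t \<in> carrier R - I\<rbrakk> \<Longrightarrow> s \<otimes> t \<in> carrier R - I"
  using I_notcarr I_prime one_imp_carrier by auto

lemma (in primeideal) loc_rel_equiv:
  "equiv (carrier R \<times> (carrier R - I)) (loc_rel R (carrier R - I))"
proof (rule equivI)
  let ?S = "carrier R - I"
  show "loc_rel R ?S \<subseteq> (carrier R \<times> ?S) \<times> (carrier R \<times> ?S)"
    by (auto simp: loc_rel_def)
  show "refl_on (carrier R \<times> ?S) (loc_rel R ?S)"
  proof (rule refl_onI)
    fix x assume "x \<in> carrier R \<times> ?S"
    then obtain a s where x: "x = (a, s)" "a \<in> carrier R" "s \<in> ?S" by auto
    then have "\<one> \<otimes> (a \<otimes> s \<ominus> a \<otimes> s) = \<zero>" by (simp add: r_neg minus_eq)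
    then show "(x, x) \<in> loc_rel R ?S"
      using x compl_submonoid(1) unfolding loc_rel_def by blast
  qed
  show "sym (loc_rel R ?S)"
  proof (rule symI)
    fix x y assume "(x, y) \<in> loc_rel R ?S"
    then obtain a s b t u where *: "x = (a, s)" "y = (b, t)" "a \<in> carrier R" "b \<in> carrier R"
      "s \<in> ?S" "t \<in> ?S" "u \<in> ?S" "u \<otimes> (a \<otimes> t \<ominus> b \<otimes> s) = \<zero>"
      by (auto simp: loc_rel_def)
    then have c: "s \<in> carrier R" "t \<in> carrier R" "u \<in> carrier R" by auto
    have "u \<otimes> (b \<otimes> s \<ominus> a \<otimes> t) = \<ominus> (u \<otimes> (a \<otimes> t \<ominus> b \<otimes> s))"
      using *(3,4) c by algebra
    also have "\<dots> = \<zero>" using * by simp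
    finally show "(y, x) \<in> loc_rel R ?S" using * by (auto simp: loc_rel_def)
  qed
  show "trans (loc_rel R ?S)"
  proof (rule transI)
    fix x y z assume "(x, y) \<in> loc_rel R ?S" "(y, z) \<in> loc_rel R ?S"
    then obtain a s b t u c r v where *: "x = (a, s)" "y = (b, t)" "z = (c, r)"
      "a \<in> carrier R" "b \<in> carrier R" "c \<in> carrier R"
      "s \<in> ?S" "t \<in> ?S" "r \<in> ?S" "u \<in> ?S" "v \<in> ?S"
      "u \<otimes> (a \<otimes> t \<ominus> b \<otimes> s) = \<zero>" "v \<otimes> (b \<otimes> r \<ominus> c \<otimes> t) = \<zero>"
      by (auto simp: loc_rel_def)
    then have cr: "s \<in> carrier R" "t \<in> carrier R" "r \<in> carrier R" "u \<in> carrier R" "v \<in> carrier R"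
      by auto
    have "(u \<otimes> (v \<otimes> t)) \<otimes> (a \<otimes> r \<ominus> c \<otimes> s)
        = (v \<otimes> r) \<otimes> (u \<otimes> (a \<otimes> t \<ominus> b \<otimes> s)) \<oplus> (u \<otimes> s) \<otimes> (v \<otimes> (b \<otimes> r \<ominus> c \<otimes> t))"
      using *(4-6) cr by algebra
    also have "\<dots> = \<zero>" using * cr by simp
    finally have "(u \<otimes> (v \<otimes> t)) \<otimes> (a \<otimes> r \<ominus> c \<otimes> s) = \<zero>" .
    moreover have "u \<otimes> (v \<otimes> t) \<in> ?S" using * compl_submonoid(2) by simp
    ultimately show "(x, z) \<in> loc_rel R ?S" using * unfolding loc_rel_def by blast
  qed
qed

context primeideal
begin

abbreviation "compl \<equiv> carrier R - I"
abbreviation "loc_eq \<equiv> loc_rel R compl"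
abbreviation "lfrac \<equiv> loc_frac R compl"
abbreviation "loc \<equiv> localization_at R I"

section \<open>Arithmetic of fractions\<close>

lemma loc_frac_eq_iff:
  assumes "a \<in> carrier R" "b \<in> carrier R" "s \<in> compl" "t \<in> compl"
  shows "lfrac a s = lfrac b t \<longleftrightarrow> (\<exists>u\<in>compl. u \<otimes> (a \<otimes> t \<ominus> b \<otimes> s) = \<zero>)"
proof -
  have "lfrac a s = lfrac b t \<longleftrightarrow> ((a, s), (b, t)) \<in> loc_eq"
    unfolding loc_frac_def using assms loc_rel_equiv by (intro eq_equiv_class_iff) auto
  then show ?thesis using assms by (auto simp: loc_rel_def)
qed

lemma loc_frac_eqI:
  assumes "a \<in> carrier R" "b \<in> carrier R" "s \<in> compl" "t \<in> compl" "a \<otimes> t = b \<otimes> s"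
  shows "lfrac a s = lfrac b t"
proof -
  have "\<one> \<otimes> (a \<otimes> t \<ominus> b \<otimes> s) = \<zero>" using assms by (simp add: r_neg minus_eq)
  then show ?thesis using loc_frac_eq_iff compl_submonoid(1) assms by blast
qed

lemma localization_carrier_eq: "carrier loc = {lfrac a s | a s. a \<in> carrier R \<and> s \<in> compl}"
  unfolding localization_at_def localization_def loc_frac_def quotient_def by auto

lemma loc_frac_closed: "\<lbrakk>a \<in> carrier R; s \<in> compl\<rbrakk> \<Longrightarrow> lfrac a s \<in> carrier loc"
  using localization_carrier_eq by auto

text \<open>The product in \<open>localization\<close> is a union over representatives; it collapses
  to one class because the choice of representatives does not matter
  (\<open>congruent2\<close>).\<close>

lemma localization_mult_frac:
  assumes "a \<in> carrier R" "b \<in> carrier R" "s \<in> compl" "t \<in> compl"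
  shows "lfrac a s \<otimes>\<^bsub>loc\<^esub> lfrac b t = lfrac (a \<otimes> b) (s \<otimes> t)"
proof -
  have cong: "congruent2 loc_eq loc_eq (\<lambda>x y. case x of (a, s) \<Rightarrow> case y of (b, t) \<Rightarrow> lfrac (a \<otimes> b) (s \<otimes> t))"
  proof (rule congruent2I[OF loc_rel_equiv loc_rel_equiv])
    fix y z w assume "(y, z) \<in> loc_eq" "w \<in> carrier R \<times> compl"
    then obtain a s b t u c r where *: "y = (a, s)" "z = (b, t)" "w = (c, r)"
      "a \<in> carrier R" "b \<in> carrier R" "c \<in> carrier R" "s \<in> compl" "t \<in> compl" "r \<in> compl" "u \<in> compl"
      "u \<otimes> (a \<otimes> t \<ominus> b \<otimes> s) = \<zero>" by (auto simp: loc_rel_def)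
    then have cr: "s \<in> carrier R" "t \<in> carrier R" "r \<in> carrier R" "u \<in> carrier R" by auto
    have "u \<otimes> ((a \<otimes> c) \<otimes> (t \<otimes> r) \<ominus> (b \<otimes> c) \<otimes> (s \<otimes> r)) = (c \<otimes> r) \<otimes> (u \<otimes> (a \<otimes> t \<ominus> b \<otimes> s))"
      using *(4-6) cr by algebra
    also have "\<dots> = \<zero>" using * cr by simp
    finally have eq: "lfrac (a \<otimes> c) (s \<otimes> r) = lfrac (b \<otimes> c) (t \<otimes> r)"
      using * cr compl_submonoid(2) by (subst loc_frac_eq_iff) auto
    show "(case y of (a, s) \<Rightarrow> case w of (b, t) \<Rightarrow> lfrac (a \<otimes> b) (s \<otimes> t)) =
          (case z of (a, s) \<Rightarrow> case w of (b, t) \<Rightarrow> lfrac (a \<otimes> b) (s \<otimes> t))"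
      using eq * by simp
    show "(case w of (a, s) \<Rightarrow> case y of (b, t) \<Rightarrow> lfrac (a \<otimes> b) (s \<otimes> t)) =
          (case w of (a, s) \<Rightarrow> case z of (b, t) \<Rightarrow> lfrac (a \<otimes> b) (s \<otimes> t))"
      using eq * cr by (simp add: m_comm)
  qed
  show ?thesis
    using UN_equiv_class2[OF loc_rel_equiv loc_rel_equiv cong, of "(a,s)" "(b,t)"] assms
    by (simp add: localization_at_def localization_def loc_frac_def case_prod_unfold)
qed

lemma localization_add_frac:
  assumes "a \<in> carrier R" "b \<in> carrier R" "s \<in> compl" "t \<in> compl"
  shows "lfrac a s \<oplus>\<^bsub>loc\<^esub> lfrac b t = lfrac (a \<otimes> t \<oplus> b \<otimes> s) (s \<otimes> t)"
proof -
  have cong: "congruent2 loc_eq loc_eq (\<lambda>x y. case x of (a, s) \<Rightarrow> case y of (b, t) \<Rightarrow> lfrac (a \<otimes> t \<oplus> b \<otimes> s) (s \<otimes> t))"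
  proof (rule congruent2I[OF loc_rel_equiv loc_rel_equiv])
    fix y z w assume "(y, z) \<in> loc_eq" "w \<in> carrier R \<times> compl"
    then obtain a s b t u c r where *: "y = (a, s)" "z = (b, t)" "w = (c, r)"
      "a \<in> carrier R" "b \<in> carrier R" "c \<in> carrier R" "s \<in> compl" "t \<in> compl" "r \<in> compl" "u \<in> compl"
      "u \<otimes> (a \<otimes> t \<ominus> b \<otimes> s) = \<zero>" by (auto simp: loc_rel_def)
    then have cr: "s \<in> carrier R" "t \<in> carrier R" "r \<in> carrier R" "u \<in> carrier R" by auto
    have "u \<otimes> ((a \<otimes> r \<oplus> c \<otimes> s) \<otimes> (t \<otimes> r) \<ominus> (b \<otimes> r \<oplus> c \<otimes> t) \<otimes> (s \<otimes> r)) = (r \<otimes> r) \<otimes> (u \<otimes> (a \<otimes> t \<ominus> b \<otimes> s))"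
      using *(4-6) cr by algebra
    also have "\<dots> = \<zero>" using * cr by simp
    finally have eq: "lfrac (a \<otimes> r \<oplus> c \<otimes> s) (s \<otimes> r) = lfrac (b \<otimes> r \<oplus> c \<otimes> t) (t \<otimes> r)"
      using * cr compl_submonoid(2) by (subst loc_frac_eq_iff) auto
    show "(case y of (a, s) \<Rightarrow> case w of (b, t) \<Rightarrow> lfrac (a \<otimes> t \<oplus> b \<otimes> s) (s \<otimes> t)) =
          (case z of (a, s) \<Rightarrow> case w of (b, t) \<Rightarrow> lfrac (a \<otimes> t \<oplus> b \<otimes> s) (s \<otimes> t))"
      using eq * by simp
    show "(case w of (a, s) \<Rightarrow> case y of (b, t) \<Rightarrow> lfrac (a \<otimes> t \<oplus> b \<otimes> s) (s \<otimes> t)) =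
          (case w of (a, s) \<Rightarrow> case z of (b, t) \<Rightarrow> lfrac (a \<otimes> t \<oplus> b \<otimes> s) (s \<otimes> t))"
      using eq * cr by (simp add: m_comm a_comm)
  qed
  show ?thesis
    using UN_equiv_class2[OF loc_rel_equiv loc_rel_equiv cong, of "(a,s)" "(b,t)"] assms
    by (simp add: localization_at_def localization_def loc_frac_def case_prod_unfold)
qed

lemma localization_one: "\<one>\<^bsub>loc\<^esub> = lfrac \<one> \<one>"
  and localization_zero: "\<zero>\<^bsub>loc\<^esub> = lfrac \<zero> \<one>"
  by (simp_all add: localization_at_def localization_def)

lemma localization_cring: "cring loc"
proof -
  note S1 = compl_submonoid(1) and S2 = compl_submonoid(2)
  have SC: "s \<in> compl \<Longrightarrow> s \<in> carrier R" for s by auto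
  have exE: "\<exists>a s. x = lfrac a s \<and> a \<in> carrier R \<and> s \<in> compl" if "x \<in> carrier loc" for x
    using that localization_carrier_eq by auto
  note [simp] = localization_mult_frac localization_add_frac localization_one localization_zero S2 SC
  show ?thesis
  proof (rule cringI)
    show "abelian_group loc"
    proof (rule abelian_groupI)
      fix x y assume "x \<in> carrier loc" "y \<in> carrier loc"
      then obtain a s b t where *: "x = lfrac a s" "a \<in> carrier R" "s \<in> compl" "y = lfrac b t" "b \<in> carrier R" "t \<in> compl"
        using exE by metis
      show "x \<oplus>\<^bsub>loc\<^esub> y \<in> carrier loc"
        using * by (simp del: Diff_iff add: loc_frac_closed)
      show "x \<oplus>\<^bsub>loc\<^esub> y = y \<oplus>\<^bsub>loc\<^esub> x"
        using * by (simp del: Diff_iff add: a_comm m_comm)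
    next
      show "\<zero>\<^bsub>loc\<^esub> \<in> carrier loc" using S1 by (simp del: Diff_iff add: loc_frac_closed)
    next
      fix x y z assume "x \<in> carrier loc" "y \<in> carrier loc" "z \<in> carrier loc"
      then obtain a s b t c r where *: "x = lfrac a s" "a \<in> carrier R" "s \<in> compl" "y = lfrac b t" "b \<in> carrier R" "t \<in> compl"
          "z = lfrac c r" "c \<in> carrier R" "r \<in> compl"
        using exE by metis
      then have cr: "s \<in> carrier R" "t \<in> carrier R" "r \<in> carrier R" by auto
      have "lfrac ((a \<otimes> t \<oplus> b \<otimes> s) \<otimes> r \<oplus> c \<otimes> (s \<otimes> t)) ((s \<otimes> t) \<otimes> r)
          = lfrac (a \<otimes> (t \<otimes> r) \<oplus> (b \<otimes> r \<oplus> c \<otimes> t) \<otimes> s) (s \<otimes> (t \<otimes> r))"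
      proof (rule loc_frac_eqI)
        show "((a \<otimes> t \<oplus> b \<otimes> s) \<otimes> r \<oplus> c \<otimes> (s \<otimes> t)) \<otimes> (s \<otimes> (t \<otimes> r)) =
          (a \<otimes> (t \<otimes> r) \<oplus> (b \<otimes> r \<oplus> c \<otimes> t) \<otimes> s) \<otimes> ((s \<otimes> t) \<otimes> r)"
          using *(2,5,8) cr by algebra
      qed (use * cr in \<open>simp_all del: Diff_iff\<close>)
      then show "x \<oplus>\<^bsub>loc\<^esub> y \<oplus>\<^bsub>loc\<^esub> z = x \<oplus>\<^bsub>loc\<^esub> (y \<oplus>\<^bsub>loc\<^esub> z)"
        using * by (simp del: Diff_iff)
    next
      fix x assume "x \<in> carrier loc"
      then obtain a s where *: "x = lfrac a s" "a \<in> carrier R" "s \<in> compl"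
        using exE by metis
      then have cr: "s \<in> carrier R" by auto
      show "\<zero>\<^bsub>loc\<^esub> \<oplus>\<^bsub>loc\<^esub> x = x"
        using * S1 cr by (simp del: Diff_iff)
      have "lfrac ((\<ominus> a) \<otimes> s \<oplus> a \<otimes> s) (s \<otimes> s) = lfrac \<zero> \<one>"
      proof (rule loc_frac_eqI)
        show "((\<ominus> a) \<otimes> s \<oplus> a \<otimes> s) \<otimes> \<one> = \<zero> \<otimes> (s \<otimes> s)" using *(2) cr by algebra
      qed (use * S1 cr in \<open>simp_all del: Diff_iff\<close>)
      then have "lfrac (\<ominus> a) s \<oplus>\<^bsub>loc\<^esub> x = \<zero>\<^bsub>loc\<^esub>" using * by (simp del: Diff_iff)
      then show "\<exists>y\<in>carrier loc. y \<oplus>\<^bsub>loc\<^esub> x = \<zero>\<^bsub>loc\<^esub>"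
        using * loc_frac_closed[of "\<ominus> a" s] by (metis a_inv_closed)
    qed
    show "Group.comm_monoid loc"
    proof (rule comm_monoidI)
      fix x y assume "x \<in> carrier loc" "y \<in> carrier loc"
      then obtain a s b t where *: "x = lfrac a s" "a \<in> carrier R" "s \<in> compl" "y = lfrac b t" "b \<in> carrier R" "t \<in> compl"
        using exE by metis
      show "x \<otimes>\<^bsub>loc\<^esub> y \<in> carrier loc"
        using * by (simp del: Diff_iff add: loc_frac_closed)
      show "x \<otimes>\<^bsub>loc\<^esub> y = y \<otimes>\<^bsub>loc\<^esub> x"
        using * by (simp del: Diff_iff add: a_comm m_comm)
    next
      show "\<one>\<^bsub>loc\<^esub> \<in> carrier loc" using S1 by (simp del: Diff_iff add: loc_frac_closed)
    next
      fix x y z assume "x \<in> carrier loc" "y \<in> carrier loc" "z \<in> carrier loc"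
      then obtain a s b t c r where *: "x = lfrac a s" "a \<in> carrier R" "s \<in> compl" "y = lfrac b t" "b \<in> carrier R" "t \<in> compl"
          "z = lfrac c r" "c \<in> carrier R" "r \<in> compl"
        using exE by metis
      then show "x \<otimes>\<^bsub>loc\<^esub> y \<otimes>\<^bsub>loc\<^esub> z = x \<otimes>\<^bsub>loc\<^esub> (y \<otimes>\<^bsub>loc\<^esub> z)"
        by (simp del: Diff_iff add: m_assoc)
    next
      fix x assume "x \<in> carrier loc"
      then obtain a s where *: "x = lfrac a s" "a \<in> carrier R" "s \<in> compl"
        using exE by metis
      then show "\<one>\<^bsub>loc\<^esub> \<otimes>\<^bsub>loc\<^esub> x = x"
        using S1 by (simp del: Diff_iff)
    qed
    fix x y z assume "x \<in> carrier loc" "y \<in> carrier loc" "z \<in> carrier loc"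
    then obtain a s b t c r where *: "x = lfrac a s" "a \<in> carrier R" "s \<in> compl" "y = lfrac b t" "b \<in> carrier R" "t \<in> compl"
        "z = lfrac c r" "c \<in> carrier R" "r \<in> compl"
      using exE by metis
    then have cr: "s \<in> carrier R" "t \<in> carrier R" "r \<in> carrier R" by auto
    have "lfrac ((a \<otimes> t \<oplus> b \<otimes> s) \<otimes> c) ((s \<otimes> t) \<otimes> r)
        = lfrac ((a \<otimes> c) \<otimes> (t \<otimes> r) \<oplus> (b \<otimes> c) \<otimes> (s \<otimes> r)) ((s \<otimes> r) \<otimes> (t \<otimes> r))"
    proof (rule loc_frac_eqI)
      show "((a \<otimes> t \<oplus> b \<otimes> s) \<otimes> c) \<otimes> ((s \<otimes> r) \<otimes> (t \<otimes> r)) =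
        ((a \<otimes> c) \<otimes> (t \<otimes> r) \<oplus> (b \<otimes> c) \<otimes> (s \<otimes> r)) \<otimes> ((s \<otimes> t) \<otimes> r)"
        using *(2,5,8) cr by algebra
    qed (use * cr in \<open>simp_all del: Diff_iff\<close>)
    then show "(x \<oplus>\<^bsub>loc\<^esub> y) \<otimes>\<^bsub>loc\<^esub> z = x \<otimes>\<^bsub>loc\<^esub> z \<oplus>\<^bsub>loc\<^esub> y \<otimes>\<^bsub>loc\<^esub> z"
      using * by (simp del: Diff_iff)
  qed
qed


lemma localization_hom: "(\<lambda>a. lfrac a \<one>) \<in> ring_hom R loc"
  using compl_submonoid(1)
  by (intro ring_hom_memI)
     (simp_all del: Diff_iff add: loc_frac_closed localization_mult_frac localization_add_frac localization_one)

lemma localization_unit: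
  assumes "s \<in> compl"
  shows "lfrac s \<one> \<in> Units loc"
proof -
  interpret L: cring loc by (rule localization_cring)
  note S1 = compl_submonoid(1)
  have s: "s \<in> carrier R" using assms by auto
  have "lfrac s \<one> \<otimes>\<^bsub>loc\<^esub> lfrac \<one> s = \<one>\<^bsub>loc\<^esub>"
    using assms S1 s loc_frac_eqI[of s \<one> s \<one>]
    by (simp del: Diff_iff add: localization_mult_frac localization_one)
  moreover have "lfrac s \<one> \<in> carrier loc" "lfrac \<one> s \<in> carrier loc"
    using loc_frac_closed s S1 assms by blast+
  ultimately show ?thesis
    unfolding Units_def using L.m_comm[of "lfrac s \<one>" "lfrac \<one> s"] by auto
qed

lemma localization_frac:
  assumes "x \<in> carrier loc"
  shows "\<exists>a\<in>carrier R. \<exists>s\<in>compl. x \<otimes>\<^bsub>loc\<^esub> lfrac s \<one> = lfrac a \<one>"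
proof -
  obtain a s where *: "x = lfrac a s" "a \<in> carrier R" "s \<in> compl"
    using assms localization_carrier_eq by auto
  have s: "s \<in> carrier R" using * by auto
  have "x \<otimes>\<^bsub>loc\<^esub> lfrac s \<one> = lfrac a \<one>"
    using * s compl_submonoid(1) loc_frac_eqI[of "a \<otimes> s" a s \<one>]
    by (simp del: Diff_iff add: localization_mult_frac)
  then show ?thesis using * by blast
qed

lemma localization_zero_iff:
  assumes "a \<in> carrier R"
  shows "lfrac a \<one> = \<zero>\<^bsub>loc\<^esub> \<longleftrightarrow> (\<exists>u\<in>compl. u \<otimes> a = \<zero>)"
  using assms compl_submonoid(1)
  by (simp del: Diff_iff add: localization_zero loc_frac_eq_iff minus_eq)

end

section \<open>Height and the spectrum of a localized quotient\<close>

text \<open>If every member is below \<open>Suc n\<close>, it is at most \<open>n\<close>, and so is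
  the supremum. The successor excludes the bound 0, which the supremum of the empty set also
  reaches.\<close>

lemma enat_Suc_le_Sup_iff: "enat (Suc n) \<le> Sup Y \<longleftrightarrow> (\<exists>x\<in>Y. enat (Suc n) \<le> x)"
proof
  assume *: "enat (Suc n) \<le> Sup Y"
  show "\<exists>x\<in>Y. enat (Suc n) \<le> x"
  proof (rule ccontr)
    assume "\<not> ?thesis"
    then have "x \<le> enat n" if "x \<in> Y" for x
      using that by (cases x) (auto simp: not_le not_less_eq_eq)
    then have "Sup Y \<le> enat n" by (rule Sup_least)
    with * show False by (metis enat_ord_simps(1) not_less_eq_eq order_refl order_trans)
  qed
qed (blast intro: order_trans Sup_upper)

text \<open>Rings are sets inside one type, so that polynomial rings in different sets of variables
  can be compared by inclusion and primes restricted by intersection.\<close>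

definition subring_set :: "'a::comm_ring_1 set \<Rightarrow> bool" where
  "subring_set D \<longleftrightarrow> 1 \<in> D \<and> (\<forall>x\<in>D. \<forall>y\<in>D. x - y \<in> D \<and> x * y \<in> D)"

lemma subring_set_closed:
  assumes "subring_set D"
  shows "0 \<in> D" "1 \<in> D" "x \<in> D \<Longrightarrow> - x \<in> D" "x \<in> D \<Longrightarrow> y \<in> D \<Longrightarrow> x + y \<in> D"
    "x \<in> D \<Longrightarrow> y \<in> D \<Longrightarrow> x - y \<in> D" "x \<in> D \<Longrightarrow> y \<in> D \<Longrightarrow> x * y \<in> D"
proof -
  show *: "1 \<in> D" "x \<in> D \<Longrightarrow> y \<in> D \<Longrightarrow> x - y \<in> D" "x \<in> D \<Longrightarrow> y \<in> D \<Longrightarrow> x * y \<in> D" for x y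
    using assms by (auto simp: subring_set_def)
  show 0: "0 \<in> D" using *(2)[OF *(1) *(1)] by simp
  show 1: "- x \<in> D" if "x \<in> D" for x using *(2)[OF 0 that] by simp
  show "x + y \<in> D" if "x \<in> D" "y \<in> D" using *(2)[OF that(1) 1[OF that(2)]] by simp
qed

lemma subring_set_power:
  assumes "subring_set D" "x \<in> D"
  shows "x ^ n \<in> D"
  using assms by (induction n) (auto simp: subring_set_closed)

lemma subring_set_sum:
  assumes "subring_set D" "\<And>x. x \<in> Y \<Longrightarrow> f x \<in> D"
  shows "sum f Y \<in> D"
  using assms(2) by (induction Y rule: infinite_finite_induct) (auto simp: subring_set_closed[OF assms(1)])

lemma subring_set_prod:
  assumes "subring_set D" "\<And>x. x \<in> Y \<Longrightarrow> f x \<in> D"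
  shows "prod f Y \<in> D"
  using assms(2) by (induction Y rule: infinite_finite_induct) (auto simp: subring_set_closed[OF assms(1)])

definition prime_in :: "'a::comm_ring_1 set \<Rightarrow> 'a set \<Rightarrow> bool" where
  "prime_in D P \<longleftrightarrow> P \<subseteq> D \<and> 0 \<in> P \<and> (\<forall>x\<in>P. \<forall>y\<in>P. x + y \<in> P) \<and> (\<forall>d\<in>D. \<forall>x\<in>P. d * x \<in> P) \<and>
     1 \<notin> P \<and> (\<forall>x\<in>D. \<forall>y\<in>D. x * y \<in> P \<longrightarrow> x \<in> P \<or> y \<in> P)"

lemma prime_inD:
  assumes "prime_in D P"
  shows "P \<subseteq> D" "0 \<in> P" "1 \<notin> P" "x \<in> P \<Longrightarrow> y \<in> P \<Longrightarrow> x + y \<in> P"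
    "d \<in> D \<Longrightarrow> x \<in> P \<Longrightarrow> d * x \<in> P" "d \<in> D \<Longrightarrow> x \<in> P \<Longrightarrow> x * d \<in> P"
    "x \<in> D \<Longrightarrow> y \<in> D \<Longrightarrow> x * y \<in> P \<longleftrightarrow> x \<in> P \<or> y \<in> P"
  using assms unfolding prime_in_def by (blast, blast, blast, blast, blast, metis mult.commute, metis mult.commute)

lemma prime_in_diff:
  assumes "prime_in D P" "subring_set D" "x \<in> P" "y \<in> P"
  shows "x - y \<in> P"
proof -
  have "(- 1) * y \<in> P" using assms by (intro prime_inD(5)) (auto simp: subring_set_closed)
  then show ?thesis using prime_inD(4)[OF assms(1,3)] by force
qed

lemma prime_in_sum:
  assumes "prime_in D P" "\<And>x. x \<in> Y \<Longrightarrow> f x \<in> P"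
  shows "sum f Y \<in> P"
  using assms(2) by (induction Y rule: infinite_finite_induct) (auto intro: prime_inD(2,4)[OF assms(1)])

lemma prime_in_prod:
  assumes "prime_in D P" "subring_set D" "finite Y" "\<And>x. x \<in> Y \<Longrightarrow> f x \<in> D"
  shows "prod f Y \<in> P \<longleftrightarrow> (\<exists>x\<in>Y. f x \<in> P)"
  using assms(3,4)
  by (induction Y) (auto simp: prime_inD(3,7)[OF assms(1)] subring_set_prod[OF assms(2)])

text \<open>The height of \<open>Q / I\<close> in \<open>D / I\<close>.\<close>

definition ht_over :: "'a::comm_ring_1 set \<Rightarrow> 'a set \<Rightarrow> 'a set \<Rightarrow> enat" where
  "ht_over D I Q = Sup {enat n | n. \<exists>c. (\<forall>i\<le>n. prime_in D (c i) \<and> I \<subseteq> c i) \<and>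
     (\<forall>i<n. c i \<subset> c (Suc i)) \<and> c n = Q}"

text \<open>A chain that ends in \<open>Q\<close> becomes one of the same length that ends in
  \<open>Q'\<close> when its last member is replaced.\<close>

lemma ht_over_mono:
  assumes "prime_in D Q" "prime_in D Q'" "Q \<subseteq> Q'"
  shows "ht_over D I Q \<le> ht_over D I Q'"
proof -
  have "enat n \<le> ht_over D I Q'"
    if c: "\<forall>i\<le>n. prime_in D (c i) \<and> I \<subseteq> c i" "\<forall>i<n. c i \<subset> c (Suc i)" "c n = Q" for n c
    unfolding ht_over_def
  proof (rule Sup_upper, clarsimp, intro exI conjI)
    have "I \<subseteq> Q'" using c assms by blast
    then show "\<forall>i\<le>n. prime_in D ((c(n := Q')) i) \<and> I \<subseteq> (c(n := Q')) i"
      using c assms by auto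
    show "\<forall>i<n. (c(n := Q')) i \<subset> (c(n := Q')) (Suc i)"
    proof (intro allI impI)
      fix i assume i: "i < n"
      then have "c i \<subset> c (Suc i)" using c by auto
      then show "(c(n := Q')) i \<subset> (c(n := Q')) (Suc i)"
        using i c(3) assms(3) by (cases "Suc i = n") auto
    qed
    show "(c(n := Q')) n = Q'" by simp
  qed
  then show ?thesis
    by (subst ht_over_def) (auto intro!: Sup_least)
qed

lemma one_le_ht_over:
  assumes "prime_in D Q" "prime_in D Q'" "I \<subseteq> Q" "Q \<subset> Q'"
  shows "1 \<le> ht_over D I Q'"
  unfolding ht_over_def one_enat_def
  by (rule Sup_upper, clarsimp, rule exI[of _ "\<lambda>i. if i = 0 then Q else Q'"]) (use assms in \<open>auto simp: le_Suc_eq\<close>)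

lemma one_le_ht_overE:
  assumes "1 \<le> ht_over D I Q"
  obtains Q0 where "prime_in D Q0" "I \<subseteq> Q0" "Q0 \<subset> Q"
proof -
  obtain n c where c: "Suc 0 \<le> n" "\<forall>i\<le>n. prime_in D (c i) \<and> I \<subseteq> c i" "\<forall>i<n. c i \<subset> c (Suc i)" "c n = Q"
    using assms unfolding ht_over_def one_enat_def One_nat_def enat_Suc_le_Sup_iff by auto
  then obtain m where "n = Suc m" by (cases n) auto
  then show ?thesis using c by (intro that[of "c m"]) auto
qed

lemma two_le_ht_overE:
  assumes "enat 2 \<le> ht_over D I Q"
  obtains Q0 Q1 where "prime_in D Q0" "prime_in D Q1" "I \<subseteq> Q0" "Q0 \<subset> Q1" "Q1 \<subset> Q"
proof -
  obtain n c where c: "2 \<le> n" "\<forall>i\<le>n. prime_in D (c i) \<and> I \<subseteq> c i" "\<forall>i<n. c i \<subset> c (Suc i)" "c n = Q"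
    using assms unfolding ht_over_def numeral_2_eq_2 enat_Suc_le_Sup_iff by auto
  then obtain m where "n = Suc (Suc m)" by (metis add_2_eq_Suc le_Suc_ex)
  then show ?thesis using c by (intro that[of "c m" "c (Suc m)"]) auto
qed

text \<open>\<open>L\<close> is the localization of \<open>D / I\<close> at \<open>P / I\<close>, and \<open>h\<close> is the canonical map.\<close>

locale local_frac =
  fixes D I P :: "'a::comm_ring_1 set" and L :: "('l, 'm) ring_scheme" (structure) and h :: "'a \<Rightarrow> 'l"
  assumes subring_D: "subring_set D"
    and cring_L: "cring L"
    and prime_P: "prime_in D P"
    and I_subset_P: "I \<subseteq> P"
    and h_closed: "a \<in> D \<Longrightarrow> h a \<in> carrier L"
    and h_add: "a \<in> D \<Longrightarrow> b \<in> D \<Longrightarrow> h (a + b) = h a \<oplus> h b"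
    and h_mult: "a \<in> D \<Longrightarrow> b \<in> D \<Longrightarrow> h (a * b) = h a \<otimes> h b"
    and h_one: "h 1 = \<one>"
    and h_unit: "s \<in> D - P \<Longrightarrow> h s \<in> Units L"
    and h_frac: "x \<in> carrier L \<Longrightarrow> \<exists>a\<in>D. \<exists>s\<in>D - P. x \<otimes> h s = h a"
    and h_zero_iff: "a \<in> D \<Longrightarrow> h a = \<zero> \<longleftrightarrow> (\<exists>s\<in>D - P. s * a \<in> I)"
begin

sublocale L: cring L by (rule cring_L)

lemmas D_closed = subring_set_closed[OF subring_D]

lemma one_notin_P: "1 \<in> D - P"
  using D_closed prime_inD(3)[OF prime_P] by auto

lemma mult_notin_P: "s \<in> D - P \<Longrightarrow> t \<in> D - P \<Longrightarrow> s * t \<in> D - P"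
  using D_closed prime_inD(7)[OF prime_P] by auto

lemma h_I: "a \<in> I \<Longrightarrow> h a = \<zero>"
  using h_zero_iff[of a] one_notin_P I_subset_P prime_inD(1)[OF prime_P] by (metis mult_1 subsetD)

lemma h_0: "h 0 = \<zero>"
  using h_add[of 0 0] h_closed[of 0] D_closed(1) L.add.l_cancel_one' by auto

lemma h_diff:
  assumes "a \<in> D" "b \<in> D"
  shows "h (a - b) = h a \<ominus> h b"
proof -
  have "h (a - b) \<oplus> h b = h a" using h_add[of "a - b" b] assms D_closed by simp
  then show ?thesis
    using assms D_closed h_closed L.add.inv_solve_right[of "h (a - b)" "h a" "h b"] by (simp add: L.minus_eq)
qed

lemma h_eq_iff:
  assumes "a \<in> D" "b \<in> D"
  shows "h a = h b \<longleftrightarrow> (\<exists>s\<in>D - P. s * (a - b) \<in> I)"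
proof -
  have "h a = h b \<longleftrightarrow> h (a - b) = \<zero>"
    using assms h_closed by (simp add: h_diff L.r_right_minus_eq)
  then show ?thesis using h_zero_iff[of "a - b"] assms D_closed by simp
qed

lemma unit_cancel:
  assumes "s \<in> D - P" "x \<in> carrier L" "y \<in> carrier L" "x \<otimes> h s = y \<otimes> h s"
  shows "x = y"
  using assms h_unit[OF assms(1)] L.m_comm L.Units_l_cancel[of "h s" x y] L.Units_closed by metis

text \<open>The extension of \<open>Q\<close> to \<open>L\<close> with denominators cleared. For
  primes between \<open>I\<close> and \<open>P\<close>, any presentation of \<open>x\<close> as a
  fraction decides membership (\<open>mem_ext_iff\<close>).\<close>

definition exten :: "'a set \<Rightarrow> 'l set" where
  "exten Q = {x \<in> carrier L. \<exists>a\<in>Q. \<exists>s\<in>D - P. x \<otimes> h s = h a}"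

definition contr :: "'l set \<Rightarrow> 'a set" where
  "contr q = {a \<in> D. h a \<in> q}"

definition primes_below :: "'a set set" where
  "primes_below = {Q. prime_in D Q \<and> I \<subseteq> Q \<and> Q \<subseteq> P}"

text \<open>Two fractions \<open>a / s\<close> and \<open>a' / s'\<close> for the same
  \<open>x\<close> satisfy \<open>t * (a * s' - a' * s) \<in> I\<close> with \<open>t\<close>
  outside \<open>P\<close>. As \<open>I\<close> lies in \<open>Q\<close> and \<open>t * s'\<close>
  lies outside \<open>Q\<close>, primality moves membership from one numerator to the other.\<close>

lemma mem_ext_iff:
  assumes "Q \<in> primes_below" "x \<in> carrier L" "a \<in> D" "s \<in> D - P" "x \<otimes> h s = h a"
  shows "x \<in> exten Q \<longleftrightarrow> a \<in> Q"
proof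
  assume "x \<in> exten Q"
  then obtain a' s' where *: "a' \<in> Q" "s' \<in> D - P" "x \<otimes> h s' = h a'" unfolding exten_def by auto
  have Q: "prime_in D Q" "I \<subseteq> Q" "Q \<subseteq> P" using assms by (auto simp: primes_below_def)
  have D: "a' \<in> D" "s' \<in> D" "s \<in> D" using * assms Q(1) prime_inD(1) by auto
  have "h (a * s') = x \<otimes> h s \<otimes> h s'" using assms D by (simp add: h_mult)
  also have "\<dots> = x \<otimes> h s' \<otimes> h s" using assms(2) h_closed[OF D(2)] h_closed[OF D(3)] by algebra
  also have "\<dots> = h (a' * s)" using * D by (simp add: h_mult)
  finally obtain t where t: "t \<in> D - P" "t * (a * s' - a' * s) \<in> I"
    using h_eq_iff[of "a * s'" "a' * s"] assms D D_closed by auto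
  have "t * (a * s' - a' * s) + t * s * a' \<in> Q"
  proof (rule prime_inD(4)[OF Q(1)])
    show "t * (a * s' - a' * s) \<in> Q" using t Q(2) by auto
    show "t * s * a' \<in> Q" using t D *(1) D_closed by (intro prime_inD(5)[OF Q(1)]) auto
  qed
  then have "(t * s') * a \<in> Q" by (simp add: algebra_simps)
  moreover have "t * s' \<in> D - P" using t * mult_notin_P by simp
  ultimately show "a \<in> Q" using prime_inD(7)[OF Q(1), of "t * s'" a] assms Q(3) by auto
next
  assume "a \<in> Q" then show "x \<in> exten Q" unfolding exten_def using assms by auto
qed

lemma h_mem_ext_iff:
  assumes "Q \<in> primes_below" "a \<in> D"
  shows "h a \<in> exten Q \<longleftrightarrow> a \<in> Q"
  using mem_ext_iff[OF assms(1) h_closed[OF assms(2)] assms(2) one_notin_P] h_closed[OF assms(2)]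
  by (simp add: h_one)

lemma con_ext: "Q \<in> primes_below \<Longrightarrow> contr (exten Q) = Q"
  unfolding contr_def using h_mem_ext_iff by (auto simp: primes_below_def dest: prime_inD(1))

lemma ext_prime:
  assumes "Q \<in> primes_below"
  shows "primeideal (exten Q) L"
proof -
  have Q: "prime_in D Q" "I \<subseteq> Q" "Q \<subseteq> P" using assms by (auto simp: primes_below_def)
  have add: "x \<oplus> y \<in> exten Q" if xy: "x \<in> exten Q" "y \<in> exten Q" for x y
  proof -
    obtain a s b t where *: "a \<in> Q" "s \<in> D - P" "x \<otimes> h s = h a" "b \<in> Q" "t \<in> D - P" "y \<otimes> h t = h b"
      "x \<in> carrier L" "y \<in> carrier L" using xy unfolding exten_def by auto
    then have D: "a \<in> D" "b \<in> D" "s \<in> D" "t \<in> D" using prime_inD(1)[OF Q(1)] by auto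
    have "(x \<oplus> y) \<otimes> (h s \<otimes> h t) = x \<otimes> h s \<otimes> h t \<oplus> y \<otimes> h t \<otimes> h s"
      using *(7,8) h_closed[OF D(3)] h_closed[OF D(4)] by algebra
    then have "(x \<oplus> y) \<otimes> h (s * t) = x \<otimes> h s \<otimes> h t \<oplus> y \<otimes> h t \<otimes> h s"
      using D by (simp add: h_mult)
    also have "\<dots> = h (a * t + b * s)" using * D D_closed by (simp add: h_mult h_add)
    finally have "(x \<oplus> y) \<otimes> h (s * t) = h (a * t + b * s)" .
    moreover have "a * t + b * s \<in> Q" using * D prime_inD[OF Q(1)] by auto
    ultimately show ?thesis unfolding exten_def using * mult_notin_P[of s t] by auto
  qed
  have mul: "x \<otimes> y \<in> exten Q \<longleftrightarrow> x \<in> exten Q \<or> y \<in> exten Q" if xy: "x \<in> carrier L" "y \<in> carrier L" for x y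
  proof -
    obtain a s b t where *: "a \<in> D" "s \<in> D - P" "x \<otimes> h s = h a" "b \<in> D" "t \<in> D - P" "y \<otimes> h t = h b"
      using h_frac xy by metis
    then have D: "s \<in> D" "t \<in> D" by auto
    have "x \<otimes> y \<otimes> h (s * t) = (x \<otimes> h s) \<otimes> (y \<otimes> h t)"
      using xy h_closed[OF D(1)] h_closed[OF D(2)] unfolding h_mult[OF D] by algebra
    also have "\<dots> = h (a * b)" using * by (simp add: h_mult)
    finally have "x \<otimes> y \<otimes> h (s * t) = h (a * b)" .
    then have "x \<otimes> y \<in> exten Q \<longleftrightarrow> a * b \<in> Q"
      using * xy mult_notin_P D_closed by (intro mem_ext_iff[OF assms]) auto
    also have "\<dots> \<longleftrightarrow> x \<in> exten Q \<or> y \<in> exten Q"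
      using prime_inD(7)[OF Q(1)] * xy mem_ext_iff[OF assms] by metis
    finally show ?thesis .
  qed
  have sub: "exten Q \<subseteq> carrier L" unfolding exten_def by auto
  have "ideal (exten Q) L"
  proof (rule idealI[OF L.ring_axioms])
    show "subgroup (exten Q) (add_monoid L)"
    proof (rule L.add.subgroupI)
      show "exten Q \<noteq> {}" using h_mem_ext_iff[OF assms, of 0] prime_inD(2)[OF Q(1)] D_closed by auto
      fix x assume x: "x \<in> exten Q"
      then have "\<ominus> x = \<ominus> \<one> \<otimes> x" using sub L.l_minus[of \<one> x] by auto
      then show "\<ominus> x \<in> exten Q" using mul[of "\<ominus> \<one>" x] x sub by auto
    qed (use sub add in auto)
  qed (use mul sub in auto)
  moreover have "carrier L \<noteq> exten Q"
    using h_mem_ext_iff[OF assms, of 1] prime_inD(3)[OF Q(1)] D_closed h_one by auto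
  ultimately show ?thesis
    using mul by (intro primeidealI cring_L) auto
qed

lemma con_prime:
  assumes "primeideal q L"
  shows "contr q \<in> primes_below"
proof -
  interpret q: primeideal q L by fact
  have one: "\<one> \<notin> q" using q.I_notcarr q.one_imp_carrier by blast
  have "I \<subseteq> contr q"
    unfolding contr_def using h_I I_subset_P prime_inD(1)[OF prime_P] by (auto simp: q.zero_closed)
  moreover have "contr q \<subseteq> P"
  proof
    fix a assume a: "a \<in> contr q"
    show "a \<in> P"
    proof (rule ccontr)
      assume "a \<notin> P"
      then have u: "h a \<in> Units L" using a h_unit unfolding contr_def by auto
      then have "inv (h a) \<otimes> h a \<in> q" using a unfolding contr_def by (intro q.I_l_closed) auto
      then show False using one u by simp
    qed
  qed
  moreover have "prime_in D (contr q)"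
    unfolding prime_in_def contr_def
    using one q.I_l_closed q.I_prime q.a_closed h_closed
    by (auto simp: h_0 h_add h_mult h_one D_closed q.zero_closed)
  ultimately show ?thesis unfolding primes_below_def by auto
qed

lemma ext_con:
  assumes "primeideal q L"
  shows "exten (contr q) = q"
proof -
  interpret q: primeideal q L by fact
  have "x \<in> exten (contr q) \<longleftrightarrow> x \<in> q" if x: "x \<in> carrier L" for x
  proof -
    obtain a s where *: "a \<in> D" "s \<in> D - P" "x \<otimes> h s = h a" using h_frac x by metis
    have "x \<in> exten (contr q) \<longleftrightarrow> a \<in> contr q" by (rule mem_ext_iff[OF con_prime[OF assms] x *])
    also have "\<dots> \<longleftrightarrow> x \<otimes> h s \<in> q" using * unfolding contr_def by simp
    also have "\<dots> \<longleftrightarrow> x \<in> q"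
    proof
      assume "x \<otimes> h s \<in> q"
      moreover have "s \<notin> contr q" using con_prime[OF assms] * unfolding primes_below_def by auto
      ultimately show "x \<in> q" using q.I_prime[OF x h_closed[of s]] * unfolding contr_def by auto
    qed (use q.I_r_closed[of x "h s"] h_closed[of s] *(2) in auto)
    finally show ?thesis .
  qed
  then show ?thesis using q.Icarr unfolding exten_def by blast
qed

lemma ext_mono: "Q \<subseteq> Q' \<Longrightarrow> exten Q \<subseteq> exten Q'"
  unfolding exten_def by auto

lemma con_mono: "q \<subseteq> q' \<Longrightarrow> contr q \<subseteq> contr q'"
  unfolding contr_def by auto

lemma ext_subset_iff: "Q \<in> primes_below \<Longrightarrow> Q' \<in> primes_below \<Longrightarrow> exten Q \<subseteq> exten Q' \<longleftrightarrow> Q \<subseteq> Q'"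
  using ext_mono con_mono con_ext by metis

lemma ext_inj: "Q \<in> primes_below \<Longrightarrow> Q' \<in> primes_below \<Longrightarrow> exten Q = exten Q' \<longleftrightarrow> Q = Q'"
  using con_ext by metis

lemma primeideal_iff: "primeideal q L \<longleftrightarrow> (\<exists>Q\<in>primes_below. q = exten Q)"
  using ext_prime con_prime ext_con by metis

lemma P_below: "P \<in> primes_below"
  unfolding primes_below_def using prime_P I_subset_P by auto

lemma unit_of_notin:
  assumes "x \<in> carrier L" "x \<notin> exten P"
  shows "x \<in> Units L"
proof -
  obtain a s where *: "a \<in> D" "s \<in> D - P" "x \<otimes> h s = h a" using h_frac assms by metis
  then have "a \<notin> P" using mem_ext_iff[OF P_below] assms by auto
  then have "x \<otimes> h s \<in> Units L" using * h_unit by auto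
  then show ?thesis
    using L.prod_unit_r[OF _ h_unit[OF *(2)] assms(1)] L.Units_closed[OF h_unit[OF *(2)]] by blast
qed

text \<open>Evaluates the definite description in \<open>local_depth\<close>: elements outside
  \<open>exten P\<close> are units, so every proper ideal lies in \<open>exten P\<close>.\<close>

lemma the_maximalideal: "(THE m. maximalideal m L) = exten P"
proof (rule the_equality)
  interpret p: primeideal "exten P" L using ext_prime P_below by auto
  show max: "maximalideal (exten P) L"
  proof (rule maximalidealI)
    show "ideal (exten P) L" using p.is_ideal .
    show "carrier L \<noteq> exten P" using p.I_notcarr .
    fix J assume J: "ideal J L" "exten P \<subseteq> J" "J \<subseteq> carrier L"
    show "J = exten P \<or> J = carrier L"
    proof (cases "J = exten P")
      case False
      then obtain x where x: "x \<in> J" "x \<notin> exten P" using J by auto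
      then have u: "x \<in> Units L" using J unit_of_notin by auto
      interpret J: ideal J L by fact
      have "inv x \<otimes> x \<in> J" using x u by (intro J.I_l_closed) auto
      then show ?thesis using u J.one_imp_carrier by simp
    qed simp
  qed
  fix m assume m: "maximalideal m L"
  then obtain Q where Q: "Q \<in> primes_below" "m = exten Q"
    using L.maximalideal_prime primeideal_iff by auto
  then have "m \<subseteq> exten P" using ext_mono unfolding primes_below_def by auto
  moreover have "exten P \<subseteq> carrier L" unfolding exten_def by auto
  ultimately show "m = exten P"
    using maximalideal.I_maximal[OF m p.is_ideal] p.I_notcarr by auto
qed


text \<open>The chains in \<open>ht_over\<close> are not restricted to primes inside
  \<open>P\<close>, but a chain that ends in \<open>Q\<close> stays below \<open>P\<close> by
  itself, so extension and contraction carry chains to chains of the same length.\<close>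

lemma prime_height_ext:
  assumes "Q \<in> primes_below"
  shows "prime_height L (exten Q) = ht_over D I Q"
proof -
  have QP: "Q \<subseteq> P" using assms unfolding primes_below_def by auto
  have "(\<exists>c. prime_chain L n c \<and> c n = exten Q) \<longleftrightarrow>
    (\<exists>c. (\<forall>i\<le>n. prime_in D (c i) \<and> I \<subseteq> c i) \<and> (\<forall>i<n. c i \<subset> c (Suc i)) \<and> c n = Q)" for n
  proof
    assume "\<exists>c. prime_chain L n c \<and> c n = exten Q"
    then obtain c where c: "\<And>i. i \<le> n \<Longrightarrow> primeideal (c i) L" "\<And>i. i < n \<Longrightarrow> c i \<subset> c (Suc i)" "c n = exten Q"
      unfolding prime_chain_def by auto
    have "contr (c i) \<subset> contr (c (Suc i))" if "i < n" for i
      using c(2)[OF that] con_mono[of "c i" "c (Suc i)"] ext_con[OF c(1), of i] ext_con[OF c(1), of "Suc i"] that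
      by (metis Suc_leI less_imp_le psubset_eq)
    moreover have "\<forall>i\<le>n. prime_in D (contr (c i)) \<and> I \<subseteq> contr (c i)"
      using con_prime c(1) unfolding primes_below_def by auto
    ultimately show "\<exists>c. (\<forall>i\<le>n. prime_in D (c i) \<and> I \<subseteq> c i) \<and> (\<forall>i<n. c i \<subset> c (Suc i)) \<and> c n = Q"
      using c(3) con_ext[OF assms] by (intro exI[of _ "\<lambda>i. contr (c i)"]) auto
  next
    assume "\<exists>c. (\<forall>i\<le>n. prime_in D (c i) \<and> I \<subseteq> c i) \<and> (\<forall>i<n. c i \<subset> c (Suc i)) \<and> c n = Q"
    then obtain c where c: "\<And>i. i \<le> n \<Longrightarrow> prime_in D (c i) \<and> I \<subseteq> c i" "\<And>i. i < n \<Longrightarrow> c i \<subset> c (Suc i)" "c n = Q"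
      by auto
    have "c i \<subseteq> c n" if "i \<le> n" for i
      using that by (induction i rule: inc_induct) (use c(2) in auto)
    then have B: "c i \<in> primes_below" if "i \<le> n" for i
      using that c(1)[OF that] c(3) QP unfolding primes_below_def by blast
    have "exten (c i) \<subset> exten (c (Suc i))" if "i < n" for i
      using c(2)[OF that] B[of i] B[of "Suc i"] that ext_subset_iff ext_inj by (simp add: psubset_eq)
    then show "\<exists>c. prime_chain L n c \<and> c n = exten Q"
      unfolding prime_chain_def using B ext_prime c(3) by (intro exI[of _ "\<lambda>i. exten (c i)"]) auto
  qed
  then show ?thesis unfolding prime_height_def ht_over_def by simp
qed

text \<open>Every prime of \<open>L\<close> lies in \<open>exten P\<close>, so the last member of
  any chain can be replaced by \<open>exten P\<close>.\<close>

lemma krull_dim_eq: "krull_dim L = ht_over D I P"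
proof -
  have "prime_height L (exten P) = krull_dim L"
  proof (rule antisym)
    show "prime_height L (exten P) \<le> krull_dim L"
      unfolding prime_height_def krull_dim_def by (rule Sup_subset_mono) auto
    have "enat n \<le> prime_height L (exten P)" if c: "prime_chain L n c" for n c
      unfolding prime_height_def
    proof (rule Sup_upper, clarsimp, intro exI conjI)
      have "primeideal (c n) L" using c unfolding prime_chain_def by auto
      then have "c n \<subseteq> exten P" using primeideal_iff[of "c n"] ext_mono[of _ P] unfolding primes_below_def by blast
      moreover have "(c(n := exten P)) i \<subset> (c(n := exten P)) (Suc i)" if "c n \<subseteq> exten P" "i < n" for i
      proof -
        have "c i \<subset> c (Suc i)" using c that unfolding prime_chain_def by auto
        then show ?thesis using that by (cases "Suc i = n") auto
      qed
      ultimately show "prime_chain L n (c(n := exten P))"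
        using c ext_prime[OF P_below] unfolding prime_chain_def by simp
    qed simp
    then show "krull_dim L \<le> prime_height L (exten P)" unfolding krull_dim_def by (auto intro!: Sup_least)
  qed
  then show ?thesis using prime_height_ext[OF P_below] by simp
qed

lemma all_primeideal_iff: "(\<forall>q. primeideal q L \<longrightarrow> R q) \<longleftrightarrow> (\<forall>Q\<in>primes_below. R (exten Q))"
proof (intro iffI ballI allI impI)
  fix Q assume "\<forall>q. primeideal q L \<longrightarrow> R q" "Q \<in> primes_below"
  then show "R (exten Q)" using ext_prime by blast
next
  fix q assume *: "\<forall>Q\<in>primes_below. R (exten Q)" "primeideal q L"
  then have "R (exten (contr q))" using con_prime by blast
  then show "R q" using ext_con[OF *(2)] by simp
qed

section \<open>Minimal primes of the localization and heights of their sums\<close>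

definition minimal_below :: "'a set set" where
  "minimal_below = {Q \<in> primes_below. \<forall>Q'. prime_in D Q' \<longrightarrow> I \<subseteq> Q' \<longrightarrow> Q' \<subseteq> Q \<longrightarrow> Q' = Q}"

lemma minimal_primes_eq: "minimal_primes L = exten ` minimal_below"
proof -
  have iff: "exten Q \<in> minimal_primes L \<longleftrightarrow> Q \<in> minimal_below" if Q: "Q \<in> primes_below" for Q
  proof -
    have "exten Q \<in> minimal_primes L \<longleftrightarrow> (\<forall>Q'\<in>primes_below. exten Q' \<subseteq> exten Q \<longrightarrow> exten Q' = exten Q)"
      unfolding minimal_primes_def all_primeideal_iff using ext_prime[OF Q] by simp
    also have "\<dots> \<longleftrightarrow> (\<forall>Q'\<in>primes_below. Q' \<subseteq> Q \<longrightarrow> Q' = Q)"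
      using ext_subset_iff[OF _ Q] ext_inj[OF _ Q] by (intro ball_cong) simp_all
    also have "\<dots> \<longleftrightarrow> Q \<in> minimal_below"
    proof -
      have "Q' \<in> primes_below \<longleftrightarrow> prime_in D Q' \<and> I \<subseteq> Q'" if "Q' \<subseteq> Q" for Q'
        using Q that unfolding primes_below_def by simp (metis subset_trans)
      then have "(\<forall>Q'\<in>primes_below. Q' \<subseteq> Q \<longrightarrow> Q' = Q) \<longleftrightarrow>
          (\<forall>Q'. prime_in D Q' \<longrightarrow> I \<subseteq> Q' \<longrightarrow> Q' \<subseteq> Q \<longrightarrow> Q' = Q)" by metis
      then show ?thesis using Q unfolding minimal_below_def by simp
    qed
    finally show ?thesis .
  qed
  show ?thesis
  proof (intro equalityI subsetI)
    fix q assume q: "q \<in> minimal_primes L"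
    then obtain Q where Q: "Q \<in> primes_below" "q = exten Q"
      using primeideal_iff[of q] unfolding minimal_primes_def by auto
    then show "q \<in> exten ` minimal_below" using iff[OF Q(1)] q by blast
  next
    fix q assume "q \<in> exten ` minimal_below"
    then obtain Q where Q: "Q \<in> minimal_below" "q = exten Q" by blast
    then have "Q \<in> primes_below" unfolding minimal_below_def by simp
    then show "q \<in> minimal_primes L" using iff Q by simp
  qed
qed

text \<open>A prime of \<open>L\<close> contains the sum exactly if its contraction contains
  \<open>Q1\<close> and \<open>Q2\<close>, that is, contains \<open>Q\<close>; by monotonicity the
  infimum in \<open>height\<close> is then attained at \<open>Q\<close>. It is applied to variable
  ideals, whose sum is again a prime variable ideal.\<close>

lemma height_sum_eq:
  assumes "Q1 \<in> primes_below" "Q2 \<in> primes_below" "Q \<in> primes_below" "Q1 \<subseteq> Q" "Q2 \<subseteq> Q"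
    and least: "\<And>T. prime_in D T \<Longrightarrow> Q1 \<subseteq> T \<Longrightarrow> Q2 \<subseteq> T \<Longrightarrow> Q \<subseteq> T"
  shows "height L (exten Q1 <+>\<^bsub>L\<^esub> exten Q2) = ht_over D I Q"
proof -
  have iff: "exten Q1 <+>\<^bsub>L\<^esub> exten Q2 \<subseteq> exten T \<longleftrightarrow> Q \<subseteq> T" if T: "T \<in> primes_below" for T
  proof -
    interpret q1: primeideal "exten Q1" L using assms ext_prime by auto
    interpret q2: primeideal "exten Q2" L using assms ext_prime by auto
    interpret t: primeideal "exten T" L using T ext_prime by auto
    have "exten Q1 <+>\<^bsub>L\<^esub> exten Q2 \<subseteq> exten T \<longleftrightarrow> exten Q1 \<subseteq> exten T \<and> exten Q2 \<subseteq> exten T"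
    proof
      assume *: "exten Q1 <+>\<^bsub>L\<^esub> exten Q2 \<subseteq> exten T"
      have "x \<in> exten Q1 <+>\<^bsub>L\<^esub> exten Q2" if "x \<in> exten Q1" for x
      proof -
        have "x \<oplus> \<zero> \<in> exten Q1 <+>\<^bsub>L\<^esub> exten Q2"
          unfolding set_add_def' using that q2.zero_closed by blast
        then show ?thesis using q1.Icarr[OF that] by simp
      qed
      moreover have "x \<in> exten Q1 <+>\<^bsub>L\<^esub> exten Q2" if "x \<in> exten Q2" for x
      proof -
        have "\<zero> \<oplus> x \<in> exten Q1 <+>\<^bsub>L\<^esub> exten Q2"
          unfolding set_add_def' using that q1.zero_closed by blast
        then show ?thesis using q2.Icarr[OF that] by simp
      qed
      ultimately show "exten Q1 \<subseteq> exten T \<and> exten Q2 \<subseteq> exten T" using * by blast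
    next
      assume "exten Q1 \<subseteq> exten T \<and> exten Q2 \<subseteq> exten T"
      then show "exten Q1 <+>\<^bsub>L\<^esub> exten Q2 \<subseteq> exten T"
        unfolding set_add_def' using t.a_closed by auto
    qed
    also have "\<dots> \<longleftrightarrow> Q1 \<subseteq> T \<and> Q2 \<subseteq> T" using ext_subset_iff[OF assms(1) T] ext_subset_iff[OF assms(2) T] by simp
    also have "\<dots> \<longleftrightarrow> Q \<subseteq> T" using assms(4,5) least[of T] T unfolding primes_below_def by blast
    finally show ?thesis .
  qed
  have "{prime_height L p |p. primeideal p L \<and> exten Q1 <+>\<^bsub>L\<^esub> exten Q2 \<subseteq> p} = {ht_over D I T | T. T \<in> primes_below \<and> Q \<subseteq> T}"
  proof (intro equalityI subsetI)
    fix d assume "d \<in> {prime_height L p |p. primeideal p L \<and> exten Q1 <+>\<^bsub>L\<^esub> exten Q2 \<subseteq> p}"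
    then obtain T where "T \<in> primes_below" "d = prime_height L (exten T)" "exten Q1 <+>\<^bsub>L\<^esub> exten Q2 \<subseteq> exten T"
      unfolding primeideal_iff by blast
    then show "d \<in> {ht_over D I T | T. T \<in> primes_below \<and> Q \<subseteq> T}"
      using iff prime_height_ext by blast
  next
    fix d assume "d \<in> {ht_over D I T | T. T \<in> primes_below \<and> Q \<subseteq> T}"
    then obtain T where "T \<in> primes_below" "d = ht_over D I T" "Q \<subseteq> T" by blast
    then show "d \<in> {prime_height L p |p. primeideal p L \<and> exten Q1 <+>\<^bsub>L\<^esub> exten Q2 \<subseteq> p}"
      using iff[of T] prime_height_ext[of T] ext_prime[of T] by (intro CollectI exI[of _ "exten T"]) simp
  qed
  then have "height L (exten Q1 <+>\<^bsub>L\<^esub> exten Q2) = Inf {ht_over D I T | T. T \<in> primes_below \<and> Q \<subseteq> T}"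
    unfolding height_def by simp
  also have "\<dots> = ht_over D I Q"
  proof (rule antisym)
    show "Inf {ht_over D I T | T. T \<in> primes_below \<and> Q \<subseteq> T} \<le> ht_over D I Q"
      using assms(3) by (intro Inf_lower) blast
    show "ht_over D I Q \<le> Inf {ht_over D I T | T. T \<in> primes_below \<and> Q \<subseteq> T}"
    proof (rule Inf_greatest)
      fix d assume "d \<in> {ht_over D I T | T. T \<in> primes_below \<and> Q \<subseteq> T}"
      then obtain T where "T \<in> primes_below" "d = ht_over D I T" "Q \<subseteq> T" by blast
      then show "ht_over D I Q \<le> d" using assms(3) ht_over_mono[of D Q T I] unfolding primes_below_def by simp
    qed
  qed
  finally show ?thesis .
qed

end

section \<open>Depth of a localized quotient\<close>

context local_frac
begin

lemma Suc_le_local_depth_iff: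
  "enat (Suc n) \<le> local_depth L \<longleftrightarrow>
     (\<exists>xs. regular_sequence L xs \<and> set xs \<subseteq> exten P \<and> Suc n \<le> length xs)"
  unfolding local_depth_def the_maximalideal enat_Suc_le_Sup_iff by auto

lemma Idl_empty: "Idl {} = {\<zero>}"
  using L.genideal_minimal[OF L.zeroideal, of "{}"] L.genideal_ideal[of "{}"]
    additive_subgroup.zero_closed[OF ideal.axioms(1)] by blast

lemma Idl_single: "x \<in> carrier L \<Longrightarrow> Idl {x} = {y \<otimes> x | y. y \<in> carrier L}"
  using L.cgenideal_eq_genideal[of x] unfolding cgenideal_def by simp

lemma Idl_ext_proper: "set xs \<subseteq> exten P \<Longrightarrow> Idl (set xs) \<noteq> carrier L"
proof -
  assume xs: "set xs \<subseteq> exten P"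
  interpret p: primeideal "exten P" L using ext_prime P_below by auto
  have "Idl (set xs) \<subseteq> exten P" using xs by (intro L.genideal_minimal p.is_ideal)
  moreover have "exten P \<subseteq> carrier L" unfolding exten_def by auto
  ultimately show ?thesis using p.I_notcarr by auto
qed

lemma h_unit_eq_zero:
  assumes "s \<in> D - P" "x \<in> carrier L"
  shows "x \<otimes> h s = \<zero> \<longleftrightarrow> x = \<zero>"
  using unit_cancel[OF assms, of \<zero>] assms h_closed by auto

lemma h_nonzerodivisor:
  assumes "a \<in> D" and nzd: "\<And>c. c \<in> D \<Longrightarrow> h (a * c) = \<zero> \<Longrightarrow> h c = \<zero>"
    and z: "z \<in> carrier L" "h a \<otimes> z = \<zero>"
  shows "z = \<zero>"
proof -
  obtain c s where *: "c \<in> D" "s \<in> D - P" "z \<otimes> h s = h c" using h_frac z by metis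
  have "h (a * c) = h a \<otimes> (z \<otimes> h s)" using * assms(1) by (simp add: h_mult)
  also have "\<dots> = (h a \<otimes> z) \<otimes> h s" using *(2) z(1) h_closed assms(1) by (simp add: L.m_assoc)
  also have "\<dots> = \<zero>" unfolding z(2) using *(2) h_closed by simp
  finally have "h c = \<zero>" by (rule nzd[OF *(1)])
  then show ?thesis using h_unit_eq_zero[OF *(2) z(1)] * by simp
qed

lemma one_le_local_depthI:
  assumes "a \<in> P" and nzd: "\<And>c. c \<in> D \<Longrightarrow> h (a * c) = \<zero> \<Longrightarrow> h c = \<zero>"
  shows "enat 1 \<le> local_depth L"
proof -
  have a: "a \<in> D" using assms(1) prime_inD(1)[OF prime_P] by auto
  have "regular_sequence L [h a]"
    unfolding regular_sequence_def
    using Idl_ext_proper[of "[h a]"] h_mem_ext_iff[OF P_below a] assms(1) h_closed[OF a] h_nonzerodivisor[OF a nzd]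
    by (auto simp: Idl_empty)
  then show ?thesis
    using Suc_le_local_depth_iff[of 0] h_mem_ext_iff[OF P_below a] assms(1)
    by (auto intro!: exI[of _ "[h a]"])
qed

text \<open>Regularity of \<open>h a, h b\<close> restated for numerators in \<open>D\<close>. The
  multiplier \<open>s\<close> in \<open>nzd2\<close> is there because a quotient by
  \<open>h a\<close> in \<open>L\<close> has a numerator in \<open>D\<close> only after a
  denominator outside \<open>P\<close> is cleared.\<close>

lemma two_le_local_depthI:
  assumes ab: "a \<in> P" "b \<in> P" and nzd: "\<And>c. c \<in> D \<Longrightarrow> h (a * c) = \<zero> \<Longrightarrow> h c = \<zero>"
    and nzd2: "\<And>c e. c \<in> D \<Longrightarrow> e \<in> D \<Longrightarrow> h (b * c - a * e) = \<zero> \<Longrightarrow>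
      \<exists>s\<in>D - P. \<exists>e\<in>D. h (s * c - a * e) = \<zero>"
  shows "enat 2 \<le> local_depth L"
proof -
  have a: "a \<in> D" and b: "b \<in> D" using ab prime_inD(1)[OF prime_P] by auto
  note ha = h_closed[OF a] and hb = h_closed[OF b]
  have reg2: "z \<in> Idl {h a}" if z: "z \<in> carrier L" "h b \<otimes> z \<in> Idl {h a}" for z
  proof -
    obtain y where y: "y \<in> carrier L" "h b \<otimes> z = y \<otimes> h a" using z Idl_single[OF ha] by auto
    obtain c s where c: "c \<in> D" "s \<in> D - P" "z \<otimes> h s = h c" using h_frac z by metis
    obtain e t where e: "e \<in> D" "t \<in> D - P" "y \<otimes> h t = h e" using h_frac y by metis
    have st: "s \<in> D" "t \<in> D" using c e by auto
    note hs = h_closed[OF st(1)] and ht = h_closed[OF st(2)]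
    have "h (b * (c * t)) = h b \<otimes> ((z \<otimes> h s) \<otimes> h t)"
      using a b c e st D_closed by (simp add: h_mult)
    also have "\<dots> = (h b \<otimes> z) \<otimes> (h s \<otimes> h t)" using z(1) hb hs ht by algebra
    also have "\<dots> = h a \<otimes> ((y \<otimes> h t) \<otimes> h s)" unfolding y(2) using y(1) ha hs ht by algebra
    also have "\<dots> = h (a * (e * s))" using a b c e st D_closed by (simp add: h_mult)
    finally have "h (b * (c * t) - a * (e * s)) = \<zero>"
      using a b c e st D_closed h_closed by (simp add: h_diff L.r_right_minus_eq)
    then obtain s' e' where s': "s' \<in> D - P" "e' \<in> D" "h (s' * (c * t) - a * e') = \<zero>"
      using nzd2[of "c * t" "e * s"] c e st D_closed by auto
    then have s'D: "s' \<in> D" by auto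
    \<comment> \<open>Collects the denominators \<open>s\<close> of \<open>z\<close> and
      \<open>t\<close> of \<open>y\<close> and the multiplier \<open>s'\<close> from
      \<open>nzd2\<close>; \<open>h u\<close> is a unit.\<close>
    define u where "u = s' * (s * t)"
    have u: "u \<in> D - P" unfolding u_def using s' c e mult_notin_P by blast
    have "h (s' * (c * t)) = h (a * e')"
      using s' s'D a c st D_closed h_closed by (simp add: h_diff L.r_right_minus_eq)
    moreover have "h (s' * (c * t)) = z \<otimes> h u"
    proof -
      have "h (s' * (c * t)) = h s' \<otimes> ((z \<otimes> h s) \<otimes> h t)" using s'D c st D_closed by (simp add: h_mult)
      also have "\<dots> = z \<otimes> (h s' \<otimes> (h s \<otimes> h t))" using z(1) h_closed[OF s'D] hs ht by algebra
      finally show ?thesis unfolding u_def using s'D st D_closed by (simp add: h_mult)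
    qed
    ultimately have eq: "z \<otimes> h u = h a \<otimes> h e'" using a s' by (simp add: h_mult)
    have U: "h u \<in> Units L" using h_unit u by simp
    have hu: "h u \<in> carrier L" "inv (h u) \<in> carrier L" using U by auto
    have "z = z \<otimes> h u \<otimes> inv (h u)" using z(1) U hu by (simp add: L.m_assoc)
    also have "\<dots> = (h e' \<otimes> inv (h u)) \<otimes> h a"
      unfolding eq using ha hu(2) h_closed[OF s'(2)] by algebra
    finally show ?thesis using Idl_single[OF ha] hu h_closed[OF s'(2)] by blast
  qed
  have "regular_sequence L [h a, h b]"
    unfolding regular_sequence_def
    using Idl_ext_proper[of "[h a, h b]"] h_mem_ext_iff[OF P_below a] h_mem_ext_iff[OF P_below b]
      ab ha hb h_nonzerodivisor[OF a nzd] reg2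
    by (auto simp: Idl_empty less_Suc_eq)
  then show ?thesis
    using Suc_le_local_depth_iff[of 1] h_mem_ext_iff[OF P_below a] h_mem_ext_iff[OF P_below b] ab
    by (auto simp: numeral_2_eq_2 intro!: exI[of _ "[h a, h b]"])
qed

text \<open>The first two members of a regular sequence suffice. Multiplying them by units turns
  them into images of elements of \<open>P\<close>, which does not affect regularity.\<close>

lemma two_le_local_depthE:
  assumes "enat 2 \<le> local_depth L"
  obtains a b where "a \<in> P" "b \<in> P" "\<And>c. c \<in> D \<Longrightarrow> h (a * c) = \<zero> \<Longrightarrow> h c = \<zero>"
    "\<And>c e. c \<in> D \<Longrightarrow> e \<in> D \<Longrightarrow> h (b * c - a * e) = \<zero> \<Longrightarrow> \<exists>s\<in>D - P. \<exists>e\<in>D. h (s * c - a * e) = \<zero>"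
proof -
  obtain xs where xs: "regular_sequence L xs" "set xs \<subseteq> exten P" "2 \<le> length xs"
    using assms Suc_le_local_depth_iff[of 1] by (auto simp: numeral_2_eq_2)
  define x y where "x = xs ! 0" and "y = xs ! 1"
  have len: "0 < length xs" "1 < length xs" using xs(3) by linarith+
  have mem: "x \<in> exten P" "y \<in> exten P"
    unfolding x_def y_def using xs(2) nth_mem[OF len(1)] nth_mem[OF len(2)] by blast+
  then have car: "x \<in> carrier L" "y \<in> carrier L" unfolding exten_def by auto
  have take1: "take 1 xs = [x]" unfolding x_def using xs(3) by (cases xs) auto
  have reg1: "z = \<zero>" if "z \<in> carrier L" "x \<otimes> z = \<zero>" for z
  proof -
    have "0 < length xs" using xs(3) by auto
    then have "xs ! 0 \<otimes> z \<in> Idl (set (take 0 xs)) \<longrightarrow> z \<in> Idl (set (take 0 xs))"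
      using xs(1) that(1) unfolding regular_sequence_def by blast
    then show ?thesis using that by (simp add: Idl_empty x_def)
  qed
  have reg2: "z \<in> Idl {x}" if "z \<in> carrier L" "y \<otimes> z \<in> Idl {x}" for z
  proof -
    have "1 < length xs" using xs(3) by auto
    then have "xs ! 1 \<otimes> z \<in> Idl (set (take 1 xs)) \<longrightarrow> z \<in> Idl (set (take 1 xs))"
      using xs(1) that(1) unfolding regular_sequence_def by blast
    then show ?thesis using that take1 by (simp add: y_def)
  qed
  obtain a s where a: "a \<in> P" "s \<in> D - P" "x \<otimes> h s = h a" using mem unfolding exten_def by auto
  obtain b t where b: "b \<in> P" "t \<in> D - P" "y \<otimes> h t = h b" using mem unfolding exten_def by auto
  have D: "a \<in> D" "b \<in> D" "s \<in> D" "t \<in> D" using a b prime_inD(1)[OF prime_P] by auto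
  note hs = h_closed[OF D(3)] and ht = h_closed[OF D(4)]
  show ?thesis
  proof (rule that[OF a(1) b(1)])
    fix c assume c: "c \<in> D" "h (a * c) = \<zero>"
    note hc = h_closed[OF c(1)]
    have "x \<otimes> (h c \<otimes> h s) = (x \<otimes> h s) \<otimes> h c" using car(1) hc hs by algebra
    also have "\<dots> = \<zero>" using c D a by (simp add: h_mult)
    finally have "h c \<otimes> h s = \<zero>" using reg1 hc hs by simp
    then show "h c = \<zero>" using h_unit_eq_zero a(2) hc by simp
  next
    fix c e assume c: "c \<in> D" "e \<in> D" "h (b * c - a * e) = \<zero>"
    note hc = h_closed[OF c(1)] and he = h_closed[OF c(2)]
    have "y \<otimes> (h t \<otimes> h c) = (y \<otimes> h t) \<otimes> h c" using car(2) hc ht by algebra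
    also have "\<dots> = h (b * c)" using b c D by (simp add: h_mult)
    also have "\<dots> = h (a * e)"
      using c D D_closed h_closed by (simp add: h_diff L.r_right_minus_eq)
    also have "\<dots> = (x \<otimes> h s) \<otimes> h e" using a c D by (simp add: h_mult)
    also have "\<dots> = (h s \<otimes> h e) \<otimes> x" using car(1) hs he by algebra
    finally have "y \<otimes> (h t \<otimes> h c) \<in> Idl {x}" using Idl_single[OF car(1)] hs he by blast
    then have "h t \<otimes> h c \<in> Idl {x}" using reg2 ht hc by simp
    then obtain w where w: "w \<in> carrier L" "h t \<otimes> h c = w \<otimes> x" using Idl_single[OF car(1)] by auto
    obtain d r where d: "d \<in> D" "r \<in> D - P" "w \<otimes> h r = h d" using h_frac w by metis
    have r: "r \<in> D" using d by auto
    note hr = h_closed[OF r]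
    have "h ((t * (r * s)) * c) = (h t \<otimes> h c) \<otimes> (h r \<otimes> h s)"
      using D r c D_closed ht hr hs hc by (simp add: h_mult L.m_ac)
    also have "\<dots> = (x \<otimes> h s) \<otimes> (w \<otimes> h r)" unfolding w(2) using car(1) w(1) hr hs by algebra
    also have "\<dots> = h (a * d)" using a d D by (simp add: h_mult)
    finally have "h ((t * (r * s)) * c - a * d) = \<zero>"
      using D r c d D_closed h_closed by (simp add: h_diff L.r_right_minus_eq)
    moreover have "t * (r * s) \<in> D - P" using a b d mult_notin_P by blast
    ultimately show "\<exists>s\<in>D - P. \<exists>e\<in>D. h (s * c - a * e) = \<zero>" using d(1) by blast
  qed
qed

end

section \<open>Localizing a quotient ring\<close>

definition subring_of :: "'a::comm_ring_1 set \<Rightarrow> 'a ring" where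
  "subring_of D = ring_of_type_algebra\<lparr>carrier := D\<rparr>"

lemma subring_of_simps:
  "carrier (subring_of D) = D" "x \<otimes>\<^bsub>subring_of D\<^esub> y = x * y" "x \<oplus>\<^bsub>subring_of D\<^esub> y = x + y"
  "\<one>\<^bsub>subring_of D\<^esub> = 1" "\<zero>\<^bsub>subring_of D\<^esub> = 0"
  by (simp_all add: subring_of_def ring_of_type_algebra_def)

lemma subring_of_cring:
  assumes "subring_set D"
  shows "cring (subring_of D)"
proof -
  note [simp] = subring_of_simps subring_set_closed[OF assms]
  show ?thesis
  proof (rule cringI)
    show "abelian_group (subring_of D)"
      by (rule abelian_groupI) (auto simp: algebra_simps intro: bexI[of _ "- x" for x])
    show "Group.comm_monoid (subring_of D)"
      by (rule comm_monoidI) (auto simp: algebra_simps)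
  qed (simp add: algebra_simps)
qed

locale quotient_of_subring =
  fixes D I :: "'a::comm_ring_1 set"
  assumes D: "subring_set D" and I_ideal: "ideal I (subring_of D)"
begin

abbreviation "S \<equiv> subring_of D"
abbreviation "R \<equiv> S Quot I"
abbreviation "\<pi> a \<equiv> I +>\<^bsub>S\<^esub> a"

lemma cring_S: "cring S" by (rule subring_of_cring[OF D])

lemma cring_R: "cring R" by (rule ideal.quotient_is_cring[OF I_ideal cring_S])

lemma carrier_R: "carrier R = \<pi> ` D"
  unfolding FactRing_def A_RCOSETS_def' by (auto simp: subring_of_simps)

lemma pi_hom:
  assumes "a \<in> D" "b \<in> D"
  shows "\<pi> a \<in> carrier R" "\<pi> (a + b) = \<pi> a \<oplus>\<^bsub>R\<^esub> \<pi> b" "\<pi> (a * b) = \<pi> a \<otimes>\<^bsub>R\<^esub> \<pi> b" "\<pi> 1 = \<one>\<^bsub>R\<^esub>"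
  using ideal.rcos_ring_hom[OF I_ideal] assms ring_hom_add ring_hom_mult ring_hom_one ring_hom_closed
  by (fastforce simp: subring_of_simps)+

lemma I_subset: "I \<subseteq> D"
  using additive_subgroup.a_subset[OF ideal.axioms(1)[OF I_ideal]] by (simp add: subring_of_simps)

lemma pi_zero_iff: "a \<in> D \<Longrightarrow> \<pi> a = \<zero>\<^bsub>R\<^esub> \<longleftrightarrow> a \<in> I"
proof -
  interpret S: cring S by (rule cring_S)
  interpret I: ideal I S by (rule I_ideal)
  assume "a \<in> D"
  then show ?thesis
    using I.a_rcos_self[of a] I.a_rcos_const[of a] by (auto simp: FactRing_def subring_of_simps)
qed

lemma pi_eq:
  assumes "a \<in> D" "b \<in> D" "\<pi> a = \<pi> b"
  shows "a - b \<in> I"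
proof -
  interpret R: cring R by (rule cring_R)
  have ab: "a - b \<in> D" using D assms by (simp add: subring_set_closed)
  have "\<pi> (a - b) \<oplus>\<^bsub>R\<^esub> \<pi> b = \<pi> b" using pi_hom(2)[OF ab assms(2)] assms(3) by simp
  then have "\<pi> (a - b) = \<zero>\<^bsub>R\<^esub>"
    using pi_hom(1)[OF ab assms(2)] pi_hom(1)[OF assms(2,2)] R.add.l_cancel_one by simp
  then show ?thesis using pi_zero_iff ab by simp
qed

section \<open>Primes of the quotient ring\<close>

definition preimage :: "'a set set \<Rightarrow> 'a set" where
  "preimage p = {a \<in> D. \<pi> a \<in> p}"

lemma preimage_prime:
  assumes "primeideal p R"
  shows "prime_in D (preimage p)" "I \<subseteq> preimage p"
proof -
  interpret p: primeideal p R by fact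
  have one: "\<one>\<^bsub>R\<^esub> \<notin> p" using p.I_notcarr p.one_imp_carrier by blast
  note [simp] = subring_set_closed[OF D]
  show I: "I \<subseteq> preimage p"
  proof
    fix a assume "a \<in> I"
    then have "a \<in> D" "\<pi> a = \<zero>\<^bsub>R\<^esub>" using I_subset pi_zero_iff by auto
    then show "a \<in> preimage p" using p.zero_closed by (simp add: preimage_def)
  qed
  have "0 \<in> I" using additive_subgroup.zero_closed[OF ideal.axioms(1)[OF I_ideal]]
    by (simp add: subring_of_simps)
  then have "0 \<in> preimage p" using I by auto
  then show "prime_in D (preimage p)"
    unfolding prime_in_def preimage_def
    using p.a_closed p.I_l_closed p.I_prime one pi_hom(1) by (auto simp: pi_hom(2,3) pi_hom(4)[of 1 1])
qed

lemma exists_prime_preimage: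
  assumes P: "prime_in D P" "I \<subseteq> P"
  shows "\<exists>p. primeideal p R \<and> preimage p = P"
proof (intro exI conjI)
  interpret R: cring R by (rule cring_R)
  note [simp] = subring_set_closed[OF D]
  have PD: "P \<subseteq> D" using P prime_inD by blast
  have mem: "\<pi> a \<in> \<pi> ` P \<longleftrightarrow> a \<in> P" if a: "a \<in> D" for a
  proof
    assume "\<pi> a \<in> \<pi> ` P"
    then obtain b where b: "b \<in> P" "\<pi> a = \<pi> b" by auto
    then have "a - b \<in> P" using pi_eq[of a b] a PD P by blast
    then have "(a - b) + b \<in> P" using b prime_inD(4)[OF P(1)] by blast
    then show "a \<in> P" by simp
  qed simp
  show "preimage (\<pi> ` P) = P" unfolding preimage_def using mem PD by blast
  have inv: "\<ominus>\<^bsub>R\<^esub> \<pi> a = \<pi> (- a)" if a: "a \<in> D" for a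
  proof -
    have "\<pi> (- a) \<oplus>\<^bsub>R\<^esub> \<pi> a = \<pi> 0" using a pi_hom(2)[of "- a" a] by simp
    also have "\<dots> = \<zero>\<^bsub>R\<^esub>" using pi_hom(2)[of 0 0] pi_hom(1)[of 0 0] R.add.l_cancel_one' by simp
    finally show ?thesis using R.minus_equality pi_hom(1) a by auto
  qed
  show "primeideal (\<pi> ` P) R"
  proof (rule primeidealI[OF _ cring_R])
    show "ideal (\<pi> ` P) R"
    proof (rule idealI[OF R.ring_axioms])
      show "subgroup (\<pi> ` P) (add_monoid R)"
      proof (rule R.add.subgroupI)
        show "\<pi> ` P \<subseteq> carrier R" using PD carrier_R by auto
        show "\<pi> ` P \<noteq> {}" using prime_inD(2)[OF P(1)] by auto
        fix A assume "A \<in> \<pi> ` P"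
        then obtain a where a: "a \<in> P" "A = \<pi> a" by auto
        have "- 1 * a \<in> P" by (rule prime_inD(5)[OF P(1) _ a(1)]) simp
        then show "\<ominus>\<^bsub>R\<^esub> A \<in> \<pi> ` P" using a PD inv by auto
      next
        fix A B assume "A \<in> \<pi> ` P" "B \<in> \<pi> ` P"
        then obtain a b where a: "a \<in> P" "A = \<pi> a" "b \<in> P" "B = \<pi> b" by auto
        then have "A \<oplus>\<^bsub>R\<^esub> B = \<pi> (a + b)" "a + b \<in> P" using pi_hom(2)[of a b] PD prime_inD(4)[OF P(1)] by auto
        then show "A \<oplus>\<^bsub>R\<^esub> B \<in> \<pi> ` P" by simp
      qed
    next
      fix A B assume "A \<in> \<pi> ` P" "B \<in> carrier R"
      then obtain a b where a: "a \<in> P" "A = \<pi> a" "b \<in> D" "B = \<pi> b" using carrier_R by auto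
      then have "B \<otimes>\<^bsub>R\<^esub> A = \<pi> (b * a)" "A \<otimes>\<^bsub>R\<^esub> B = \<pi> (a * b)" "b * a \<in> P" "a * b \<in> P"
        using pi_hom(3) PD prime_inD(5,6)[OF P(1)] by auto
      then show "B \<otimes>\<^bsub>R\<^esub> A \<in> \<pi> ` P" "A \<otimes>\<^bsub>R\<^esub> B \<in> \<pi> ` P" by simp_all
    qed
    have "\<pi> 1 \<notin> \<pi> ` P" using mem[of 1] prime_inD(3)[OF P(1)] by simp
    then show "carrier R \<noteq> \<pi> ` P" using pi_hom(1)[of 1 1] by auto
    fix A B assume "A \<in> carrier R" "B \<in> carrier R" "A \<otimes>\<^bsub>R\<^esub> B \<in> \<pi> ` P"
    then obtain a b where a: "a \<in> D" "A = \<pi> a" "b \<in> D" "B = \<pi> b" "\<pi> (a * b) \<in> \<pi> ` P"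
      using carrier_R pi_hom(3) by auto
    then have "a * b \<in> P" using mem by simp
    then show "A \<in> \<pi> ` P \<or> B \<in> \<pi> ` P" using prime_inD(7)[OF P(1) a(1,3)] a by auto
  qed
qed

text \<open>Combines quotient and localization: a multiple of a class vanishes modulo
  \<open>I\<close> exactly if the product of representatives lies in \<open>I\<close>, which is
  \<open>h_zero_iff\<close>. The later arguments see the localized ring only through this
  interface.\<close>

lemma local_frac_localization:
  assumes "primeideal p R"
  shows "local_frac D I (preimage p) (localization_at R p)
    (\<lambda>a. loc_frac R (carrier R - p) (\<pi> a) \<one>\<^bsub>R\<^esub>)"
proof -
  interpret p: primeideal p R by fact
  let ?h = "\<lambda>a. loc_frac R (carrier R - p) (\<pi> a) \<one>\<^bsub>R\<^esub>"
  note hom = p.localization_hom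
  have compl: "\<pi> s \<in> carrier R - p \<longleftrightarrow> s \<in> D - preimage p" if "s \<in> D" for s
    using pi_hom(1) that by (auto simp: preimage_def)
  show ?thesis
  proof (rule local_frac.intro)
    show "subring_set D" by (rule D)
    show "cring (localization_at R p)" by (rule p.localization_cring)
    show "prime_in D (preimage p)" by (rule preimage_prime(1)[OF assms])
    show "I \<subseteq> preimage p" by (rule preimage_prime(2)[OF assms])
    show "?h 1 = \<one>\<^bsub>localization_at R p\<^esub>"
      using pi_hom(4)[of 1 1] D by (simp add: subring_set_closed p.localization_one)
    show "?h a \<in> carrier (localization_at R p)" if "a \<in> D" for a
      using ring_hom_closed[OF hom] pi_hom(1) that by auto
    show "?h (a + b) = ?h a \<oplus>\<^bsub>localization_at R p\<^esub> ?h b" if "a \<in> D" "b \<in> D" for a b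
      using ring_hom_add[OF hom] pi_hom that by auto
    show "?h (a * b) = ?h a \<otimes>\<^bsub>localization_at R p\<^esub> ?h b" if "a \<in> D" "b \<in> D" for a b
      using ring_hom_mult[OF hom] pi_hom that by auto
    show "?h s \<in> Units (localization_at R p)" if "s \<in> D - preimage p" for s
      using p.localization_unit[of "\<pi> s"] compl that by auto
    show "\<exists>a\<in>D. \<exists>s\<in>D - preimage p. x \<otimes>\<^bsub>localization_at R p\<^esub> ?h s = ?h a"
      if x: "x \<in> carrier (localization_at R p)" for x
    proof -
      obtain A B where AB: "A \<in> carrier R" "B \<in> carrier R - p"
        "x \<otimes>\<^bsub>localization_at R p\<^esub> loc_frac R (carrier R - p) B \<one>\<^bsub>R\<^esub> = loc_frac R (carrier R - p) A \<one>\<^bsub>R\<^esub>"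
        using p.localization_frac[OF x] by blast
      then obtain a s where "a \<in> D" "A = \<pi> a" "s \<in> D" "B = \<pi> s" using carrier_R by auto
      then show ?thesis using AB compl by blast
    qed
    show "?h a = \<zero>\<^bsub>localization_at R p\<^esub> \<longleftrightarrow> (\<exists>s\<in>D - preimage p. s * a \<in> I)" if a: "a \<in> D" for a
    proof -
      have "?h a = \<zero>\<^bsub>localization_at R p\<^esub> \<longleftrightarrow> (\<exists>B\<in>carrier R - p. B \<otimes>\<^bsub>R\<^esub> \<pi> a = \<zero>\<^bsub>R\<^esub>)"
        using p.localization_zero_iff pi_hom(1) a by auto
      also have "\<dots> \<longleftrightarrow> (\<exists>s\<in>D - preimage p. \<pi> s \<otimes>\<^bsub>R\<^esub> \<pi> a = \<zero>\<^bsub>R\<^esub>)"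
      proof
        assume "\<exists>B\<in>carrier R - p. B \<otimes>\<^bsub>R\<^esub> \<pi> a = \<zero>\<^bsub>R\<^esub>"
        then obtain B where B: "B \<in> carrier R - p" "B \<otimes>\<^bsub>R\<^esub> \<pi> a = \<zero>\<^bsub>R\<^esub>" by blast
        then obtain s where "s \<in> D" "B = \<pi> s" using carrier_R by auto
        then show "\<exists>s\<in>D - preimage p. \<pi> s \<otimes>\<^bsub>R\<^esub> \<pi> a = \<zero>\<^bsub>R\<^esub>" using B compl by blast
      qed (use compl in blast)
      also have "\<dots> \<longleftrightarrow> (\<exists>s\<in>D - preimage p. s * a \<in> I)"
      proof (rule bex_cong[OF refl])
        fix s assume "s \<in> D - preimage p"
        then have s: "s \<in> D" by simp
        then have "s * a \<in> D" using a D by (simp add: subring_set_closed)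
        then show "\<pi> s \<otimes>\<^bsub>R\<^esub> \<pi> a = \<zero>\<^bsub>R\<^esub> \<longleftrightarrow> s * a \<in> I"
          using pi_zero_iff[of "s * a"] pi_hom(3)[OF s a] by simp
      qed
      finally show ?thesis .
    qed
  qed
qed

end

section \<open>Polynomials over a subring: primes are locally principal or of depth at least two\<close>

text \<open>In a domain, divisibility of \<open>c\<close> by \<open>f\<close> in the localization at
  \<open>Q\<close>, with denominators cleared.\<close>

definition loc_dvd :: "'a::comm_ring_1 set \<Rightarrow> 'a set \<Rightarrow> 'a \<Rightarrow> 'a \<Rightarrow> bool" where
  "loc_dvd D Q f c \<longleftrightarrow> (\<exists>s\<in>D - Q. \<exists>h\<in>D. s * c = f * h)"

text \<open>In the second alternative \<open>Q\<close> is locally principal with separated powers, so it has height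
  at most 1. The alternative is proved by induction on the number of variables, without unique
  factorization: an element of \<open>Q\<close> of minimal degree among those with a coefficient outside
  \<open>q = Q \<inter> E\<close> has its leading coefficient outside \<open>q\<close>, so one can divide by it locally.\<close>

definition reg_or_principal :: "'a::comm_ring_1 set \<Rightarrow> 'a set \<Rightarrow> bool" where
  "reg_or_principal D Q \<longleftrightarrow>
     (\<exists>f\<in>Q. \<exists>g\<in>Q. f \<noteq> 0 \<and> (\<forall>c\<in>D. \<forall>h\<in>D. g * c = f * h \<longrightarrow> loc_dvd D Q f c)) \<or>
     (\<exists>f\<in>Q. (\<forall>c\<in>Q. loc_dvd D Q f c) \<and> (\<forall>c\<in>D. (\<forall>n. loc_dvd D Q (f ^ n) c) \<longrightarrow> c = 0))"

text \<open>The product of the individual multipliers is still outside the prime. It is used to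
  treat all coefficients of a polynomial with one multiplier.\<close>

lemma loc_dvd_common:
  assumes E: "subring_set E" and q: "prime_in E q" and f: "f \<in> E"
    and Y: "finite Y" "\<And>c. c \<in> Y \<Longrightarrow> loc_dvd E q f c"
  shows "\<exists>s\<in>E - q. \<forall>c\<in>Y. \<exists>h\<in>E. s * c = f * h"
  using Y
proof (induction Y)
  case empty
  then show ?case using subring_set_closed[OF E] prime_inD(3)[OF q] by auto
next
  case (insert x Y)
  then obtain s where s: "s \<in> E - q" "\<forall>c\<in>Y. \<exists>h\<in>E. s * c = f * h" by auto
  obtain s' h' where s': "s' \<in> E - q" "h' \<in> E" "s' * x = f * h'"
    using insert.prems[of x] unfolding loc_dvd_def by auto
  have "s * s' \<in> E - q" using s(1) s'(1) prime_inD(7)[OF q, of s s'] subring_set_closed(6)[OF E, of s s'] by blast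
  moreover have "\<exists>h\<in>E. (s * s') * c = f * h" if c: "c \<in> insert x Y" for c
  proof (cases "c = x")
    case True
    have "(s * s') * x = f * (s * h')" using s'(3) by (metis mult.assoc mult.left_commute)
    then show ?thesis using True s s'(2) subring_set_closed(6)[OF E, of s h'] by blast
  next
    case False
    then obtain h where h: "h \<in> E" "s * c = f * h" using s c by auto
    have "(s * s') * c = f * (s' * h)" using h(2) by (metis mult.assoc mult.left_commute)
    then show ?thesis using h s'(1) subring_set_closed(6)[OF E, of s' h] by blast
  qed
  ultimately show ?case by blast
qed

definition polys_over :: "'a::comm_ring_1 set \<Rightarrow> 'a poly set" where
  "polys_over E = {p. \<forall>i. poly.coeff p i \<in> E}"

lemma subring_set_polys_over:
  assumes "subring_set E"
  shows "subring_set (polys_over E)"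
  unfolding subring_set_def polys_over_def
  using subring_set_closed[OF assms]
  by (auto simp: coeff_mult coeff_1 intro!: subring_set_sum[OF assms])

lemma polys_over_const: "0 \<in> E \<Longrightarrow> [:e:] \<in> polys_over E \<longleftrightarrow> e \<in> E"
  unfolding polys_over_def by (auto simp: coeff_pCons split: nat.splits)

lemma polys_over_monom: "0 \<in> E \<Longrightarrow> e \<in> E \<Longrightarrow> Polynomial.monom e i \<in> polys_over E"
  unfolding polys_over_def by simp

lemma polys_over_div_const:
  assumes "p \<in> polys_over E" "0 \<in> E" "\<And>i. i \<le> Polynomial.degree p \<Longrightarrow> \<exists>h\<in>E. poly.coeff p i = f * h"
  shows "\<exists>H\<in>polys_over E. p = [:f:] * H"
proof -
  obtain h where h: "\<And>i. i \<le> Polynomial.degree p \<Longrightarrow> h i \<in> E \<and> poly.coeff p i = f * h i"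
    using assms(3) by metis
  define H where "H = (\<Sum>i\<le>Polynomial.degree p. Polynomial.monom (h i) i)"
  have cH: "poly.coeff H i = (if i \<le> Polynomial.degree p then h i else 0)" for i
    unfolding H_def by (auto simp: coeff_sum)
  have "p = [:f:] * H"
    by (rule poly_eqI) (use h cH coeff_eq_0[of p] in \<open>auto simp: not_le\<close>)
  moreover have "H \<in> polys_over E" unfolding polys_over_def using cH h assms by auto
  ultimately show ?thesis by blast
qed

locale prime_in_polys_over =
  fixes E :: "'a::idom set" and Q :: "'a poly set"
  assumes E: "subring_set E" and Q: "prime_in (polys_over E) Q"
begin

abbreviation "D \<equiv> polys_over E"

lemmas E_closed = subring_set_closed[OF E]
lemmas D = subring_set_polys_over[OF E]
lemmas D_closed = subring_set_closed[OF D]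

definition "q = {e \<in> E. [:e:] \<in> Q}"

lemma const_D: "[:e:] \<in> D \<longleftrightarrow> e \<in> E" by (rule polys_over_const[OF E_closed(1)])

lemma const_Q: "e \<in> E \<Longrightarrow> [:e:] \<in> Q \<longleftrightarrow> e \<in> q" by (simp add: q_def)

lemma prime_q: "prime_in E q"
  unfolding prime_in_def
proof (intro conjI ballI impI)
  show "q \<subseteq> E" "0 \<in> q" "1 \<notin> q" using prime_inD(2,3)[OF Q] E_closed(1) by (auto simp: q_def one_pCons)
  show "x + y \<in> q" if "x \<in> q" "y \<in> q" for x y
    using that prime_inD(4)[OF Q, of "[:x:]" "[:y:]"] E_closed by (simp add: q_def)
  show "d * x \<in> q" if "d \<in> E" "x \<in> q" for d x
    using that prime_inD(5)[OF Q, of "[:d:]" "[:x:]"] E_closed const_D by (simp add: q_def mult.commute)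
  show "x \<in> q \<or> y \<in> q" if "x \<in> E" "y \<in> E" "x * y \<in> q" for x y
    using that prime_inD(7)[OF Q, of "[:x:]" "[:y:]"] E_closed const_D by (simp add: q_def mult.commute)
qed

lemma mult_notin_Q: "s \<in> D - Q \<Longrightarrow> t \<in> D - Q \<Longrightarrow> s * t \<in> D - Q"
  using prime_inD(7)[OF Q, of s t] D_closed(6)[of s t] by blast

lemma const_notin_Q: "e \<in> E - q \<Longrightarrow> [:e:] \<in> D - Q"
  using const_D const_Q by auto

lemma coeff_E: "p \<in> D \<Longrightarrow> poly.coeff p i \<in> E"
  by (simp add: polys_over_def)

lemma const_loc_dvd:
  assumes c: "c \<in> D" and f: "f \<in> E" and "\<And>i. loc_dvd E q f (poly.coeff c i)"
  shows "\<exists>e\<in>E - q. \<exists>h\<in>D. [:e:] * c = [:f:] * h"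
proof -
  obtain s where s: "s \<in> E - q" "\<forall>x\<in>poly.coeff c ` {..Polynomial.degree c}. \<exists>h\<in>E. s * x = f * h"
    using loc_dvd_common[OF E prime_q f, of "poly.coeff c ` {..Polynomial.degree c}"] assms(3) by auto
  have "\<exists>H\<in>polys_over E. [:s:] * c = [:f:] * H"
  proof (rule polys_over_div_const)
    show "[:s:] * c \<in> polys_over E" using D_closed(6)[OF _ c, of "[:s:]"] s const_D[of s] by blast
    show "0 \<in> E" by (rule E_closed)
    fix i assume "i \<le> Polynomial.degree ([:s:] * c)"
    then have "i \<le> Polynomial.degree c" using degree_smult_le[of s c] by simp
    then show "\<exists>h\<in>E. poly.coeff ([:s:] * c) i = f * h" using s by simp
  qed
  then show ?thesis using s by blast
qed

text \<open>By \<open>qD\<close>, \<open>Q\<close> is the extension of \<open>q\<close> to the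
  polynomial ring. Divisibility by a constant is decided coefficientwise, so whatever
  \<open>q\<close> provides serves \<open>Q\<close> as a constant polynomial.\<close>

lemma reg_or_principal_extended:
  assumes qD: "\<And>p i. p \<in> Q \<Longrightarrow> poly.coeff p i \<in> q" and IH: "reg_or_principal E q"
  shows "reg_or_principal D Q"
  using IH[unfolded reg_or_principal_def]
proof
  assume "\<exists>f\<in>q. \<exists>g\<in>q. f \<noteq> 0 \<and> (\<forall>c\<in>E. \<forall>h\<in>E. g * c = f * h \<longrightarrow> loc_dvd E q f c)"
  then obtain f g where fg: "f \<in> q" "g \<in> q" "f \<noteq> 0" "\<And>c h. c \<in> E \<Longrightarrow> h \<in> E \<Longrightarrow> g * c = f * h \<Longrightarrow> loc_dvd E q f c"
    by blast
  have E: "f \<in> E" "g \<in> E" using fg prime_inD(1)[OF prime_q] by auto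
  have "loc_dvd D Q [:f:] c" if c: "c \<in> D" "h \<in> D" "[:g:] * c = [:f:] * h" for c h
  proof -
    have "loc_dvd E q f (poly.coeff c i)" for i
    proof (rule fg(4))
      show "poly.coeff c i \<in> E" "poly.coeff h i \<in> E" using c coeff_E by auto
      show "g * poly.coeff c i = f * poly.coeff h i"
        using arg_cong[OF c(3), of "\<lambda>p. poly.coeff p i"] by simp
    qed
    then show ?thesis
      using const_loc_dvd[OF c(1) E(1)] const_notin_Q unfolding loc_dvd_def by blast
  qed
  moreover have "[:f:] \<in> Q" "[:g:] \<in> Q" "[:f:] \<noteq> 0" using fg const_Q E by auto
  ultimately show ?thesis unfolding reg_or_principal_def by blast
next
  assume "\<exists>f\<in>q. (\<forall>c\<in>q. loc_dvd E q f c) \<and> (\<forall>c\<in>E. (\<forall>n. loc_dvd E q (f ^ n) c) \<longrightarrow> c = 0)"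
  then obtain f where f: "f \<in> q" "\<And>c. c \<in> q \<Longrightarrow> loc_dvd E q f c"
    "\<And>c. c \<in> E \<Longrightarrow> (\<And>n. loc_dvd E q (f ^ n) c) \<Longrightarrow> c = 0" by blast
  have fE: "f \<in> E" using f prime_inD(1)[OF prime_q] by auto
  have fQ: "[:f:] \<in> Q" using f const_Q fE by auto
  have gen: "\<exists>e\<in>E - q. \<exists>h\<in>D. [:e:] * c = [:f:] * h" if "c \<in> Q" for c
    using const_loc_dvd[of c f] f(2) qD[OF that] that prime_inD(1)[OF Q] fE by blast
  \<comment> \<open>A multiplier outside \<open>Q\<close> is traded for a constant outside
    \<open>q\<close>, one factor of \<open>f\<close> at a time: divisibility by \<open>f\<close>
    puts \<open>c\<close> into \<open>Q\<close>, where \<open>gen\<close> applies, and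
    \<open>f\<close> cancels. Only constant multipliers allow the comparison of coefficients
    below.\<close>
  have const: "\<exists>e\<in>E - q. \<exists>h\<in>D. [:e:] * c = [:f:] ^ n * h" if "c \<in> D" "loc_dvd D Q ([:f:] ^ n) c" "f \<noteq> 0" for c n
    using that(1,2)
  proof (induction n arbitrary: c)
    case 0
    then show ?case using E_closed D_closed prime_inD(3)[OF prime_q] by (intro bexI[of _ 1] bexI[of _ c]) auto
  next
    case (Suc n)
    then obtain s h where s: "s \<in> D - Q" "h \<in> D" "s * c = [:f:] ^ Suc n * h" unfolding loc_dvd_def by blast
    have "[:f:] ^ Suc n * h = [:f:] * ([:f:] ^ n * h)" by (simp only: power_Suc mult.assoc)
    moreover have "[:f:] ^ n * h \<in> D"
      using subring_set_power[OF D] const_D fE s(2) D_closed(6) by metis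
    ultimately have "s * c \<in> Q"
      using prime_inD(6)[OF Q _ fQ] s(3) by simp
    then have "c \<in> Q" using prime_inD(7)[OF Q, of s c] s(1) Suc.prems(1) by blast
    then obtain e c1 where e: "e \<in> E - q" "c1 \<in> D" "[:e:] * c = [:f:] * c1" using gen by blast
    have "[:f:] * (s * c1) = s * ([:e:] * c)" unfolding e(3) by (simp only: mult.left_commute)
    also have "\<dots> = [:e:] * (s * c)" by (simp only: mult.left_commute)
    also have "\<dots> = [:f:] * ([:f:] ^ n * ([:e:] * h))" unfolding s(3) power_Suc by (simp only: mult.left_commute mult.assoc)
    finally have "s * c1 = [:f:] ^ n * ([:e:] * h)" using that(3) by (subst (asm) mult_cancel_left) simp
    moreover have "[:e:] * h \<in> D" using D_closed(6)[OF _ s(2), of "[:e:]"] e const_D[of e] by blast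
    ultimately have "loc_dvd D Q ([:f:] ^ n) c1" using s(1) unfolding loc_dvd_def by blast
    then obtain e' h' where e': "e' \<in> E - q" "h' \<in> D" "[:e':] * c1 = [:f:] ^ n * h'"
      using Suc.IH e(2) by blast
    have "[:e' * e:] * c = [:e':] * ([:e:] * c)" by (simp add: mult.commute)
    also have "\<dots> = [:f:] * ([:e':] * c1)" unfolding e(3) by (simp only: mult.left_commute)
    also have "\<dots> = [:f:] ^ Suc n * h'" unfolding e'(3) power_Suc by (simp only: mult.assoc)
    finally have "[:e' * e:] * c = [:f:] ^ Suc n * h'" .
    moreover have "e' * e \<in> E - q" using e(1) e'(1) prime_inD(7)[OF prime_q, of e' e] E_closed(6)[of e' e] by blast
    ultimately show ?case using e' by blast
  qed
  have "c = 0" if c: "c \<in> D" "\<And>n. loc_dvd D Q ([:f:] ^ n) c" for c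
  proof (cases "f = 0")
    case True
    then obtain s h where "s \<in> D - Q" "s * c = 0" using c(2)[of 1] unfolding loc_dvd_def by auto
    then show ?thesis using prime_inD(2)[OF Q] by auto
  next
    case False
    have "poly.coeff c i = 0" for i
    proof (rule f(3))
      show "poly.coeff c i \<in> E" using c coeff_E by auto
      fix n
      obtain e h where e: "e \<in> E - q" "h \<in> D" "[:e:] * c = [:f:] ^ n * h"
        using const[OF c(1) c(2) False] by blast
      have "e * poly.coeff c i = f ^ n * poly.coeff h i"
        using arg_cong[OF e(3), of "\<lambda>p. poly.coeff p i"] by (simp add: poly_const_pow)
      then show "loc_dvd E q (f ^ n) (poly.coeff c i)"
        unfolding loc_dvd_def using e coeff_E by blast
    qed
    then show ?thesis by (simp add: poly_eq_iff)
  qed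
  moreover have "loc_dvd D Q [:f:] c" if "c \<in> Q" for c
    using gen[OF that] const_notin_Q unfolding loc_dvd_def by blast
  ultimately show ?thesis unfolding reg_or_principal_def using fQ by blast
qed


text \<open>One step of pseudo-division by \<open>g\<close>: multiplying \<open>c\<close> by the
  leading coefficient of \<open>g\<close> avoids inverting it.\<close>

lemma reduce_top_coeff:
  assumes g: "g \<in> D" and c: "c \<in> D" "\<And>i. i > k + Polynomial.degree g \<Longrightarrow> poly.coeff c i = 0"
  defines "u \<equiv> lead_coeff g"
  defines "m \<equiv> Polynomial.monom (poly.coeff c (k + Polynomial.degree g)) k"
  shows "[:u:] * c - g * m \<in> D" "m \<in> D"
    "i \<ge> k + Polynomial.degree g \<Longrightarrow> poly.coeff ([:u:] * c - g * m) i = 0"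
proof -
  have u: "[:u:] \<in> D" unfolding u_def using coeff_E[OF g] const_D by simp
  show m: "m \<in> D" unfolding m_def by (intro polys_over_monom E_closed(1) coeff_E[OF c(1)])
  show "[:u:] * c - g * m \<in> D" by (intro D_closed(5,6) u m g c(1))
  assume i: "i \<ge> k + Polynomial.degree g"
  have "poly.coeff (g * m) i = poly.coeff g (i - k) * poly.coeff c (k + Polynomial.degree g)"
    using i unfolding m_def by (subst mult.commute[of g]) (simp add: coeff_monom_mult)
  then show "poly.coeff ([:u:] * c - g * m) i = 0"
    using c(2)[of i] coeff_eq_0[of g "i - k"] i unfolding u_def by (cases "i = k + Polynomial.degree g") auto
qed

lemma coeff_mult_top:
  fixes g c :: "'a poly"
  assumes "\<And>i. i > k \<Longrightarrow> poly.coeff c i = 0"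
  shows "poly.coeff (g * c) (Polynomial.degree g + k) = lead_coeff g * poly.coeff c k"
proof (cases "poly.coeff c k = 0")
  case False
  then have "Polynomial.degree c = k"
    using assms by (metis le_degree degree_le le_antisym)
  then show ?thesis using coeff_mult_degree_sum[of g c] by simp
next
  case True
  show ?thesis
  proof (cases "c = 0")
    case False
    have "Polynomial.degree c \<le> k" using assms by (intro degree_le) auto
    moreover have "Polynomial.degree c \<noteq> k" using True False leading_coeff_neq_0[of c] by auto
    ultimately have "Polynomial.degree (g * c) < Polynomial.degree g + k"
      using degree_mult_le[of g c] by linarith
    then show ?thesis using True coeff_eq_0 by simp
  qed simp
qed

text \<open>If the leading coefficient lay in \<open>q\<close>, subtracting the leading term would
  stay inside \<open>Q\<close>, keep a coefficient outside \<open>q\<close> and lower the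
  degree.\<close>

lemma exists_minimal_degree:
  assumes "\<not> (\<forall>p\<in>Q. \<forall>i. poly.coeff p i \<in> q)"
  obtains g where "g \<in> Q" "lead_coeff g \<in> E - q"
    "\<And>p. p \<in> Q \<Longrightarrow> (\<And>i. i \<ge> Polynomial.degree g \<Longrightarrow> poly.coeff p i = 0) \<Longrightarrow> (\<forall>i. poly.coeff p i \<in> q)"
proof -
  define N where "N = (LEAST n. \<exists>p\<in>Q. (\<forall>i\<ge>n. poly.coeff p i = 0) \<and> \<not> (\<forall>i. poly.coeff p i \<in> q))"
  obtain p where "p \<in> Q" "\<not> (\<forall>i. poly.coeff p i \<in> q)" using assms by blast
  then have "\<exists>p\<in>Q. (\<forall>i\<ge>Suc (Polynomial.degree p). poly.coeff p i = 0) \<and> \<not> (\<forall>i. poly.coeff p i \<in> q)"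
    by (intro bexI[of _ p]) (auto simp: coeff_eq_0)
  then have ex: "\<exists>n. \<exists>p\<in>Q. (\<forall>i\<ge>n. poly.coeff p i = 0) \<and> \<not> (\<forall>i. poly.coeff p i \<in> q)"
    by (metis (no_types, lifting) \<open>p \<in> Q\<close> \<open>\<not> (\<forall>i. poly.coeff p i \<in> q)\<close> coeff_eq_0 Suc_le_eq)
  obtain g where g: "g \<in> Q" "\<And>i. i \<ge> N \<Longrightarrow> poly.coeff g i = 0" "\<not> (\<forall>i. poly.coeff g i \<in> q)"
    using LeastI_ex[OF ex] unfolding N_def by blast
  have min: "\<forall>i. poly.coeff p i \<in> q" if "p \<in> Q" "\<And>i. i \<ge> n \<Longrightarrow> poly.coeff p i = 0" "n < N" for p n
    using not_less_Least[of n, OF that(3)[unfolded N_def]] that(1,2) by blast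
  have q0: "0 \<in> q" using prime_inD(2)[OF prime_q] .
  have gD: "g \<in> D" using g prime_inD(1)[OF Q] by blast
  define d where "d = Polynomial.degree g"
  have "g \<noteq> 0" using g(3) q0 by auto
  then have "poly.coeff g d \<noteq> 0" unfolding d_def by simp
  then have dN: "d < N" using g(2)[of d] by (meson not_le)
  have "lead_coeff g \<notin> q"
  proof
    assume l: "lead_coeff g \<in> q"
    define p where "p = g - [:lead_coeff g:] * Polynomial.monom 1 d"
    have cp: "poly.coeff p i = (if i = d then 0 else poly.coeff g i)" for i
      unfolding p_def d_def by simp
    have "[:lead_coeff g:] \<in> Q" using l const_Q coeff_E[OF gD] by blast
    moreover have "Polynomial.monom 1 d \<in> D" by (intro polys_over_monom E_closed(1,2))
    ultimately have "p \<in> Q"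
      unfolding p_def using g(1) by (intro prime_in_diff[OF Q D] prime_inD(6)[OF Q])
    moreover have "poly.coeff p i = 0" if "i \<ge> d" for i
      using that cp coeff_eq_0[of g i] unfolding d_def by auto
    ultimately have "\<forall>i. poly.coeff p i \<in> q" using min dN by blast
    then have "poly.coeff g i \<in> q" for i
      using cp[of i] l unfolding d_def by (cases "i = Polynomial.degree g") (auto, metis)
    then show False using g(3) by blast
  qed
  then show ?thesis
    using that[OF g(1)] coeff_E[OF gD] min[OF _ _ dN] unfolding d_def by blast
qed

text \<open>Locally \<open>g\<close> is monic up to a unit. If \<open>q\<close> contains some
  \<open>f \<noteq> 0\<close>, then \<open>g\<close> is regular modulo \<open>f\<close> by
  comparison of top coefficients. If \<open>q = {0}\<close>, pseudo-division by \<open>g\<close> is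
  exact on \<open>Q\<close>, so \<open>g\<close> generates \<open>Q\<close> locally, and degrees
  separate its powers.\<close>

lemma reg_or_principal_monic:
  assumes "\<not> (\<forall>p\<in>Q. \<forall>i. poly.coeff p i \<in> q)"
  shows "reg_or_principal D Q"
proof -
  obtain g where g: "g \<in> Q" "lead_coeff g \<in> E - q"
    and min: "\<And>p. p \<in> Q \<Longrightarrow> (\<And>i. i \<ge> Polynomial.degree g \<Longrightarrow> poly.coeff p i = 0) \<Longrightarrow> (\<forall>i. poly.coeff p i \<in> q)"
    using exists_minimal_degree[OF assms] by blast
  define u d where "u = lead_coeff g" and "d = Polynomial.degree g"
  have gD: "g \<in> D" using g prime_inD(1)[OF Q] by blast
  have u: "[:u:] \<in> D - Q" unfolding u_def using const_notin_Q g by blast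
  then have uD: "[:u:] \<in> D" by simp
  show ?thesis
  proof (cases "q = {0}")
    case False
    then obtain f where f: "f \<in> q" "f \<noteq> 0" using prime_inD(2)[OF prime_q] by blast
    then have fE: "f \<in> E" "[:f:] \<in> Q" "[:f:] \<in> D" using prime_inD(1)[OF prime_q] const_Q const_D by auto
    have "loc_dvd D Q [:f:] c" if "c \<in> D" "h \<in> D" "g * c = [:f:] * h" "\<And>i. i \<ge> n \<Longrightarrow> poly.coeff c i = 0" for c h n
      using that
    proof (induction n arbitrary: c h)
      case 0
      then have "c = 0" by (simp add: poly_eq_iff)
      then show ?case unfolding loc_dvd_def using u D_closed(1) by (intro bexI[of _ "[:u:]"] bexI[of _ 0]) auto
    next
      case (Suc n)
      \<comment> \<open>In \<open>g * c = [:f:] * h\<close> the coefficients at \<open>d + n\<close>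
        show that \<open>u\<close> times the top coefficient of \<open>c\<close> is \<open>f\<close>
        times that of \<open>h\<close>. Subtracting \<open>[:f:] * m\<close> from
        \<open>[:u:] * c\<close> therefore removes the top term, and the difference satisfies an
        equation of the same shape.\<close>
      define m where "m = Polynomial.monom (poly.coeff h (d + n)) n"
      have m: "m \<in> D" unfolding m_def by (intro polys_over_monom E_closed(1) coeff_E[OF Suc.prems(2)])
      define c' where "c' = [:u:] * c - [:f:] * m"
      have top: "u * poly.coeff c n = f * poly.coeff h (d + n)"
        using coeff_mult_top[of n c g] Suc.prems(3,4) by (simp add: u_def d_def)
      have mD: "[:u:] * c \<in> D" "[:f:] * m \<in> D" "[:u:] * h \<in> D" "g * m \<in> D"
        by (intro D_closed(6) uD fE gD m Suc.prems)+
      have "loc_dvd D Q [:f:] c'"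
      proof (rule Suc.IH)
        show "c' \<in> D" unfolding c'_def by (intro mD D_closed(5))
        show "[:u:] * h - g * m \<in> D" by (intro mD D_closed(5))
        have "g * c' = [:u:] * (g * c) - [:f:] * (g * m)"
          unfolding c'_def by (simp only: right_diff_distrib mult.left_commute)
        also have "\<dots> = [:f:] * ([:u:] * h - g * m)"
          unfolding Suc.prems(3) by (simp only: right_diff_distrib mult.left_commute)
        finally show "g * c' = [:f:] * ([:u:] * h - g * m)" .
        fix i assume "i \<ge> n"
        then show "poly.coeff c' i = 0"
          using Suc.prems(4)[of i] top by (cases "i = n") (auto simp: c'_def m_def)
      qed
      then obtain s h' where s: "s \<in> D - Q" "h' \<in> D" "s * c' = [:f:] * h'" unfolding loc_dvd_def by blast
      have "(s * [:u:]) * c = s * c' + [:f:] * (s * m)"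
        unfolding c'_def by (simp only: right_diff_distrib mult.left_commute mult.assoc) simp
      also have "\<dots> = [:f:] * (h' + s * m)" unfolding s(3) by (simp only: distrib_left)
      finally have "(s * [:u:]) * c = [:f:] * (h' + s * m)" .
      moreover have "h' + s * m \<in> D" using s by (intro D_closed(4,6) m) auto
      ultimately show ?case
        unfolding loc_dvd_def using mult_notin_Q[OF s(1) u] by blast
    qed
    note reg = this
    have "loc_dvd D Q [:f:] c" if "c \<in> D" "h \<in> D" "g * c = [:f:] * h" for c h
      using reg[OF that, of "Suc (Polynomial.degree c)"] coeff_eq_0 by (metis Suc_le_eq)
    then show ?thesis unfolding reg_or_principal_def using f fE g by (metis pCons_eq_0_iff)
  next
    case True
    have u0: "u \<noteq> 0" using g True unfolding u_def by auto
    have gen: "\<exists>e\<in>E - q. \<exists>h\<in>D. [:e:] * c = g * h" if "c \<in> Q" "\<And>i. i \<ge> n \<Longrightarrow> poly.coeff c i = 0" for c n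
      using that
    proof (induction n arbitrary: c)
      case 0
      then have "c = 0" by (simp add: poly_eq_iff)
      then show ?case using g D_closed(1) by auto
    next
      case (Suc n)
      show ?case
      proof (cases "Suc n \<le> d")
        \<comment> \<open>A remainder of degree below \<open>d\<close> has all its coefficients in
          \<open>q = {0}\<close> by minimality of \<open>g\<close>, so it is 0.\<close>
        case True
        then have "\<forall>i. poly.coeff c i \<in> q" using min Suc.prems unfolding d_def by (meson le_trans)
        then have "c = 0" using \<open>q = {0}\<close> by (simp add: poly_eq_iff)
        then show ?thesis using g D_closed(1) by auto
      next
        case False
        define k where "k = n - d"
        have k: "k + d = n" using False unfolding k_def by simp
        define m where "m = Polynomial.monom (poly.coeff c n) k"
        have cD: "c \<in> D" using Suc.prems prime_inD(1)[OF Q] by auto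
        have van: "poly.coeff c i = 0" if "i > k + Polynomial.degree g" for i
          using Suc.prems(2)[of i] that k unfolding d_def by auto
        have red: "m \<in> D" "\<And>i. i \<ge> n \<Longrightarrow> poly.coeff ([:u:] * c - g * m) i = 0"
          using reduce_top_coeff(2,3)[of g c k, OF gD cD] van
          unfolding u_def m_def k[symmetric] unfolding d_def by blast+
        have "\<exists>e\<in>E - q. \<exists>h\<in>D. [:e:] * ([:u:] * c - g * m) = g * h"
        proof (rule Suc.IH)
          show "[:u:] * c - g * m \<in> Q"
            by (intro prime_in_diff[OF Q D] prime_inD(5)[OF Q uD Suc.prems(1)] prime_inD(6)[OF Q red(1) g(1)])
        qed (rule red(2))
        then obtain e h where e: "e \<in> E - q" "h \<in> D" "[:e:] * ([:u:] * c - g * m) = g * h" by blast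
        have "[:e * u:] * c = [:e:] * ([:u:] * c - g * m) + g * ([:e:] * m)"
          by (simp add: algebra_simps)
        also have "\<dots> = g * (h + [:e:] * m)" unfolding e(3) by (simp only: distrib_left)
        finally have "[:e * u:] * c = g * (h + [:e:] * m)" .
        moreover have "h + [:e:] * m \<in> D" using e const_D by (intro D_closed(4,6) red(1)) auto
        moreover have "e * u \<in> E - q"
          using e(1) g(2) prime_inD(7)[OF prime_q, of e u] E_closed(6)[of e u] unfolding u_def by blast
        ultimately show ?thesis by blast
      qed
    qed
    have gen': "\<exists>e\<in>E - q. \<exists>h\<in>D. [:e:] * c = g * h" if "c \<in> Q" for c
      using gen[OF that, of "Suc (Polynomial.degree c)"] coeff_eq_0 by (metis Suc_le_eq)
    have d0: "d > 0"
    proof (rule ccontr)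
      assume "\<not> d > 0"
      then have "g = [:u:]" unfolding u_def d_def by (auto elim: degree_eq_zeroE)
      then show False using g(1) u by simp
    qed
    \<comment> \<open>Dividing a nonzero \<open>c\<close> by \<open>g\<close> lowers the degree,
      since \<open>d > 0\<close>, and the quotient is again divisible by all powers of
      \<open>g\<close>: an infinite descent.\<close>
    have "c = 0" if "c \<in> D" "\<And>n. loc_dvd D Q (g ^ n) c" for c
      using that
    proof (induction "Polynomial.degree c" arbitrary: c rule: less_induct)
      case (less c)
      show ?case
      proof (rule ccontr)
        assume c0: "c \<noteq> 0"
        obtain s h where s: "s \<in> D - Q" "h \<in> D" "s * c = g * h" using less.prems(2)[of 1] unfolding loc_dvd_def by auto
        then have "s * c \<in> Q" using prime_inD(6)[OF Q s(2) g(1)] by simp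
        then have "c \<in> Q" using prime_inD(7)[OF Q, of s c] s(1) less.prems(1) by blast
        then obtain e h where e: "e \<in> E - q" "h \<in> D" "[:e:] * c = g * h" using gen' by blast
        have e0: "e \<noteq> 0" using e True by auto
        have g0: "g \<noteq> 0" using d0 unfolding d_def by auto
        have h0: "h \<noteq> 0" using e(3) e0 c0 by auto
        have "Polynomial.degree c = d + Polynomial.degree h"
          using arg_cong[OF e(3), of Polynomial.degree] e0 g0 h0 unfolding d_def by (simp add: degree_mult_eq)
        then have "Polynomial.degree h < Polynomial.degree c" using d0 by simp
        moreover have "loc_dvd D Q (g ^ n) h" for n
        proof -
          obtain s h2 where s: "s \<in> D - Q" "h2 \<in> D" "s * c = g ^ Suc n * h2"
            using less.prems(2)[of "Suc n"] unfolding loc_dvd_def by blast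
          have "g * (s * h) = [:e:] * (s * c)" using e(3) by (metis mult.left_commute)
          also have "\<dots> = g * (g ^ n * ([:e:] * h2))" unfolding s(3) power_Suc by (simp only: mult.left_commute mult.assoc)
          finally have "s * h = g ^ n * ([:e:] * h2)" using g0 by (subst (asm) mult_cancel_left) simp
          moreover have "[:e:] * h2 \<in> D" using e(1) const_D by (intro D_closed(6) s(2)) auto
          ultimately show ?thesis unfolding loc_dvd_def using s by blast
        qed
        ultimately show False using less.hyps e(2) h0 by blast
      qed
    qed
    moreover have "loc_dvd D Q g c" if "c \<in> Q" for c
      using gen'[OF that] const_notin_Q unfolding loc_dvd_def by blast
    ultimately show ?thesis unfolding reg_or_principal_def using g by blast
  qed
qed

lemma reg_or_principal_step:
  assumes "reg_or_principal E q"
  shows "reg_or_principal D Q"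
proof (cases "\<forall>p\<in>Q. \<forall>i. poly.coeff p i \<in> q")
  case True
  show ?thesis
  proof (rule reg_or_principal_extended[OF _ assms])
    show "poly.coeff p i \<in> q" if "p \<in> Q" for p i
      using bspec[OF True that] by (rule spec)
  qed
next
  case False
  then show ?thesis by (rule reg_or_principal_monic)
qed

end

section \<open>Multivariate polynomials and variable ideals\<close>

type_synonym 'k mpoly = "(nat \<Rightarrow>\<^sub>0 nat) \<Rightarrow>\<^sub>0 'k"

abbreviation supp :: "('a \<Rightarrow>\<^sub>0 'b::zero) \<Rightarrow> 'a set" where "supp \<equiv> Poly_Mapping.keys"
abbreviation lkp :: "('a \<Rightarrow>\<^sub>0 'b::zero) \<Rightarrow> 'a \<Rightarrow> 'b" where "lkp \<equiv> Poly_Mapping.lookup"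
abbreviation sngl :: "'a \<Rightarrow> 'b \<Rightarrow> ('a \<Rightarrow>\<^sub>0 'b::zero)" where "sngl \<equiv> Poly_Mapping.single"

lemma poly_mapping_sum_single: "f = (\<Sum>m\<in>supp f. sngl m (lkp f m))"
proof (rule poly_mapping_eqI)
  fix k
  show "lkp f k = lkp (\<Sum>m\<in>supp f. sngl m (lkp f m)) k"
    by (cases "k \<in> supp f") (auto simp: lookup_sum lookup_single when_def in_keys_iff)
qed

lemma poly_mapping_add_induct [case_names zero single add]:
  assumes "P 0" "\<And>m c. m \<in> supp f \<Longrightarrow> P (sngl m c)" "\<And>g h. P g \<Longrightarrow> P h \<Longrightarrow> P (g + h)"
  shows "P (f :: 'a \<Rightarrow>\<^sub>0 'b::comm_monoid_add)"
proof -
  have "P (\<Sum>m\<in>Y. sngl m (lkp f m))" if "finite Y" "Y \<subseteq> supp f" for Y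
    using that by (induction Y) (auto simp: assms)
  from this[of "supp f"] show ?thesis using poly_mapping_sum_single[of f] by simp
qed

lemma keys_add_nat: "supp (m + m' :: 'a \<Rightarrow>\<^sub>0 nat) = supp m \<union> supp m'"
  by (auto simp: in_keys_iff lookup_add)

definition polys_in :: "nat set \<Rightarrow> ('k::field) mpoly set" where
  "polys_in V = {f. \<forall>m\<in>supp f. supp m \<subseteq> V}"

lemma polys_in_0 [simp]: "0 \<in> polys_in V" and polys_in_1 [simp]: "1 \<in> polys_in V"
  by (auto simp: polys_in_def)

lemma polys_in_uminus [simp]: "- f \<in> polys_in V \<longleftrightarrow> f \<in> polys_in V"
  by (auto simp: polys_in_def in_keys_iff)

lemma polys_in_add: "f \<in> polys_in V \<Longrightarrow> g \<in> polys_in V \<Longrightarrow> f + g \<in> polys_in V"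
  using Poly_Mapping.keys_add[of f g] by (auto simp: polys_in_def)

lemma polys_in_diff: "f \<in> polys_in V \<Longrightarrow> g \<in> polys_in V \<Longrightarrow> f - g \<in> polys_in V"
  using polys_in_add[of f V "- g"] by simp

lemma polys_in_mult: "f \<in> polys_in V \<Longrightarrow> g \<in> polys_in V \<Longrightarrow> f * g \<in> polys_in V"
  using keys_mult[of f g] by (fastforce simp: polys_in_def keys_add_nat)

lemma subring_polys_in: "subring_set (polys_in V)"
  unfolding subring_set_def by (auto simp: polys_in_diff polys_in_mult)

lemma polys_in_mono: "V \<subseteq> W \<Longrightarrow> polys_in V \<subseteq> polys_in W"
  by (auto simp: polys_in_def)

lemma polys_in_single [simp]: "sngl m c \<in> polys_in V \<longleftrightarrow> c = 0 \<or> supp m \<subseteq> V"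
  by (auto simp: polys_in_def)

text \<open>Substitution of 0 for the variables in \<open>U\<close>.\<close>

definition kill :: "nat set \<Rightarrow> ('k::field) mpoly \<Rightarrow> 'k mpoly" where
  "kill U f = Poly_Mapping.mapp (\<lambda>m c. c when supp m \<inter> U = {}) f"

lemma lookup_kill: "lkp (kill U f) m = (lkp f m when supp m \<inter> U = {})"
  by (auto simp: kill_def lookup_mapp when_def in_keys_iff)

lemma keys_kill: "supp (kill U f) = {m \<in> supp f. supp m \<inter> U = {}}"
proof (rule Set.set_eqI)
  fix m
  have "m \<in> supp (kill U f) \<longleftrightarrow> lkp (kill U f) m \<noteq> 0" by (rule in_keys_iff)
  also have "\<dots> \<longleftrightarrow> m \<in> {m \<in> supp f. supp m \<inter> U = {}}" by (auto simp: lookup_kill in_keys_iff[of m f])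
  finally show "m \<in> supp (kill U f) \<longleftrightarrow> m \<in> {m \<in> supp f. supp m \<inter> U = {}}" .
qed

lemma kill_0 [simp]: "kill U 0 = 0"
  and kill_add: "kill U (f + g) = kill U f + kill U g"
  and kill_uminus: "kill U (- f) = - kill U f"
  and kill_diff: "kill U (f - g) = kill U f - kill U g"
  and kill_kill: "kill U (kill W f) = kill (U \<union> W) f"
  by (rule poly_mapping_eqI; auto simp: lookup_kill lookup_add lookup_minus when_def)+

lemma kill_sum: "kill U (sum f Y) = (\<Sum>y\<in>Y. kill U (f y))"
  by (induction Y rule: infinite_finite_induct) (auto simp: kill_add)

lemma kill_single: "kill U (sngl m c) = (if supp m \<inter> U = {} then sngl m c else 0)"
  by (rule poly_mapping_eqI) (auto simp: lookup_kill lookup_single when_def)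

lemma kill_1 [simp]: "kill U 1 = 1"
  using kill_single[of U 0 1] by (simp add: single_one)

lemma kill_mult: "kill U (f * g) = kill U f * kill U g"
proof -
  have single: "kill U (sngl m c * g) = kill U (sngl m c) * kill U g" for m c
  proof (induction g rule: poly_mapping_add_induct)
    case (single m' c')
    show ?case by (auto simp: mult_single kill_single keys_add_nat Int_Un_distrib2)
  qed (auto simp: kill_add distrib_left)
  show ?thesis
    by (induction f rule: poly_mapping_add_induct) (auto simp: kill_add distrib_right single)
qed

lemma kill_prod: "kill U (prod f Y) = (\<Prod>y\<in>Y. kill U (f y))"
  by (induction Y rule: infinite_finite_induct) (auto simp: kill_mult)

lemma kill_in: "f \<in> polys_in V \<Longrightarrow> kill U f \<in> polys_in (V - U)"
  by (auto simp: polys_in_def keys_kill)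

lemma kill_closed: "f \<in> polys_in V \<Longrightarrow> kill U f \<in> polys_in V"
  by (auto simp: polys_in_def keys_kill)

lemma kill_id: "f \<in> polys_in V \<Longrightarrow> V \<inter> U = {} \<Longrightarrow> kill U f = f"
  by (rule poly_mapping_eqI) (fastforce simp: lookup_kill polys_in_def when_def in_keys_iff)

lemma kill_eq_0_mono: "kill U f = 0 \<Longrightarrow> U \<subseteq> W \<Longrightarrow> kill W f = 0"
  using kill_kill[of W U f] by (simp add: Un_absorb2)

text \<open>The ideal generated by the variables in \<open>V \<inter> U\<close>, encoded as the
  kernel of a substitution into a domain, so that primality is immediate.\<close>

definition var_ideal :: "nat set \<Rightarrow> nat set \<Rightarrow> ('k::field) mpoly set" where
  "var_ideal V U = {f \<in> polys_in V. kill U f = 0}"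

lemma prime_var_ideal: "prime_in (polys_in V) (var_ideal V U :: ('k::field) mpoly set)"
  unfolding prime_in_def var_ideal_def
  by (auto simp: polys_in_add polys_in_mult kill_add kill_mult)

lemma mem_var_ideal_iff:
  "f \<in> var_ideal V U \<longleftrightarrow> f \<in> polys_in V \<and> (\<forall>m\<in>supp f. supp m \<inter> U \<noteq> {})"
proof -
  have "kill U f = 0 \<longleftrightarrow> supp (kill U f) = {}" by simp
  then show ?thesis unfolding var_ideal_def by (auto simp: keys_kill)
qed

section \<open>Variables, their products, and gluing of polynomials\<close>

definition var :: "nat \<Rightarrow> ('k::field) mpoly" where "var i = sngl (sngl i 1) 1"

lemma var_in [simp]: "var i \<in> polys_in V \<longleftrightarrow> i \<in> V"
  by (simp add: var_def)

lemma var_nonzero [simp]: "var i \<noteq> 0"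
  by (metis var_def keys_single keys_zero insert_not_empty one_neq_zero)

lemma kill_var: "kill U (var i) = (if i \<in> U then 0 else var i)"
  by (auto simp: var_def kill_single)

lemma var_mem_var_ideal: "var i \<in> (var_ideal V U :: ('k::field) mpoly set) \<longleftrightarrow> i \<in> V \<and> i \<in> U"
  by (auto simp: var_ideal_def kill_var)

lemma kill_decomp:
  fixes f :: "('k::field) mpoly"
  assumes "f \<in> polys_in V" "kill {v} f = 0"
  shows "\<exists>g\<in>polys_in V. f = var v * g"
proof -
  define g :: "'k mpoly" where "g = (\<Sum>m\<in>supp f. sngl (m - sngl v 1) (lkp f m))"
  have m: "m = sngl v 1 + (m - sngl v 1)" if "m \<in> supp f" for m
  proof (rule poly_mapping_eqI)
    have "v \<in> supp m" using assms(2) that keys_kill[of "{v}" f] by auto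
    then have "lkp m v \<noteq> 0" by (simp add: in_keys_iff)
    then show "lkp m i = lkp (sngl v 1 + (m - sngl v 1)) i" for i
      by (auto simp: lookup_add lookup_minus lookup_single when_def)
  qed
  have "var v * g = (\<Sum>m\<in>supp f. sngl (sngl v 1 + (m - sngl v 1)) (lkp f m))"
    unfolding g_def var_def by (simp add: sum_distrib_left mult_single)
  also have "\<dots> = (\<Sum>m\<in>supp f. sngl m (lkp f m))" by (intro sum.cong refl arg_cong2[where f = sngl] m[symmetric])
  also have "\<dots> = f" by (rule poly_mapping_sum_single[symmetric])
  finally have "f = var v * g" ..
  moreover have "g \<in> polys_in V"
    unfolding g_def
  proof (rule subring_set_sum[OF subring_polys_in])
    fix m assume m: "m \<in> supp f"
    have "supp (m - sngl v 1) \<subseteq> supp m" by (auto simp: in_keys_iff lookup_minus)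
    then show "sngl (m - sngl v 1) (lkp f m) \<in> polys_in V" using m assms(1) by (auto simp: polys_in_def)
  qed
  ultimately show ?thesis by blast
qed

definition var_prod :: "nat set \<Rightarrow> ('k::field) mpoly" where "var_prod F = (\<Prod>i\<in>F. var i)"

lemma var_prod_in: "F \<subseteq> V \<Longrightarrow> var_prod F \<in> polys_in V"
  unfolding var_prod_def by (intro subring_set_prod[OF subring_polys_in]) auto

lemma var_prod_nonzero [simp]: "var_prod F \<noteq> 0"
  unfolding var_prod_def by (cases "finite F") auto

lemma kill_var_prod: "finite F \<Longrightarrow> kill U (var_prod F) = (if F \<inter> U = {} then var_prod F else 0)"
  unfolding var_prod_def kill_prod by (auto simp: kill_var prod_zero_iff intro!: prod.cong)

text \<open>Variables are split off one at a time: \<open>kill {v}\<close> fixes the product of the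
  others, so in a domain it must annihilate the remaining quotient.\<close>

lemma var_prod_dvd:
  fixes f :: "('k::field) mpoly"
  assumes "finite F" "f \<in> polys_in V" "\<And>v. v \<in> F \<Longrightarrow> kill {v} f = 0"
  shows "\<exists>g\<in>polys_in V. f = var_prod F * g"
  using assms(1,3)
proof (induction F)
  case empty
  then show ?case using assms(2) by (simp add: var_prod_def)
next
  case (insert v F)
  then obtain g where g: "g \<in> polys_in V" "f = var_prod F * g" by auto
  have "kill {v} f = var_prod F * kill {v} g" using g insert.hyps by (simp add: kill_mult kill_var_prod)
  then have "kill {v} g = 0" using insert.prems by simp
  then obtain h where "h \<in> polys_in V" "g = var v * h" using kill_decomp g by blast
  then show ?case using g insert.hyps by (auto simp: var_prod_def algebra_simps)
qed

lemma var_prod_mem_prime: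
  assumes "prime_in (polys_in V) P" "finite F" "F \<subseteq> V"
  shows "var_prod F \<in> P \<longleftrightarrow> (\<exists>i\<in>F. var i \<in> P)"
  unfolding var_prod_def using assms by (intro prime_in_prod[OF assms(1) subring_polys_in]) auto

text \<open>\<open>kill\<close> acts monomial by monomial, so the coefficient of \<open>m\<close>
  can be copied from any \<open>t C\<close> with \<open>C\<close> disjoint from
  \<open>supp m\<close>; \<open>compat\<close> makes the choice irrelevant. Monomials that meet
  every \<open>C\<close> get coefficient 0.\<close>

lemma glue:
  fixes t :: "nat set \<Rightarrow> ('k::field) mpoly"
  assumes "finite CC" "\<And>C. C \<in> CC \<Longrightarrow> t C \<in> polys_in V"
    and compat: "\<And>C C'. C \<in> CC \<Longrightarrow> C' \<in> CC \<Longrightarrow> kill (C \<union> C') (t C) = kill (C \<union> C') (t C')"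
  shows "\<exists>g\<in>polys_in V. \<forall>C\<in>CC. kill C g = kill C (t C)"
proof -
  define good where "good m C \<longleftrightarrow> C \<in> CC \<and> supp m \<inter> C = {}" for m :: "nat \<Rightarrow>\<^sub>0 nat" and C
  define a where "a m = (if \<exists>C. good m C then lkp (t (SOME C. good m C)) m else 0)" for m
  have a: "a m = lkp (t C) m" if "good m C" for m C
  proof -
    define C' where "C' = (SOME C. good m C)"
    have C': "good m C'" unfolding C'_def using that by (rule someI)
    have "lkp (kill (C \<union> C') (t C)) m = lkp (kill (C \<union> C') (t C')) m"
      using compat that C' unfolding good_def by simp
    moreover have "supp m \<inter> (C \<union> C') = {}" using that C' unfolding good_def by auto
    ultimately have "lkp (t C) m = lkp (t C') m" by (simp add: lookup_kill)
    then show ?thesis unfolding a_def using that C'_def by auto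
  qed
  have supp: "\<exists>C\<in>CC. m \<in> supp (t C)" if "a m \<noteq> 0" for m
  proof -
    have "\<exists>C. good m C" using that unfolding a_def by presburger
    then obtain C where "good m C" by blast
    then show ?thesis using a[of m C] that unfolding good_def by (auto simp: in_keys_iff)
  qed
  have "finite {m. a m \<noteq> 0}"
    by (rule finite_subset[of _ "\<Union>C\<in>CC. supp (t C)"]) (use supp assms(1) in auto)
  then have lg: "lkp (Abs_poly_mapping a) = a" by simp
  show ?thesis
  proof (intro bexI[of _ "Abs_poly_mapping a"] ballI)
    show "Abs_poly_mapping a \<in> polys_in V"
      unfolding polys_in_def
    proof (intro CollectI ballI)
      fix m assume "m \<in> supp (Abs_poly_mapping a)"
      then have "a m \<noteq> 0" by (simp add: in_keys_iff lg)
      then obtain C where "C \<in> CC" "m \<in> supp (t C)" using supp by blast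
      then show "supp m \<subseteq> V" using assms(2)[of C] unfolding polys_in_def by blast
    qed
    fix C assume C: "C \<in> CC"
    show "kill C (Abs_poly_mapping a) = kill C (t C)"
      by (rule poly_mapping_eqI) (use a C lg in \<open>auto simp: lookup_kill when_def good_def\<close>)
  qed
qed

section \<open>Regular pairs in polynomial rings over a field\<close>

definition eval_var :: "nat \<Rightarrow> ('k::field) mpoly poly \<Rightarrow> 'k mpoly" where
  "eval_var t p = poly p (var t)"

lemma eval_var_in:
  assumes "p \<in> polys_over (polys_in W)"
  shows "eval_var t p \<in> polys_in (insert t W)"
proof -
  have "poly p (var t) = (\<Sum>i\<le>Polynomial.degree p. poly.coeff p i * var t ^ i)"
    by (rule poly_altdef)
  also have "\<dots> \<in> polys_in (insert t W)"
  proof (rule subring_set_sum[OF subring_polys_in])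
    fix i
    have "poly.coeff p i \<in> polys_in (insert t W)"
      using assms polys_in_mono[of W "insert t W"] unfolding polys_over_def by blast
    moreover have "var t ^ i \<in> polys_in (insert t W)"
      by (rule subring_set_power[OF subring_polys_in]) simp
    ultimately show "poly.coeff p i * var t ^ i \<in> polys_in (insert t W)" by (rule polys_in_mult)
  qed
  finally show ?thesis unfolding eval_var_def .
qed

text \<open>\<open>kill {t}\<close> isolates the constant coefficient, so \<open>var t\<close> is
  transcendental over the polynomials in \<open>W\<close>.\<close>

lemma eval_var_eq_0:
  assumes "p \<in> polys_over (polys_in W)" "t \<notin> W" "eval_var t p = 0"
  shows "p = 0"
  using assms(1,3)
proof (induction p)
  case 0
  then show ?case by simp
next
  case (pCons a p)
  have a: "a \<in> polys_in W" and p: "p \<in> polys_over (polys_in W)"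
    using pCons.prems(1) unfolding polys_over_def by (auto simp: coeff_pCons split: nat.splits)
  have eq: "a + var t * poly p (var t) = 0" using pCons.prems(2) by (simp add: eval_var_def)
  have "kill {t} (a + var t * poly p (var t)) = a"
    using kill_id[OF a] assms(2) by (simp add: kill_add kill_mult kill_var)
  then have a0: "a = 0" using eq by simp
  then have "poly p (var t) = 0" using eq by simp
  then show ?case using pCons.IH p a0 by (simp add: eval_var_def)
qed

lemma eval_var_surj:
  assumes "f \<in> polys_in (insert t W)"
  shows "\<exists>p\<in>polys_over (polys_in W). eval_var t p = f"
proof -
  note sub = subring_set_polys_over[OF subring_polys_in, of W]
  have single: "\<exists>p\<in>polys_over (polys_in W). eval_var t p = sngl m c" if m: "supp m \<subseteq> insert t W"
    for m :: "nat \<Rightarrow>\<^sub>0 nat" and c :: 'a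
  proof -
    define k where "k = lkp m t"
    define m' where "m' = m - sngl t k"
    have "m = m' + sngl t k"
      by (rule poly_mapping_eqI) (auto simp: m'_def k_def lookup_add lookup_minus lookup_single when_def)
    moreover have "supp m' \<subseteq> W"
    proof
      fix i assume "i \<in> supp m'"
      then have "lkp m' i \<noteq> 0" by (simp add: in_keys_iff)
      then have "lkp m i \<noteq> 0" "i \<noteq> t" by (auto simp: m'_def k_def lookup_minus lookup_single when_def split: if_splits)
      then show "i \<in> W" using m by (metis in_keys_iff insertE subsetD)
    qed
    moreover have "var t ^ k = (sngl (sngl t k) 1 :: 'a mpoly)"
    proof (induction k)
      case (Suc k)
      then show ?case by (simp add: var_def mult_single single_add[symmetric])
    qed (simp add: single_one)
    ultimately have "eval_var t (Polynomial.monom (sngl m' c) k) = sngl m c" "sngl m' c \<in> polys_in W"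
      by (simp_all add: eval_var_def poly_monom mult_single)
    then show ?thesis using polys_over_monom[OF polys_in_0] by blast
  qed
  have "f \<in> polys_in (insert t W) \<longrightarrow> (\<exists>p\<in>polys_over (polys_in W). eval_var t p = f)"
    (is "_ \<longrightarrow> ?R f")
  proof -
    have "?R (\<Sum>m\<in>Y. sngl m (lkp f m))" if "finite Y" "Y \<subseteq> supp f" for Y
      using that
    proof (induction Y)
      case empty
      show ?case using subring_set_closed(1)[OF sub] by (auto intro!: bexI[of _ 0] simp: eval_var_def)
    next
      case (insert m Y)
      obtain p where p: "p \<in> polys_over (polys_in W)" "eval_var t p = sngl m (lkp f m)"
        using single[of m "lkp f m"] insert.prems assms unfolding polys_in_def by blast
      obtain r where "r \<in> polys_over (polys_in W)" "eval_var t r = (\<Sum>m\<in>Y. sngl m (lkp f m))"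
        using insert by auto
      then show ?case
        using p insert.hyps subring_set_closed(4)[OF sub p(1)]
        by (intro bexI[of _ "p + r"]) (auto simp: eval_var_def)
    qed
    from this[of "supp f"] show ?thesis using poly_mapping_sum_single[of f] by simp
  qed
  then show ?thesis using assms by blast
qed

text \<open>Transports the step for univariate polynomials along \<open>eval_var t\<close>, an
  isomorphism from \<open>polys_over (polys_in W)\<close> onto
  \<open>polys_in (insert t W)\<close>.\<close>

lemma reg_or_principal_insert:
  fixes Q :: "('k::field) mpoly set"
  assumes IH: "\<And>q :: 'k mpoly set. prime_in (polys_in W) q \<Longrightarrow> reg_or_principal (polys_in W) q"
    and "t \<notin> W" and prime_Q: "prime_in (polys_in (insert t W)) Q"
  shows "reg_or_principal (polys_in (insert t W)) Q"
proof -
  define D :: "'k mpoly poly set" where "D = polys_over (polys_in W)"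
  define Q' where "Q' = {p \<in> D. eval_var t p \<in> Q}"
  have sub: "subring_set D" unfolding D_def by (rule subring_set_polys_over[OF subring_polys_in])
  note D_ops = subring_set_closed[OF sub]
  have ev: "eval_var t p \<in> polys_in (insert t W)" if "p \<in> D" for p
    using that unfolding D_def by (rule eval_var_in)
  have hom: "eval_var t (p + r) = eval_var t p + eval_var t r" "eval_var t (p - r) = eval_var t p - eval_var t r"
    "eval_var t (p * r) = eval_var t p * eval_var t r" "eval_var t 0 = (0 :: 'k mpoly)" "eval_var t 1 = (1 :: 'k mpoly)"
    "eval_var t (p ^ n) = eval_var t p ^ n" for p r :: "'k mpoly poly" and n
    by (simp_all add: eval_var_def)
  have inj: "p = r" if "p \<in> D" "r \<in> D" "eval_var t p = eval_var t r" for p r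
    using eval_var_eq_0[of "p - r" W t] D_ops(5)[OF that(1,2)] that(3) assms(2) unfolding D_def by (simp add: hom)
  have surj: "\<exists>p\<in>D. eval_var t p = f" if "f \<in> polys_in (insert t W)" for f
    using eval_var_surj[OF that] unfolding D_def .
  have Q': "prime_in D Q'"
    unfolding prime_in_def Q'_def
    using prime_inD[OF prime_Q] ev by (auto simp: hom D_ops)
  interpret prime_in_polys_over "polys_in W" Q'
    using Q' unfolding D_def by unfold_locales (rule subring_polys_in)
  have "reg_or_principal D Q'"
    unfolding D_def by (rule reg_or_principal_step[OF IH[OF prime_q]])
  have dvd: "loc_dvd D Q' f c \<longleftrightarrow> loc_dvd (polys_in (insert t W)) Q (eval_var t f) (eval_var t c)"
    if fc: "f \<in> D" "c \<in> D" for f c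
  proof
    assume "loc_dvd D Q' f c"
    then obtain s h where s: "s \<in> D - Q'" "h \<in> D" "s * c = f * h" unfolding loc_dvd_def by blast
    have "eval_var t s * eval_var t c = eval_var t f * eval_var t h"
      using arg_cong[OF s(3), of "eval_var t"] by (simp only: hom)
    moreover have "eval_var t s \<in> polys_in (insert t W) - Q" using s(1) ev unfolding Q'_def by blast
    ultimately show "loc_dvd (polys_in (insert t W)) Q (eval_var t f) (eval_var t c)"
      unfolding loc_dvd_def using ev[OF s(2)] by blast
  next
    assume "loc_dvd (polys_in (insert t W)) Q (eval_var t f) (eval_var t c)"
    then obtain s h where s: "s \<in> polys_in (insert t W) - Q" "h \<in> polys_in (insert t W)"
      "s * eval_var t c = eval_var t f * h" unfolding loc_dvd_def by blast
    obtain s' h' where s': "s' \<in> D" "eval_var t s' = s" "h' \<in> D" "eval_var t h' = h" using surj s by (metis DiffD1)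
    have "s' * c = f * h'"
      by (rule inj) (use D_ops(6) s' fc s(3) in \<open>auto simp: hom\<close>)
    moreover have "s' \<in> D - Q'" using s' s(1) unfolding Q'_def by blast
    ultimately show "loc_dvd D Q' f c" unfolding loc_dvd_def using s' by blast
  qed
  have Q'D: "Q' \<subseteq> D" unfolding Q'_def by blast
  have Q'Q: "eval_var t p \<in> Q" if "p \<in> Q'" for p using that unfolding Q'_def by blast
  from \<open>reg_or_principal D Q'\<close> show ?thesis
    unfolding reg_or_principal_def[of D]
  proof
    assume "\<exists>f\<in>Q'. \<exists>g\<in>Q'. f \<noteq> 0 \<and> (\<forall>c\<in>D. \<forall>h\<in>D. g * c = f * h \<longrightarrow> loc_dvd D Q' f c)"
    then obtain f g where fg: "f \<in> Q'" "g \<in> Q'" "f \<noteq> 0"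
      "\<And>c h. c \<in> D \<Longrightarrow> h \<in> D \<Longrightarrow> g * c = f * h \<Longrightarrow> loc_dvd D Q' f c" by blast
    have fgD: "f \<in> D" "g \<in> D" using fg Q'D by auto
    have "loc_dvd (polys_in (insert t W)) Q (eval_var t f) c"
      if c: "c \<in> polys_in (insert t W)" "h \<in> polys_in (insert t W)" "eval_var t g * c = eval_var t f * h" for c h
    proof -
      obtain c' h' where c': "c' \<in> D" "eval_var t c' = c" "h' \<in> D" "eval_var t h' = h" using surj c by metis
      have "g * c' = f * h'"
        by (rule inj) (use D_ops(6) c' fgD c(3) in \<open>auto simp: hom\<close>)
      then show ?thesis using fg(4)[OF c'(1,3)] dvd[OF fgD(1) c'(1)] c'(2) by simp
    qed
    moreover have "eval_var t f \<noteq> 0" using inj[OF fgD(1) D_ops(1)] fg(3) hom(4) by auto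
    ultimately show ?thesis unfolding reg_or_principal_def using Q'Q[OF fg(1)] Q'Q[OF fg(2)] by blast
  next
    assume "\<exists>f\<in>Q'. (\<forall>c\<in>Q'. loc_dvd D Q' f c) \<and> (\<forall>c\<in>D. (\<forall>n. loc_dvd D Q' (f ^ n) c) \<longrightarrow> c = 0)"
    then obtain f where f: "f \<in> Q'" "\<And>c. c \<in> Q' \<Longrightarrow> loc_dvd D Q' f c"
      "\<And>c. c \<in> D \<Longrightarrow> (\<And>n. loc_dvd D Q' (f ^ n) c) \<Longrightarrow> c = 0" by blast
    have fD: "f \<in> D" using f Q'D by auto
    have "loc_dvd (polys_in (insert t W)) Q (eval_var t f) c" if c: "c \<in> Q" for c
    proof -
      obtain c' where c': "c' \<in> D" "eval_var t c' = c" using surj c prime_inD(1)[OF prime_Q] by blast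
      then have "c' \<in> Q'" unfolding Q'_def using c by simp
      then show ?thesis using f(2) dvd[OF fD c'(1)] c' by simp
    qed
    moreover have "c = 0" if c: "c \<in> polys_in (insert t W)"
      "\<forall>n. loc_dvd (polys_in (insert t W)) Q (eval_var t f ^ n) c" for c
    proof -
      obtain c' where c': "c' \<in> D" "eval_var t c' = c" using surj c by blast
      have "loc_dvd D Q' (f ^ n) c'" for n
        using dvd[OF subring_set_power[OF sub fD] c'(1), of n] c(2) c'(2) by (simp add: hom)
      then have "c' = 0" using f(3) c'(1) by blast
      then show ?thesis using c'(2) hom(4) by simp
    qed
    ultimately show ?thesis unfolding reg_or_principal_def using Q'Q[OF f(1)] by blast
  qed
qed

lemma reg_or_principal_polys_in:
  assumes "finite W" "prime_in (polys_in W) (Q :: ('k::field) mpoly set)"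
  shows "reg_or_principal (polys_in W) Q"
  using assms
proof (induction W arbitrary: Q)
  case empty
  \<comment> \<open>Without variables every nonzero polynomial is a unit, so \<open>Q = {0}\<close>
    and the locally principal alternative holds with generator 0.\<close>
  have "c = 0" if "c \<in> Q" for c
  proof (rule ccontr)
    assume c0: "c \<noteq> 0"
    have "c \<in> polys_in {}" using that prime_inD(1)[OF empty] by blast
    then have keys: "supp c \<subseteq> {0}" unfolding polys_in_def by auto
    have c: "c = sngl 0 (lkp c 0)"
    proof (rule poly_mapping_eqI)
      fix m show "lkp c m = lkp (sngl 0 (lkp c 0)) m"
        using keys by (cases "m = 0") (auto simp: lookup_single in_keys_iff)
    qed
    then have "lkp c 0 \<noteq> 0" using c0 by (metis single_zero)
    then have "sngl 0 (1 / lkp c 0) * c = 1" by (subst c) (simp add: mult_single)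
    moreover have "sngl 0 (1 / lkp c 0) * c \<in> Q" by (rule prime_inD(5)[OF empty _ that]) simp
    ultimately show False using prime_inD(3)[OF empty] by simp
  qed
  then have "loc_dvd (polys_in {}) Q 0 c" if "c \<in> Q" for c
    using that prime_inD(3)[OF empty] unfolding loc_dvd_def by (intro bexI[of _ 1] bexI[of _ 0]) auto
  moreover have "c = 0" if c: "c \<in> polys_in {}" "\<forall>n. loc_dvd (polys_in {}) Q (0 ^ n) c" for c :: "'k mpoly"
  proof -
    obtain s where "s \<in> polys_in {} - Q" "s * c = 0" using c(2)[THEN spec, of 1] unfolding loc_dvd_def by auto
    then show ?thesis using prime_inD(2)[OF empty] by auto
  qed
  ultimately show ?case unfolding reg_or_principal_def using prime_inD(2)[OF empty] by blast
next
  case (insert t W)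
  then show ?case using reg_or_principal_insert by blast
qed

text \<open>Polynomial rings over a field satisfy \<open>(S\<^sub>2)\<close>: a prime with a chain of length 2 below it locally
  contains a regular sequence of length 2, since a locally principal prime contains no such chain.\<close>

lemma exists_regular_pair:
  assumes "finite W" and Q: "prime_in (polys_in W) (Q :: ('k::field) mpoly set)"
    and Q1: "prime_in (polys_in W) Q1" "Q1 \<subset> Q" "Q1 \<noteq> {0}"
  shows "\<exists>f\<in>Q. \<exists>g\<in>Q. f \<noteq> 0 \<and> (\<forall>c\<in>polys_in W. \<forall>h\<in>polys_in W. g * c = f * h \<longrightarrow> loc_dvd (polys_in W) Q f c)"
proof (rule ccontr)
  assume "\<not> ?thesis"
  then obtain f where f: "f \<in> Q" "\<And>c. c \<in> Q \<Longrightarrow> loc_dvd (polys_in W) Q f c"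
    "\<And>c. c \<in> polys_in W \<Longrightarrow> (\<And>n. loc_dvd (polys_in W) Q (f ^ n) c) \<Longrightarrow> c = 0"
    using reg_or_principal_polys_in[OF assms(1,2)] unfolding reg_or_principal_def by blast
  have QD: "Q \<subseteq> polys_in W" using prime_inD(1)[OF Q] .
  \<comment> \<open>Division by a generator \<open>f\<close> outside the prime \<open>Q1\<close>
    leads from \<open>Q1\<close> back into \<open>Q1\<close>. Iterated, it makes a nonzero element
    of \<open>Q1\<close> divisible by every power of \<open>f\<close>, against separatedness. The
    case \<open>f \<in> Q1\<close> is excluded by \<open>fn\<close>, as it would force
    \<open>Q \<subseteq> Q1\<close>.\<close>
  have div: "\<exists>s\<in>polys_in W - Q. \<exists>h\<in>Q1. s * c = f * h" if c: "c \<in> Q1" and f1: "f \<notin> Q1" for c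
  proof -
    obtain s h where s: "s \<in> polys_in W - Q" "h \<in> polys_in W" "s * c = f * h"
      using f(2) c Q1(2) unfolding loc_dvd_def by blast
    have "s * c \<in> Q1" using s(1) by (intro prime_inD(5)[OF Q1(1) _ c]) simp
    then have "h \<in> Q1" using prime_inD(7)[OF Q1(1), of f h] s f1 f(1) QD by (metis subsetD)
    then show ?thesis using s by blast
  qed
  have fn: "f \<notin> Q1"
  proof
    assume f1: "f \<in> Q1"
    have "Q \<subseteq> Q1"
    proof
      fix c assume c: "c \<in> Q"
      obtain s h where s: "s \<in> polys_in W - Q" "h \<in> polys_in W" "s * c = f * h"
        using f(2)[OF c] unfolding loc_dvd_def by blast
      have "s * c \<in> Q1" unfolding s(3) by (rule prime_inD(6)[OF Q1(1) s(2) f1])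
      then show "c \<in> Q1" using prime_inD(7)[OF Q1(1), of s c] s(1) c QD Q1(2) by auto
    qed
    then show False using Q1(2) by blast
  qed
  have pow: "\<exists>s\<in>polys_in W - Q. \<exists>h\<in>Q1. s * c = f ^ n * h" if "c \<in> Q1" for c n
    using that
  proof (induction n arbitrary: c)
    case 0
    then show ?case using prime_inD(3)[OF Q] by (intro bexI[of _ 1] bexI[of _ c]) auto
  next
    case (Suc n)
    obtain s h where s: "s \<in> polys_in W - Q" "h \<in> Q1" "s * c = f * h" using div[OF Suc.prems fn] by blast
    obtain s' h' where s': "s' \<in> polys_in W - Q" "h' \<in> Q1" "s' * h = f ^ n * h'" using Suc.IH[OF s(2)] by blast
    have "(s' * s) * c = s' * (s * c)" by (rule mult.assoc)
    also have "\<dots> = f * (s' * h)" unfolding s(3) by (rule mult.left_commute)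
    also have "\<dots> = f ^ Suc n * h'" unfolding s'(3) by (simp only: power_Suc mult.assoc)
    finally have "(s' * s) * c = f ^ Suc n * h'" .
    moreover have "s' * s \<in> polys_in W - Q"
      using s s' prime_inD(7)[OF Q, of s' s] polys_in_mult[of s' W s] by blast
    ultimately show ?case using s' by blast
  qed
  obtain c where c: "c \<in> Q1" "c \<noteq> 0" using Q1(3) prime_inD(2)[OF Q1(1)] by blast
  have "loc_dvd (polys_in W) Q (f ^ n) c" for n
    using pow[OF c(1), of n] prime_inD(1)[OF Q1(1)] unfolding loc_dvd_def by blast
  then show False using f(3) c prime_inD(1)[OF Q1(1)] by blast
qed

section \<open>Antichains and gluing of polynomials\<close>

text \<open>Reachability alone, so the empty vertex set counts as connected, unlike in
  \<open>Digraph_Component.connected\<close>.\<close>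

definition conn_on :: "'a set \<Rightarrow> ('a \<times> 'a) set \<Rightarrow> bool" where
  "conn_on S E \<longleftrightarrow> (\<forall>u\<in>S. \<forall>v\<in>S. (u, v) \<in> E\<^sup>*)"

lemma conn_on_image:
  assumes inj: "inj_on \<phi> S" and E: "E \<subseteq> S \<times> S"
  shows "conn_on (\<phi> ` S) (map_prod \<phi> \<phi> ` E) \<longleftrightarrow> conn_on S E"
proof -
  have "(\<phi> u, \<phi> v) \<in> (map_prod \<phi> \<phi> ` E)\<^sup>*" if "(u, v) \<in> E\<^sup>*" for u v
    using that
  proof (induction rule: rtrancl_induct)
    case (step y z)
    then have "(\<phi> y, \<phi> z) \<in> map_prod \<phi> \<phi> ` E" by force
    then show ?case using step.IH by (rule rtrancl_into_rtrancl[rotated])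
  qed simp
  moreover have "\<exists>v\<in>S. y = \<phi> v \<and> (u, v) \<in> E\<^sup>*" if "(\<phi> u, y) \<in> (map_prod \<phi> \<phi> ` E)\<^sup>*" "u \<in> S" for u y
    using that
  proof (induction rule: rtrancl_induct)
    case (step y z)
    then obtain v where v: "v \<in> S" "y = \<phi> v" "(u, v) \<in> E\<^sup>*" by auto
    obtain v' z' where z: "(v', z') \<in> E" "y = \<phi> v'" "z = \<phi> z'" using step.hyps by auto
    then have "v' = v" "z' \<in> S" using v E inj by (auto simp: inj_on_def)
    then show ?case using z v by (metis rtrancl.rtrancl_into_rtrancl)
  qed auto
  ultimately show ?thesis unfolding conn_on_def using inj by (auto simp: inj_on_def) (metis)
qed

lemma var_ideal_subset_prime:
  fixes Q :: "('k::field) mpoly set"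
  assumes Q: "prime_in (polys_in V) Q" and "\<And>i. i \<in> V \<Longrightarrow> i \<in> U \<Longrightarrow> var i \<in> Q"
  shows "var_ideal V U \<subseteq> Q"
proof
  fix f :: "'k mpoly" assume f: "f \<in> var_ideal V U"
  have "(\<Sum>m\<in>supp f. sngl m (lkp f m)) \<in> Q"
  proof (rule prime_in_sum[OF Q])
    fix m assume m: "m \<in> supp f"
    then obtain i where i: "i \<in> supp m" "i \<in> U" "supp m \<subseteq> V"
      using f unfolding mem_var_ideal_iff polys_in_def by blast
    then have "kill {i} (sngl m (lkp f m)) = 0" "sngl m (lkp f m) \<in> polys_in V" by (auto simp: kill_single)
    then obtain g where "g \<in> polys_in V" "sngl m (lkp f m) = var i * g" using kill_decomp by blast
    then show "sngl m (lkp f m) \<in> Q" using prime_inD(6)[OF Q] assms(2) i by auto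
  qed
  then show "f \<in> Q" using poly_mapping_sum_single[of f] by simp
qed

lemma var_ideal_mono: "U \<subseteq> U' \<Longrightarrow> var_ideal V U \<subseteq> var_ideal V U'"
  using kill_eq_0_mono by (fastforce simp: var_ideal_def)

lemma var_ideal_subset_iff:
  "U \<subseteq> V \<Longrightarrow> (var_ideal V U :: ('k::field) mpoly set) \<subseteq> var_ideal V U' \<longleftrightarrow> U \<subseteq> U'"
  using var_mem_var_ideal[where 'k = 'k] var_ideal_mono by blast

lemma var_ideal_inj:
  assumes "U \<subseteq> V" "U' \<subseteq> V"
  shows "(var_ideal V U :: ('k::field) mpoly set) = var_ideal V U' \<longleftrightarrow> U = U'"
  using var_ideal_subset_iff[OF assms(1), of U', where 'k = 'k] var_ideal_subset_iff[OF assms(2), of U, where 'k = 'k] by auto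

lemma prime_in_restrict:
  assumes "prime_in (polys_in V) Q" "W \<subseteq> V"
  shows "prime_in (polys_in W) (Q \<inter> polys_in W)"
  unfolding prime_in_def
proof (intro conjI ballI impI)
  have W: "x \<in> polys_in V" if "x \<in> polys_in W" for x :: "'a mpoly"
    using that polys_in_mono[OF assms(2)] by blast
  note Q = prime_inD[OF assms(1)]
  show "Q \<inter> polys_in W \<subseteq> polys_in W" "0 \<in> Q \<inter> polys_in W" "1 \<notin> Q \<inter> polys_in W"
    using Q(2,3) by auto
  show "x + y \<in> Q \<inter> polys_in W" if "x \<in> Q \<inter> polys_in W" "y \<in> Q \<inter> polys_in W" for x y
    using that Q(4) polys_in_add by blast
  show "d * x \<in> Q \<inter> polys_in W" if "d \<in> polys_in W" "x \<in> Q \<inter> polys_in W" for d x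
    using that Q(5)[OF W[OF that(1)]] polys_in_mult by blast
  show "x \<in> Q \<inter> polys_in W \<or> y \<in> Q \<inter> polys_in W"
    if "x \<in> polys_in W" "y \<in> polys_in W" "x * y \<in> Q \<inter> polys_in W" for x y
    using that Q(7)[OF W[OF that(1)] W[OF that(2)]] by blast
qed

lemma sum_var_nonzero:
  assumes "finite F" "F \<noteq> {}"
  shows "(\<Sum>v\<in>F. var v) \<noteq> (0 :: ('k::field) mpoly)"
proof
  assume *: "(\<Sum>v\<in>F. var v) = (0 :: 'k mpoly)"
  obtain v where v: "v \<in> F" using assms by blast
  have "kill (F - {v}) (\<Sum>v\<in>F. var v) = (\<Sum>u\<in>F. if u = v then var u else (0 :: 'k mpoly))"
    unfolding kill_sum by (intro sum.cong) (auto simp: kill_var)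
  also have "\<dots> = var v" using v assms by simp
  finally show False using * by simp
qed

text \<open>An antichain of subsets of \<open>A\<close>; its members are the complements in \<open>A\<close> of the facets of a
  simplicial complex, and the pairs with \<open>C \<union> C' \<noteq> A\<close> correspond to intersecting facets.\<close>

locale antichain =
  fixes V A :: "nat set" and CC :: "nat set set"
  assumes finite_V: "finite V" and A_V: "A \<subseteq> V"
    and CC_A: "C \<in> CC \<Longrightarrow> C \<subseteq> A"
    and antichain: "C \<in> CC \<Longrightarrow> C' \<in> CC \<Longrightarrow> C \<subseteq> C' \<Longrightarrow> C = C'"
begin

lemma finite_A: "finite A" using finite_V A_V finite_subset by blast

lemma finite_CC: "finite CC"
  using CC_A finite_A by (meson PowI finite_Pow_iff finite_subset subsetI)

definition zero_on :: "('k::field) mpoly \<Rightarrow> bool" where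
  "zero_on c \<longleftrightarrow> (\<forall>C\<in>CC. kill C c = 0)"

text \<open>One squarefree monomial per facet. By the antichain property each facet sees only its
  own summand, so the sum vanishes on no component.\<close>

definition facet_sum :: "('k::field) mpoly" where
  "facet_sum = (\<Sum>C\<in>CC. var_prod (A - C))"

lemma kill_facet:
  assumes "C \<in> CC" "C' \<in> CC"
  shows "kill C (var_prod (A - C')) = (if C = C' then var_prod (A - C) else 0)"
proof -
  have "finite (A - C')" using finite_A by simp
  moreover have "(A - C') \<inter> C \<noteq> {}" if "C \<noteq> C'"
    using that antichain[OF assms] CC_A[OF assms(1)] by auto
  ultimately show ?thesis by (auto simp: kill_var_prod)
qed

lemma kill_facet_sum: "C \<in> CC \<Longrightarrow> kill C facet_sum = var_prod (A - C)"
  unfolding facet_sum_def kill_sum using finite_CC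
  by (simp add: kill_facet cong: sum.cong)

lemma facet_sum_nonzerodivisor: "zero_on (facet_sum * c) \<Longrightarrow> zero_on c"
  by (simp add: zero_on_def kill_mult kill_facet_sum)

text \<open>On the facet \<open>A - C\<close> the element \<open>facet_sum\<close> is the product of the variables, and \<open>b\<close> is regular
  modulo it. This gives quotients \<open>t C\<close> of \<open>c\<close> by \<open>facet_sum\<close> on the facets; they agree on those
  intersections where \<open>b\<close> does not vanish, and \<open>compat\<close> extends this to all intersections, so that
  they glue.\<close>

lemma facet_sum_regular:
  fixes b c e :: "('k::field) mpoly"
  assumes b: "b \<in> polys_in V" and c: "c \<in> polys_in V" and e: "e \<in> polys_in V"
    and kill1: "\<And>C v. C \<in> CC \<Longrightarrow> v \<in> A - C \<Longrightarrow> kill (insert v C) b \<noteq> 0"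
    and compat: "\<And>t :: nat set \<Rightarrow> 'k mpoly.
      (\<And>C C'. C \<in> CC \<Longrightarrow> C' \<in> CC \<Longrightarrow> kill (C \<union> C') b \<noteq> 0 \<Longrightarrow> kill (C \<union> C') (t C) = kill (C \<union> C') (t C')) \<Longrightarrow>
      (\<And>C C'. C \<in> CC \<Longrightarrow> C' \<in> CC \<Longrightarrow> kill (C \<union> C') (t C) = kill (C \<union> C') (t C'))"
    and strict: "\<And>C. C \<in> CC \<Longrightarrow> C \<noteq> A"
    and Z: "zero_on (b * c - facet_sum * e)"
  shows "\<exists>e\<in>polys_in V. zero_on (c - facet_sum * e)"
proof -
  have eq: "kill C b * kill C c = var_prod (A - C) * kill C e" if "C \<in> CC" for C
    using Z that unfolding zero_on_def by (simp add: kill_diff kill_mult kill_facet_sum)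
  have "\<exists>g\<in>polys_in V. kill C c = var_prod (A - C) * g" if C: "C \<in> CC" for C
  proof (rule var_prod_dvd)
    show "finite (A - C)" using finite_A by simp
    show "kill C c \<in> polys_in V" using c by (rule kill_closed)
    \<comment> \<open>Setting \<open>v\<close> to 0 annihilates the product of the variables on the
      facet but, by \<open>kill1\<close>, not \<open>b\<close>; in a domain this forces
      \<open>v\<close> to divide \<open>kill C c\<close>.\<close>
    fix v assume v: "v \<in> A - C"
    have "kill {v} (kill C b) * kill {v} (kill C c) = kill {v} (var_prod (A - C)) * kill {v} (kill C e)"
      using eq[OF C] by (metis kill_mult)
    also have "\<dots> = 0" using v finite_A by (subst kill_var_prod) auto
    finally show "kill {v} (kill C c) = 0" using kill1[OF C v] by (simp add: kill_kill)
  qed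
  then obtain t where t: "\<And>C. C \<in> CC \<Longrightarrow> t C \<in> polys_in V \<and> kill C c = var_prod (A - C) * t C" by metis
  have et: "kill C b * t C = kill C e" if C: "C \<in> CC" for C
  proof -
    have "var_prod (A - C) * (kill C b * t C) = var_prod (A - C) * kill C e"
      using eq[OF C] t[OF C] by (metis mult.left_commute)
    then show ?thesis by simp
  qed
  have "kill (C \<union> C') (t C) = kill (C \<union> C') (t C')" if C: "C \<in> CC" "C' \<in> CC" for C C'
  proof (rule compat[OF _ C])
    fix C C' assume C: "C \<in> CC" "C' \<in> CC" "kill (C \<union> C') b \<noteq> 0"
    have "kill (C \<union> C') b * kill (C \<union> C') (t C) = kill (C \<union> C') e"
      using arg_cong[OF et[OF C(1)], of "kill (C \<union> C')"] by (simp add: kill_mult kill_kill Un_ac)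
    moreover have "kill (C \<union> C') b * kill (C \<union> C') (t C') = kill (C \<union> C') e"
      using arg_cong[OF et[OF C(2)], of "kill (C \<union> C')"] by (simp add: kill_mult kill_kill Un_ac)
    ultimately show "kill (C \<union> C') (t C) = kill (C \<union> C') (t C')" using C(3) by (metis mult_cancel_left)
  qed
  then obtain g where g: "g \<in> polys_in V" "\<And>C. C \<in> CC \<Longrightarrow> kill C g = kill C (t C)"
    using glue[OF finite_CC, of t V] t by blast
  have "kill C (c - facet_sum * g) = 0" if C: "C \<in> CC" for C
  proof -
    have "kill C c = kill C (kill C c)" by (simp add: kill_kill)
    also have "\<dots> = var_prod (A - C) * kill C (t C)"
      using t[OF C] by (simp add: kill_mult kill_facet[OF C C])
    finally show ?thesis using g(2)[OF C] by (simp add: kill_diff kill_mult kill_facet_sum C)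
  qed
  then show ?thesis using g unfolding zero_on_def by blast
qed

definition meet_graph :: "(nat set \<times> nat set) set" where
  "meet_graph = {(C, C'). C \<in> CC \<and> C' \<in> CC \<and> C \<union> C' \<noteq> A}"

text \<open>The pairs not covered by \<open>t\<close> have \<open>C \<union> C' = A\<close>, so only
  the values after \<open>kill A\<close> matter. These agree along each edge of a path from
  \<open>C\<close> to \<open>C'\<close>, because \<open>kill A\<close> factors through
  \<open>kill\<close> of the two endpoints' union.\<close>

lemma meet_graph_compat:
  fixes t :: "nat set \<Rightarrow> ('k::field) mpoly"
  assumes conn: "conn_on CC meet_graph"
    and t: "\<And>C C'. (C, C') \<in> meet_graph \<Longrightarrow> kill (C \<union> C') (t C) = kill (C \<union> C') (t C')"
    and C: "C \<in> CC" "C' \<in> CC"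
  shows "kill (C \<union> C') (t C) = kill (C \<union> C') (t C')"
proof (cases "(C, C') \<in> meet_graph")
  case False
  then have A: "C \<union> C' = A" using C by (auto simp: meet_graph_def)
  have "(C, C') \<in> meet_graph\<^sup>*" using conn C unfolding conn_on_def by blast
  then have "kill A (t C) = kill A (t C')"
  proof (induction rule: rtrancl_induct)
    case (step y z)
    then have "y \<union> z \<subseteq> A" using CC_A by (auto simp: meet_graph_def)
    then have "kill A f = kill A (kill (y \<union> z) f)" for f :: "'k mpoly" by (simp add: kill_kill Un_absorb2)
    then show ?case using step.IH t[OF step.hyps(2)] by metis
  qed simp
  then show ?thesis using A by simp
qed (rule t)

text \<open>If \<open>v\<close> were the only vertex of the facet \<open>A - C\<close>, a neighbour
  \<open>z\<close> of \<open>C\<close> would miss \<open>v\<close>, hence lie in \<open>C\<close>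
  and equal it. So \<open>C\<close> would be isolated.\<close>

lemma meet_graph_two_left:
  assumes conn: "conn_on CC meet_graph" and C: "C \<in> CC" "C' \<in> CC" "C \<noteq> C'" and v: "v \<in> A - C"
  shows "\<not> A \<subseteq> insert v C"
proof
  assume *: "A \<subseteq> insert v C"
  have "(C, C') \<in> meet_graph\<^sup>*" using conn C unfolding conn_on_def by blast
  then have "C' = C"
  proof (induction rule: rtrancl_induct)
    case (step y z)
    then have z: "z \<in> CC" "C \<union> z \<noteq> A" by (auto simp: meet_graph_def)
    then have "z \<subseteq> C" using * CC_A[OF C(1)] CC_A[OF z(1)] by blast
    then show ?case using antichain z C by blast
  qed simp
  then show False using C by simp
qed

text \<open>The idempotent that separates two parts of a disconnected complex is not in the Stanley-Reisner
  ring, but its products with all elements of \<open>P\<close> are. So \<open>P\<close> has depth at most 1.\<close>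

lemma conn_of_regular_pair:
  fixes a b :: "('k::field) mpoly"
  assumes ab: "a \<in> var_ideal V A" "b \<in> var_ideal V A"
    and nzd: "\<And>c. c \<in> polys_in V \<Longrightarrow> zero_on (a * c) \<Longrightarrow> zero_on c"
    and nzd2: "\<And>c e. c \<in> polys_in V \<Longrightarrow> e \<in> polys_in V \<Longrightarrow> zero_on (b * c - a * e) \<Longrightarrow>
      \<exists>s\<in>polys_in V - var_ideal V A. \<exists>e\<in>polys_in V. zero_on (s * c - a * e)"
  shows "conn_on CC meet_graph"
proof (rule ccontr)
  assume "\<not> ?thesis"
  then obtain C1 C2 where C12: "C1 \<in> CC" "C2 \<in> CC" "(C1, C2) \<notin> meet_graph\<^sup>*" unfolding conn_on_def by blast
  define X1 where "X1 = {C \<in> CC. (C1, C) \<in> meet_graph\<^sup>*}"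
  have sep: "C \<union> C' = A" if "C \<in> X1" "C' \<in> CC" "C' \<notin> X1" for C C'
  proof (rule ccontr)
    assume "C \<union> C' \<noteq> A"
    then have "(C, C') \<in> meet_graph" using that unfolding X1_def meet_graph_def by blast
    then show False using that unfolding X1_def by (metis (no_types, lifting) mem_Collect_eq rtrancl.rtrancl_into_rtrancl)
  qed
  \<comment> \<open>Multiplication by the idempotent that is 1 on the facets from \<open>X1\<close>
    and 0 on the others. Facets from different sides share no vertex, and \<open>f\<close> vanishes
    after \<open>kill A\<close>, so the pieces glue.\<close>
  have proj: "\<exists>g\<in>polys_in V. \<forall>C\<in>CC. kill C g = (if C \<in> X1 then kill C f else 0)" if f: "f \<in> var_ideal V A" for f :: "'k mpoly"
  proof -
    define t where "t C = (if C \<in> X1 then f else 0)" for C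
    have fA: "kill A f = 0" "f \<in> polys_in V" using f by (auto simp: var_ideal_def)
    have "\<exists>g\<in>polys_in V. \<forall>C\<in>CC. kill C g = kill C (t C)"
    proof (rule glue[OF finite_CC])
      show "t C \<in> polys_in V" for C using fA by (simp add: t_def)
      fix C C' assume C: "C \<in> CC" "C' \<in> CC"
      show "kill (C \<union> C') (t C) = kill (C \<union> C') (t C')"
        using sep[of C C'] sep[of C' C] C fA by (auto simp: t_def Un_commute)
    qed
    then show ?thesis unfolding t_def by (metis kill_0)
  qed
  obtain a' where a': "a' \<in> polys_in V" "\<And>C. C \<in> CC \<Longrightarrow> kill C a' = (if C \<in> X1 then kill C a else 0)"
    using proj[OF ab(1)] by blast
  obtain b' where b': "b' \<in> polys_in V" "\<And>C. C \<in> CC \<Longrightarrow> kill C b' = (if C \<in> X1 then kill C b else 0)"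
    using proj[OF ab(2)] by blast
  \<comment> \<open>Both products are the projection of \<open>a * b\<close>. Regularity then makes
    \<open>a'\<close> locally a multiple of \<open>a\<close>, with the idempotent itself as the
    quotient, which is impossible.\<close>
  have "zero_on (b * a' - a * b')"
    unfolding zero_on_def using a' b' by (simp add: kill_diff kill_mult)
  then obtain s e where s: "s \<in> polys_in V" "s \<notin> var_ideal V A" "e \<in> polys_in V" "zero_on (s * a' - a * e)"
    using nzd2[OF a'(1) b'(1)] by blast
  \<comment> \<open>A nonzerodivisor vanishes on no component: otherwise it would annihilate the
    facet monomial of \<open>C\<close>, which is nonzero on that facet and zero on all
    others.\<close>
  have a0: "kill C a \<noteq> 0" if C: "C \<in> CC" for C
  proof
    assume "kill C a = 0"
    then have "zero_on (a * var_prod (A - C))"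
      unfolding zero_on_def by (simp add: kill_mult kill_facet[OF _ C])
    then have "zero_on (var_prod (A - C) :: 'k mpoly)" using nzd var_prod_in[of "A - C" V] A_V by blast
    then show False unfolding zero_on_def using C by (auto simp: kill_facet[OF C C])
  qed
  have C1X: "C1 \<in> X1" "C2 \<notin> X1" using C12 unfolding X1_def by auto
  have S: "kill C s * kill C a' = kill C a * kill C e" if "C \<in> CC" for C
    using s(4) that unfolding zero_on_def by (simp add: kill_diff kill_mult)
  have "kill C1 s * kill C1 a = kill C1 a * kill C1 e"
    using S[OF C12(1)] a'(2)[OF C12(1)] C1X by simp
  then have 1: "kill C1 s = kill C1 e" using a0[OF C12(1)] by (simp add: mult.commute)
  have "kill C2 a * kill C2 e = 0"
    using S[OF C12(2)] a'(2)[OF C12(2)] C1X by simp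
  then have 2: "kill C2 e = 0" using a0[OF C12(2)] by simp
  \<comment> \<open>\<open>kill A\<close> factors through both \<open>kill C1\<close> and
    \<open>kill C2\<close>: \<open>e\<close> vanishes on the second and agrees with \<open>s\<close>
    on the first, so \<open>s\<close> falls into \<open>P_A\<close>.\<close>
  have "kill A e = 0" using kill_eq_0_mono[OF 2] CC_A[OF C12(2)] by blast
  moreover have "kill A s = kill A (kill C1 s)" "kill A e = kill A (kill C1 e)"
    using CC_A[OF C12(1)] by (simp_all add: kill_kill Un_absorb2)
  ultimately have "kill A s = 0" using 1 by simp
  then show False using s(1,2) unfolding var_ideal_def by blast
qed

end

section \<open>Squarefree monomial ideals\<close>

text \<open>\<open>GG\<close> holds the supports of the monomial generators. The ideal enters only
  through the primes that contain it and through a sufficient condition for membership.\<close>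

locale squarefree_ideal =
  fixes V :: "nat set" and GG :: "nat set set" and I :: "('k::field) mpoly set"
  assumes finite_V: "finite V" and GG_V: "G \<in> GG \<Longrightarrow> G \<subseteq> V"
    and subset_prime_iff: "prime_in (polys_in V) Q \<Longrightarrow> I \<subseteq> Q \<longleftrightarrow> (\<forall>G\<in>GG. var_prod G \<in> Q)"
    and mem_I: "f \<in> polys_in V \<Longrightarrow> (\<And>m. m \<in> supp f \<Longrightarrow> \<exists>G\<in>GG. G \<subseteq> supp m) \<Longrightarrow> f \<in> I"
begin

abbreviation "D \<equiv> polys_in V :: 'k mpoly set"
abbreviation "PV \<equiv> var_ideal V :: nat set \<Rightarrow> 'k mpoly set"

definition cover :: "nat set \<Rightarrow> bool" where
  "cover U \<longleftrightarrow> U \<subseteq> V \<and> (\<forall>G\<in>GG. G \<inter> U \<noteq> {})"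

definition min_cover :: "nat set \<Rightarrow> bool" where
  "min_cover C \<longleftrightarrow> cover C \<and> (\<forall>C'. cover C' \<longrightarrow> C' \<subseteq> C \<longrightarrow> C' = C)"

definition vars :: "'k mpoly set \<Rightarrow> nat set" where
  "vars Q = {i \<in> V. var i \<in> Q}"

definition CC :: "nat set \<Rightarrow> nat set set" where
  "CC A = {C. min_cover C \<and> C \<subseteq> A}"

lemma finite_G: "G \<in> GG \<Longrightarrow> finite G"
  using GG_V finite_V finite_subset by blast

lemma vars_V: "vars Q \<subseteq> V" unfolding vars_def by blast

lemma vars_var_ideal: "U \<subseteq> V \<Longrightarrow> vars (PV U) = U"
  unfolding vars_def by (auto simp: var_mem_var_ideal)

lemma var_ideal_vars_subset: "prime_in D Q \<Longrightarrow> PV (vars Q) \<subseteq> Q"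
  by (rule var_ideal_subset_prime) (auto simp: vars_def)

lemma vars_mono: "Q \<subseteq> Q' \<Longrightarrow> vars Q \<subseteq> vars Q'" unfolding vars_def by blast

lemma I_subset_iff_cover:
  assumes "prime_in D Q"
  shows "I \<subseteq> Q \<longleftrightarrow> cover (vars Q)"
proof -
  have "var_prod G \<in> Q \<longleftrightarrow> G \<inter> vars Q \<noteq> {}" if "G \<in> GG" for G
    using var_prod_mem_prime[OF assms finite_G[OF that] GG_V[OF that]] GG_V[OF that] unfolding vars_def by auto
  then show ?thesis using subset_prime_iff[OF assms] vars_V unfolding cover_def by auto
qed

lemma I_subset_var_ideal: "U \<subseteq> V \<Longrightarrow> I \<subseteq> PV U \<longleftrightarrow> cover U"
  using I_subset_iff_cover[OF prime_var_ideal] vars_var_ideal by simp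

lemma var_ideal_subset_iff_vars:
  assumes "U \<subseteq> V" "prime_in D Q"
  shows "PV U \<subseteq> Q \<longleftrightarrow> U \<subseteq> vars Q"
proof
  assume "PV U \<subseteq> Q"
  then show "U \<subseteq> vars Q" using vars_mono vars_var_ideal assms(1) by metis
next
  assume "U \<subseteq> vars Q"
  then show "PV U \<subseteq> Q" using var_ideal_mono var_ideal_vars_subset[OF assms(2)] by blast
qed

lemma exists_min_cover:
  assumes "cover U"
  shows "\<exists>C. min_cover C \<and> C \<subseteq> U"
proof -
  have "finite U" using assms finite_V finite_subset unfolding cover_def by blast
  then show ?thesis using assms
  proof (induction U rule: finite_psubset_induct)
    case (psubset U)
    show ?case
    proof (cases "min_cover U")
      case False
      then obtain C' where C': "cover C'" "C' \<subset> U" using psubset.prems unfolding min_cover_def by blast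
      then obtain C where "min_cover C" "C \<subseteq> C'" using psubset.IH by blast
      then show ?thesis using C' by blast
    qed auto
  qed
qed

lemma CC_V: "C \<in> CC A \<Longrightarrow> C \<subseteq> V" unfolding CC_def min_cover_def cover_def by blast

lemma CC_cover: "C \<in> CC A \<Longrightarrow> cover C" unfolding CC_def min_cover_def by blast

lemma CC_mono: "A \<subseteq> A' \<Longrightarrow> CC A \<subseteq> CC A'" unfolding CC_def by blast

lemma antichain_CC: "A \<subseteq> V \<Longrightarrow> antichain V A (CC A)"
  by unfold_locales (auto simp: finite_V CC_def min_cover_def)

text \<open>\<open>I\<close> is the intersection of its minimal primes: if no generator divides the
  monomial \<open>m\<close>, the complement of \<open>supp m\<close> is a cover, and a minimal cover
  inside it leaves \<open>m\<close> alive under \<open>kill\<close>.\<close>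

lemma mem_I_of_kill:
  assumes "f \<in> D" "\<And>C. min_cover C \<Longrightarrow> kill C f = 0"
  shows "f \<in> I"
proof (rule mem_I[OF assms(1)], rule ccontr)
  fix m assume m: "m \<in> supp f" "\<not> (\<exists>G\<in>GG. G \<subseteq> supp m)"
  then have "cover (V - supp m)" unfolding cover_def using GG_V by blast
  then obtain C where C: "min_cover C" "C \<subseteq> V - supp m" using exists_min_cover by blast
  then have "m \<in> supp (kill C f)" using m by (auto simp: keys_kill)
  then show False using assms(2)[OF C(1)] by simp
qed

lemma local_zero_iff:
  assumes P: "prime_in D P" and c: "c \<in> D"
  shows "(\<exists>s\<in>D - P. s * c \<in> I) \<longleftrightarrow> (\<forall>C\<in>CC (vars P). kill C c = 0)"
proof
  assume "\<exists>s\<in>D - P. s * c \<in> I"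
  then obtain s where s: "s \<in> D - P" "s * c \<in> I" by blast
  show "\<forall>C\<in>CC (vars P). kill C c = 0"
  proof
    fix C assume C: "C \<in> CC (vars P)"
    have "I \<subseteq> PV C" using I_subset_var_ideal CC_V[OF C] CC_cover[OF C] by blast
    moreover have "PV C \<subseteq> P" using var_ideal_subset_iff_vars[OF CC_V[OF C] P] C unfolding CC_def by blast
    ultimately have "c \<in> PV C" using s c prime_inD(7)[OF prime_var_ideal, of s V c C] by blast
    then show "kill C c = 0" unfolding var_ideal_def by blast
  qed
next
  assume *: "\<forall>C\<in>CC (vars P). kill C c = 0"
  \<comment> \<open>The product of all variables outside \<open>P\<close>. It avoids
    \<open>P\<close> and vanishes on every component whose minimal cover is not inside
    \<open>vars P\<close>.\<close>
  define s :: "'k mpoly" where "s = var_prod (V - vars P)"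
  have sD: "s \<in> D" unfolding s_def by (rule var_prod_in) blast
  moreover have "s \<notin> P"
    unfolding s_def using var_prod_mem_prime[OF P, of "V - vars P"] finite_V by (auto simp: vars_def)
  moreover have "s * c \<in> I"
  proof (rule mem_I_of_kill)
    show "s * c \<in> D" using sD c by (rule polys_in_mult)
    fix C assume C: "min_cover C"
    show "kill C (s * c) = 0"
    proof (cases "C \<subseteq> vars P")
      case True
      then show ?thesis using * C unfolding CC_def by (simp add: kill_mult)
    next
      case False
      moreover have "C \<subseteq> V" using C unfolding min_cover_def cover_def by simp
      ultimately have "(V - vars P) \<inter> C \<noteq> {}" by auto
      then have "kill C s = 0" unfolding s_def using finite_V by (simp add: kill_var_prod)
      then show ?thesis by (simp add: kill_mult)
    qed
  qed
  ultimately show "\<exists>s\<in>D - P. s * c \<in> I" by blast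
qed

lemma minimal_prime_iff:
  "prime_in D Q \<and> I \<subseteq> Q \<and> (\<forall>Q'. prime_in D Q' \<longrightarrow> I \<subseteq> Q' \<longrightarrow> Q' \<subseteq> Q \<longrightarrow> Q' = Q) \<longleftrightarrow>
     (\<exists>C. min_cover C \<and> Q = PV C)" (is "?L \<longleftrightarrow> ?R")
proof
  assume L: ?L
  then have "cover (vars Q)" using I_subset_iff_cover by blast
  then obtain C where C: "min_cover C" "C \<subseteq> vars Q" using exists_min_cover by blast
  have CV: "C \<subseteq> V" using C vars_V by blast
  have "PV C \<subseteq> Q" using var_ideal_subset_iff_vars[OF CV] C L by blast
  moreover have "I \<subseteq> PV C" using I_subset_var_ideal[OF CV] C unfolding min_cover_def by blast
  ultimately have "PV C = Q" using L prime_var_ideal by blast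
  then show ?R using C by blast
next
  assume ?R
  then obtain C where C: "min_cover C" "Q = PV C" by blast
  then have CV: "C \<subseteq> V" unfolding min_cover_def cover_def by blast
  have "Q' = Q" if Q': "prime_in D Q'" "I \<subseteq> Q'" "Q' \<subseteq> Q" for Q'
  proof -
    have "cover (vars Q')" using I_subset_iff_cover Q' by blast
    moreover have "vars Q' \<subseteq> C" using vars_mono[OF Q'(3)] C vars_var_ideal[OF CV] by simp
    ultimately have "vars Q' = C" using C unfolding min_cover_def by blast
    then show ?thesis using var_ideal_vars_subset[OF Q'(1)] Q'(3) C by blast
  qed
  moreover have "I \<subseteq> Q" using I_subset_var_ideal[OF CV] C unfolding min_cover_def by blast
  ultimately show ?L using C prime_var_ideal by blast
qed

section \<open>Regular elements and regular pairs at a prime\<close>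

definition zero_at :: "nat set \<Rightarrow> 'k mpoly \<Rightarrow> bool" where
  "zero_at A c \<longleftrightarrow> (\<forall>C\<in>CC A. kill C c = 0)"

definition regular_one :: "'k mpoly set \<Rightarrow> bool" where
  "regular_one P \<longleftrightarrow> (\<exists>a\<in>P. \<forall>c\<in>D. zero_at (vars P) (a * c) \<longrightarrow> zero_at (vars P) c)"

text \<open>The hypotheses of \<open>two_le_local_depthI\<close>, with vanishing in the localization
  replaced by \<open>zero_at\<close>; no quotient or localization is mentioned.\<close>

definition regular_two :: "'k mpoly set \<Rightarrow> bool" where
  "regular_two P \<longleftrightarrow> (\<exists>a\<in>P. \<exists>b\<in>P. (\<forall>c\<in>D. zero_at (vars P) (a * c) \<longrightarrow> zero_at (vars P) c) \<and>
     (\<forall>c\<in>D. \<forall>e\<in>D. zero_at (vars P) (b * c - a * e) \<longrightarrow>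
       (\<exists>s\<in>D - P. \<exists>e\<in>D. zero_at (vars P) (s * c - a * e))))"

definition meet :: "nat set \<Rightarrow> (nat set \<times> nat set) set" where
  "meet A = {(C, C'). C \<in> CC A \<and> C' \<in> CC A \<and> C \<union> C' \<noteq> A}"

lemma var_ideal_single_subset:
  assumes "prime_in D Q" "I \<subseteq> Q" "vars Q \<subseteq> A" "CC A = {C}"
  shows "PV C \<subseteq> Q"
proof -
  have "cover (vars Q)" using I_subset_iff_cover assms by blast
  then obtain C' where "min_cover C'" "C' \<subseteq> vars Q" using exists_min_cover by blast
  then have C': "C' \<in> CC A" "C' \<subseteq> vars Q" using assms(3) unfolding CC_def by auto
  then have "C \<subseteq> vars Q" using assms(4) by simp
  moreover have "C \<subseteq> V" using CC_V[of C A] assms(4) by simp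
  ultimately show ?thesis using var_ideal_subset_iff_vars[OF _ assms(1)] by simp
qed

lemma facet_sum_mem:
  assumes P: "prime_in D P" and strict: "\<And>C. C \<in> CC (vars P) \<Longrightarrow> C \<noteq> vars P"
  shows "antichain.facet_sum (vars P) (CC (vars P)) \<in> P"
proof -
  interpret antichain V "vars P" "CC (vars P)" by (rule antichain_CC[OF vars_V])
  show ?thesis
    unfolding facet_sum_def
  proof (rule prime_in_sum[OF P])
    fix C assume C: "C \<in> CC (vars P)"
    then obtain i where "i \<in> vars P - C" using strict[OF C] CC_A by blast
    then show "var_prod (vars P - C) \<in> P"
      using var_prod_mem_prime[OF P, of "vars P - C"] finite_A A_V unfolding vars_def by auto
  qed
qed

text \<open>With several minimal covers inside \<open>vars P\<close>, none of them is
  \<open>vars P\<close> itself, so each facet monomial lies in \<open>P\<close> and the facet sum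
  serves. With a single cover \<open>C\<close> the sum can be 1, but the ring is locally a domain,
  and an element of \<open>P\<close> outside a smaller prime serves.\<close>

lemma regular_one_of_height:
  assumes P: "prime_in D P" "I \<subseteq> P" and ht: "enat 1 \<le> ht_over D I P"
  shows "regular_one P"
proof -
  interpret antichain V "vars P" "CC (vars P)" by (rule antichain_CC[OF vars_V])
  have zero: "zero_at (vars P) c \<longleftrightarrow> zero_on c" for c by (simp add: zero_at_def zero_on_def)
  have cov: "cover (vars P)" using I_subset_iff_cover P by blast
  then obtain C where C: "C \<in> CC (vars P)" using exists_min_cover unfolding CC_def by blast
  show ?thesis
  proof (cases "CC (vars P) = {C}")
    case True
    obtain Q0 where Q0: "prime_in D Q0" "I \<subseteq> Q0" "Q0 \<subset> P"
      using one_le_ht_overE[of D I P] ht by (auto simp: one_enat_def)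
    have sub: "PV C \<subseteq> Q0" using var_ideal_single_subset[OF Q0(1,2) vars_mono True] Q0 by blast
    obtain a where a: "a \<in> P" "a \<notin> Q0" using Q0 by blast
    then have "kill C a \<noteq> 0" using sub prime_inD(1)[OF P(1)] unfolding var_ideal_def by blast
    then show ?thesis unfolding regular_one_def zero_at_def True
      using a by (intro bexI[of _ a]) (auto simp: kill_mult)
  next
    case False
    then obtain C' where C': "C' \<in> CC (vars P)" "C' \<noteq> C" using C by blast
    have "C \<noteq> vars P" if "C \<in> CC (vars P)" for C
      using that antichain[of _ C] CC_A C C' by metis
    then have "facet_sum \<in> P" by (rule facet_sum_mem[OF P(1)])
    then show ?thesis unfolding regular_one_def zero using facet_sum_nonzerodivisor by blast
  qed
qed

text \<open>With a single cover \<open>C\<close> the ring is locally the polynomial ring in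
  \<open>V - C\<close>, with \<open>kill C\<close> as the projection. The middle member
  \<open>Q1\<close> of a chain of length 2 restricts to the nonzero intermediate prime that
  \<open>exists_regular_pair\<close> asks for.\<close>

lemma regular_two_single:
  assumes P: "prime_in D P" "I \<subseteq> P" and ht: "enat 2 \<le> ht_over D I P" and C: "CC (vars P) = {C}"
  shows "regular_two P"
proof -
  define W where "W = V - C"
  have W: "W \<subseteq> V" "finite W" using finite_V by (auto simp: W_def)
  have CV: "C \<subseteq> V" using CC_V[of C "vars P"] C by blast
  obtain Q0 Q1 where Q: "prime_in D Q0" "prime_in D Q1" "I \<subseteq> Q0" "Q0 \<subset> Q1" "Q1 \<subset> P"
    using two_le_ht_overE[OF ht] by blast
  have sub0: "PV C \<subseteq> Q0" using var_ideal_single_subset[OF Q(1,3) vars_mono C] Q by blast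
  have kill_W: "kill C f \<in> polys_in W" if "f \<in> D" for f using kill_in[OF that] unfolding W_def .
  have kill_id_W: "kill C f = f" if "f \<in> polys_in W" for f :: "'k mpoly"
    using kill_id[OF that, of C] unfolding W_def by blast
  have kill_mem: "kill C f \<in> Q \<longleftrightarrow> f \<in> Q" if Q': "prime_in D Q" "PV C \<subseteq> Q" "f \<in> D" for Q f
  proof -
    have "f - kill C f \<in> PV C"
      using that(3) kill_closed[OF that(3), of C] by (simp add: var_ideal_def polys_in_diff kill_diff kill_kill)
    then have *: "f - kill C f \<in> Q" using Q' by blast
    show ?thesis
    proof
      assume "kill C f \<in> Q"
      then have "(f - kill C f) + kill C f \<in> Q" using * prime_inD(4)[OF Q'(1)] by blast
      then show "f \<in> Q" by simp
    next
      assume "f \<in> Q"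
      then have "f - (f - kill C f) \<in> Q" using * prime_in_diff[OF Q'(1) subring_polys_in] by blast
      then show "kill C f \<in> Q" by simp
    qed
  qed
  have "\<exists>f\<in>P \<inter> polys_in W. \<exists>g\<in>P \<inter> polys_in W. f \<noteq> 0 \<and> (\<forall>c\<in>polys_in W. \<forall>h\<in>polys_in W. g * c = f * h \<longrightarrow> loc_dvd (polys_in W) (P \<inter> polys_in W) f c)"
  proof (rule exists_regular_pair[OF W(2)])
    show "prime_in (polys_in W) (P \<inter> polys_in W)" "prime_in (polys_in W) (Q1 \<inter> polys_in W)"
      using prime_in_restrict W P Q by blast+
    have "\<exists>f\<in>P \<inter> polys_in W. f \<notin> Q1"
    proof -
      obtain f where f: "f \<in> P" "f \<notin> Q1" using Q by blast
      then have fD: "f \<in> D" using prime_inD(1)[OF P(1)] by blast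
      show ?thesis
        using kill_mem[OF P(1) _ fD] kill_mem[OF Q(2) _ fD] kill_W[OF fD] sub0 Q f
        by (intro bexI[of _ "kill C f"]) auto
    qed
    then show "Q1 \<inter> polys_in W \<subset> P \<inter> polys_in W" using Q by blast
    obtain f where f: "f \<in> Q1" "f \<notin> Q0" using Q by blast
    then have fD: "f \<in> D" using prime_inD(1)[OF Q(2)] by blast
    have "kill C f \<in> Q1 \<inter> polys_in W" using kill_mem[OF Q(2) _ fD] kill_W[OF fD] sub0 Q f by auto
    moreover have "kill C f \<noteq> 0" using f sub0 fD unfolding var_ideal_def by blast
    ultimately show "Q1 \<inter> polys_in W \<noteq> {0}" by blast
  qed
  then obtain a b where ab: "a \<in> P" "a \<in> polys_in W" "b \<in> P" "b \<in> polys_in W" "a \<noteq> 0"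
    "\<And>c h. c \<in> polys_in W \<Longrightarrow> h \<in> polys_in W \<Longrightarrow> b * c = a * h \<Longrightarrow> loc_dvd (polys_in W) (P \<inter> polys_in W) a c"
    by blast
  have zero: "zero_at (vars P) c \<longleftrightarrow> kill C c = 0" for c unfolding zero_at_def C by simp
  have "\<exists>s\<in>D - P. \<exists>e\<in>D. zero_at (vars P) (s * c - a * e)"
    if c: "c \<in> D" "e \<in> D" "zero_at (vars P) (b * c - a * e)" for c e
  proof -
    have "b * kill C c = a * kill C e"
      using c(3) kill_id_W[OF ab(2)] kill_id_W[OF ab(4)] by (simp add: zero kill_diff kill_mult)
    then obtain s h where s: "s \<in> polys_in W" "s \<notin> P" "h \<in> polys_in W" "s * kill C c = a * h"
      using ab(6)[OF kill_W[OF c(1)] kill_W[OF c(2)]] unfolding loc_dvd_def by blast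
    have "zero_at (vars P) (s * c - a * h)"
      using s kill_id_W[OF ab(2)] kill_id_W[OF s(1)] kill_id_W[OF s(3)] by (simp add: zero kill_diff kill_mult)
    then show ?thesis using s polys_in_mono[OF W(1)] by blast
  qed
  moreover have "zero_at (vars P) c" if "zero_at (vars P) (a * c)" for c
    using that ab(5) kill_id_W[OF ab(2)] by (simp add: zero kill_mult)
  ultimately show ?thesis unfolding regular_two_def using ab(1,3) by blast
qed

text \<open>With several covers the facet sum comes first. The second element \<open>b\<close> must
  survive on each codimension-one face of each facet, and on each intersection of two facets unless
  \<open>P\<close> is a variable ideal and the intersection is empty, where \<open>conn\<close>
  takes over.\<close>

lemma regular_two_of_height:
  assumes P: "prime_in D P" "I \<subseteq> P" and ht: "enat 2 \<le> ht_over D I P"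
    and conn: "P = PV (vars P) \<Longrightarrow> conn_on (CC (vars P)) (meet (vars P))"
  shows "regular_two P"
proof -
  define A where "A = vars P"
  interpret antichain V A "CC A" unfolding A_def by (rule antichain_CC[OF vars_V])
  have zero: "zero_at A c \<longleftrightarrow> zero_on c" for c by (simp add: zero_at_def zero_on_def)
  have meet: "meet A = meet_graph" by (simp add: meet_def meet_graph_def)
  have conn': "conn_on (CC A) meet_graph" if "P = PV A"
    using conn that unfolding A_def[symmetric] meet by blast
  have cov: "cover A" unfolding A_def using I_subset_iff_cover P by blast
  then obtain C where C: "C \<in> CC A" using exists_min_cover unfolding CC_def by blast
  show ?thesis
  proof (cases "CC A = {C}")
    case True
    then show ?thesis using regular_two_single[OF P ht] unfolding A_def by blast
  next
    case False
    then obtain C0 where C0: "C0 \<in> CC A" "C0 \<noteq> C" using C by blast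
    have strict: "C' \<noteq> A" if "C' \<in> CC A" for C'
      using that antichain[of _ C'] CC_A C C0 by metis
    have other: "\<exists>C''\<in>CC A. C' \<noteq> C''" for C' using C C0 by blast
    have fP: "facet_sum \<in> P" using facet_sum_mem[OF P(1)] strict unfolding A_def by blast
    have "\<exists>b\<in>P. (\<forall>C\<in>CC A. \<forall>v\<in>A - C. kill (insert v C) b \<noteq> 0) \<and>
      (\<forall>C\<in>CC A. \<forall>C'\<in>CC A. kill (C \<union> C') b = 0 \<longrightarrow> P = PV A \<and> C \<union> C' = A)"
    proof (cases "P = PV A")
      case False
      \<comment> \<open>An element that survives \<open>kill A\<close> survives
        \<open>kill U\<close> for every \<open>U \<subseteq> A\<close>, so no intersection is left
        to connectedness.\<close>
      then obtain b where b: "b \<in> P" "b \<notin> PV A" using var_ideal_vars_subset[OF P(1)] unfolding A_def by blast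
      then have "kill A b \<noteq> 0" using prime_inD(1)[OF P(1)] unfolding var_ideal_def by blast
      then have "kill U b \<noteq> 0" if "U \<subseteq> A" for U using kill_eq_0_mono that by blast
      moreover have "insert v C \<subseteq> A" if "C \<in> CC A" "v \<in> A - C" for v C using CC_A that by blast
      moreover have "C \<union> C' \<subseteq> A" if "C \<in> CC A" "C' \<in> CC A" for C C' using CC_A that by blast
      ultimately have "\<And>C v. C \<in> CC A \<Longrightarrow> v \<in> A - C \<Longrightarrow> kill (insert v C) b \<noteq> 0"
        "\<And>C C'. C \<in> CC A \<Longrightarrow> C' \<in> CC A \<Longrightarrow> kill (C \<union> C') b \<noteq> 0"
        by simp_all
      then show ?thesis using b(1) by (intro bexI[of _ b]) auto
    next
      case True
      \<comment> \<open>A linear form that restricts to 0 on the empty face only. The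
        codimension-one faces of the facets are nonempty by
        \<open>meet_graph_two_left\<close>.\<close>
      define b :: "'k mpoly" where "b = (\<Sum>v\<in>A. var v)"
      have kb: "kill U b \<noteq> 0" if "\<not> A \<subseteq> U" for U
      proof -
        have "kill U b = (\<Sum>v\<in>A - U. var v)"
          unfolding b_def kill_sum using finite_A
          by (subst sum.mono_neutral_right[of A "A - U"]) (auto simp: kill_var intro!: sum.cong)
        then show ?thesis using sum_var_nonzero[of "A - U"] finite_A that by auto
      qed
      have "b \<in> P" unfolding b_def by (rule prime_in_sum[OF P(1)]) (simp add: A_def vars_def)
      moreover have "kill (insert v C') b \<noteq> 0" if "C' \<in> CC A" "v \<in> A - C'" for C' v
        using meet_graph_two_left[OF conn'[OF True] that(1) _ _ that(2)] other[of C'] kb by blast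
      moreover have "C \<union> C' = A" if "C \<in> CC A" "C' \<in> CC A" "kill (C \<union> C') b = 0" for C C'
        using kb[of "C \<union> C'"] that CC_A by blast
      ultimately show ?thesis using True by blast
    qed
    then obtain b where b: "b \<in> P" "\<And>C v. C \<in> CC A \<Longrightarrow> v \<in> A - C \<Longrightarrow> kill (insert v C) b \<noteq> 0"
      "\<And>C C'. C \<in> CC A \<Longrightarrow> C' \<in> CC A \<Longrightarrow> kill (C \<union> C') b = 0 \<Longrightarrow> P = PV A \<and> C \<union> C' = A" by blast
    have bD: "b \<in> D" using b(1) prime_inD(1)[OF P(1)] by blast
    have compat: "kill (C \<union> C') (t C) = kill (C \<union> C') (t C')"
      if t: "\<And>C C'. C \<in> CC A \<Longrightarrow> C' \<in> CC A \<Longrightarrow> kill (C \<union> C') b \<noteq> 0 \<Longrightarrow> kill (C \<union> C') (t C) = kill (C \<union> C') (t C')"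
        and C: "C \<in> CC A" "C' \<in> CC A" for t :: "nat set \<Rightarrow> 'k mpoly" and C C'
    proof (cases "P = PV A")
      case False
      then show ?thesis using t[OF C] b(3)[OF C] by blast
    next
      case True
      show ?thesis
      proof (rule meet_graph_compat[OF conn'[OF True] _ C])
      fix B B' assume XY: "(B, B') \<in> meet_graph"
      then have "kill (B \<union> B') b \<noteq> 0" using b(3)[of B B'] unfolding meet_graph_def by blast
      then show "kill (B \<union> B') (t B) = kill (B \<union> B') (t B')" using t XY unfolding meet_graph_def by blast
      qed
    qed
    have reg: "\<exists>e\<in>D. zero_on (c - facet_sum * e)"
      if "c \<in> D" "e \<in> D" "zero_on (b * c - facet_sum * e)" for c e
      by (rule facet_sum_regular[OF bD that(1,2) b(2) compat strict that(3)])
    have "\<exists>s\<in>D - P. \<exists>e\<in>D. zero_on (s * c - facet_sum * e)"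
      if "c \<in> D" "e \<in> D" "zero_on (b * c - facet_sum * e)" for c e
      using reg[OF that] prime_inD(3)[OF P(1)] by (rule_tac bexI[of _ 1]) simp_all
    then show ?thesis
      unfolding regular_two_def A_def[symmetric] zero using fP b(1) facet_sum_nonzerodivisor by blast
  qed
qed

lemma meet_conn_of_regular_two:
  assumes "A \<subseteq> V" "regular_two (PV A)"
  shows "conn_on (CC A) (meet A)"
proof -
  interpret antichain V A "CC A" using assms(1) by (rule antichain_CC)
  have zero: "zero_at A c \<longleftrightarrow> zero_on c" for c by (simp add: zero_at_def zero_on_def)
  have meet: "meet A = meet_graph" by (simp add: meet_def meet_graph_def)
  obtain a b where ab: "a \<in> PV A" "b \<in> PV A" "\<And>c. c \<in> D \<Longrightarrow> zero_on (a * c) \<Longrightarrow> zero_on c"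
    "\<And>c e. c \<in> D \<Longrightarrow> e \<in> D \<Longrightarrow> zero_on (b * c - a * e) \<Longrightarrow> \<exists>s\<in>D - PV A. \<exists>e\<in>D. zero_on (s * c - a * e)"
    using assms(2) unfolding regular_two_def vars_var_ideal[OF assms(1)] zero by blast
  show ?thesis unfolding meet by (rule conn_of_regular_pair[OF ab])
qed

text \<open>The graph \<open>min_prime_graph k\<close> transported to minimal covers
  (\<open>connected_iff\<close>). Heights are those over \<open>I\<close> before localization, so an
  edge does not depend on \<open>A\<close>.\<close>

definition height_graph :: "nat \<Rightarrow> nat set \<Rightarrow> (nat set \<times> nat set) set" where
  "height_graph k A = {(C, C'). C \<in> CC A \<and> C' \<in> CC A \<and> C \<noteq> C' \<and>
     1 \<le> ht_over D I (PV (C \<union> C')) \<and> ht_over D I (PV (C \<union> C')) \<le> enat k}"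

text \<open>Distinct minimal covers are incomparable, so \<open>PV C\<close> lies strictly below
  \<open>PV (C \<union> C')\<close>.\<close>

lemma one_le_ht_union:
  assumes "C \<in> CC A" "C' \<in> CC A" "C \<noteq> C'"
  shows "1 \<le> ht_over D I (PV (C \<union> C'))"
proof (rule one_le_ht_over[OF prime_var_ideal prime_var_ideal])
  have V: "C \<subseteq> V" "C' \<subseteq> V" using CC_V assms by auto
  show "I \<subseteq> PV C" using I_subset_var_ideal[OF V(1)] CC_cover[OF assms(1)] by blast
  have "\<not> C' \<subseteq> C" using assms CC_cover[OF assms(2)] unfolding CC_def min_cover_def by blast
  then show "PV C \<subset> PV (C \<union> C')"
    using var_ideal_subset_iff[of C V "C \<union> C'", where 'k = 'k] var_ideal_subset_iff[of "C \<union> C'" V C, where 'k = 'k] V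
    by auto
qed

lemma meet_conn_of_height_graph_conn:
  assumes "A \<subseteq> V" "enat (k + 1) \<le> ht_over D I (PV A)" "conn_on (CC A) (height_graph k A)"
  shows "conn_on (CC A) (meet A)"
proof -
  have "height_graph k A \<subseteq> meet A"
  proof (clarsimp simp: height_graph_def meet_def)
    fix C C' assume "ht_over D I (PV (C \<union> C')) \<le> enat k" "A = C \<union> C'"
    then have "enat (k + 1) \<le> enat k" using assms(2) by (metis order_trans)
    then show False by simp
  qed
  then show ?thesis using assms(3) rtrancl_mono unfolding conn_on_def by blast
qed

lemma height_graph_conn:
  assumes "A \<subseteq> V"
    and meet: "\<And>B. B \<subseteq> V \<Longrightarrow> cover B \<Longrightarrow> enat (k + 1) \<le> ht_over D I (PV B) \<Longrightarrow> conn_on (CC B) (meet B)"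
  shows "conn_on (CC A) (height_graph k A)"
proof -
  have "finite A" using assms(1) finite_V finite_subset by blast
  then show ?thesis using assms(1)
  proof (induction A rule: finite_psubset_induct)
    case (psubset A)
    show ?case
    proof (cases "cover A \<and> enat (k + 1) \<le> ht_over D I (PV A)")
      \<comment> \<open>Either no cover lies inside \<open>A\<close>, or \<open>PV A\<close> has
        height at most \<open>k\<close>; then monotonicity of the height makes all distinct covers
        adjacent.\<close>
      case False
      have "(C, C') \<in> (height_graph k A)\<^sup>*" if C: "C \<in> CC A" "C' \<in> CC A" for C C'
      proof (cases "C = C'")
        case False
        have CA: "C \<subseteq> A" "C' \<subseteq> A" using C unfolding CC_def by auto
        have "cover A" using CC_cover[OF C(1)] CA psubset.prems unfolding cover_def by blast
        then have "ht_over D I (PV A) \<le> enat k"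
          using \<open>\<not> (cover A \<and> _)\<close> by (cases "ht_over D I (PV A)") auto
        moreover have "ht_over D I (PV (C \<union> C')) \<le> ht_over D I (PV A)"
          using CA by (intro ht_over_mono prime_var_ideal var_ideal_mono) auto
        ultimately have "(C, C') \<in> height_graph k A"
          using one_le_ht_union[OF C False] C False unfolding height_graph_def by auto
        then show ?thesis by blast
      qed simp
      then show ?thesis unfolding conn_on_def by blast
    next
      case True
      have step: "(C, C') \<in> (height_graph k A)\<^sup>*" if "(C, C') \<in> meet A" for C C'
      proof -
        have C: "C \<in> CC A" "C' \<in> CC A" "C \<union> C' \<noteq> A" using that unfolding meet_def by auto
        define B where "B = C \<union> C'"
        have B: "B \<subset> A" using C unfolding B_def CC_def by blast
        have "(C, C') \<in> (height_graph k B)\<^sup>*"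
          using psubset.IH[OF B] B psubset.prems C unfolding conn_on_def CC_def B_def by blast
        \<comment> \<open>An edge inside \<open>B\<close> has the same height in \<open>A\<close>,
          so the path found in the smaller set is also a path for \<open>A\<close>.\<close>
        moreover have "height_graph k B \<subseteq> height_graph k A"
          using CC_mono[of B A] B unfolding height_graph_def by blast
        ultimately show ?thesis using rtrancl_mono by blast
      qed
      have path: "(C, C') \<in> (height_graph k A)\<^sup>*" if "(C, C') \<in> (meet A)\<^sup>*" for C C'
        using that by (induction rule: rtrancl_induct) (auto intro: rtrancl_trans step)
      have "conn_on (CC A) (meet A)" using meet[OF psubset.prems] True by simp
      then show ?thesis unfolding conn_on_def by (simp add: path)
    qed
  qed
qed

end

section \<open>The equivalence\<close>

lemma connected_pair_digraph_iff:
  assumes "sym (parcs H)" "parcs H \<subseteq> pverts H \<times> pverts H"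
  shows "Digraph_Component.connected (with_proj H) \<longleftrightarrow> pverts H \<noteq> {} \<and> conn_on (pverts H) (parcs H)"
proof -
  define K where "K = with_proj (mk_symmetric (with_proj H))"
  have verts: "verts K = pverts H" unfolding K_def by (simp add: with_proj_def)
  have "parcs (mk_symmetric (with_proj H)) = parcs H"
    using assms(1) by (auto simp: parcs_mk_symmetric with_proj_def sym_def)
  then have arcs: "arcs_ends K = parcs H"
    unfolding K_def by (force simp: arcs_ends_def arc_to_ends_def with_proj_def)
  have reach: "(u, v) \<in> rtrancl_on (pverts H) (parcs H) \<longleftrightarrow> (u, v) \<in> (parcs H)\<^sup>*" if u: "u \<in> pverts H" for u v
  proof
    assume "(u, v) \<in> rtrancl_on (pverts H) (parcs H)"
    then show "(u, v) \<in> (parcs H)\<^sup>*"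
      by (induction rule: rtrancl_on_induct) (auto intro: rtrancl_into_rtrancl)
  next
    assume "(u, v) \<in> (parcs H)\<^sup>*"
    then show "(u, v) \<in> rtrancl_on (pverts H) (parcs H)"
    proof (induction rule: rtrancl_induct)
      case base
      then show ?case using u by blast
    next
      case (step y z)
      then show ?case using assms(2) by (meson rtrancl_on_into_rtrancl_on mem_Sigma_iff subsetD)
    qed
  qed
  show ?thesis
    unfolding Digraph_Component.connected_def K_def[symmetric] strongly_connected_def reachable_def verts arcs conn_on_def
    using reach by auto
qed

lemma min_le_iff_enat:
  fixes d x :: enat
  shows "min (enat 2) (d - enat j) \<le> x \<longleftrightarrow>
    (enat (j + 1) \<le> d \<longrightarrow> enat 1 \<le> x) \<and> (enat (j + 2) \<le> d \<longrightarrow> enat 2 \<le> x)"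
  by (cases d; cases x) (auto simp: min_def)

lemma ideal_of_prime_in:
  assumes "subring_set D" "prime_in D Q"
  shows "ideal Q (subring_of D)"
proof -
  interpret S: cring "subring_of D" by (rule subring_of_cring[OF assms(1)])
  note Q = prime_inD[OF assms(2)]
  show ?thesis
  proof (rule idealI[OF S.ring_axioms])
    show "subgroup Q (add_monoid (subring_of D))"
    proof (rule S.add.subgroupI)
      fix x assume x: "x \<in> Q"
      then have "x \<in> D" "- x \<in> Q"
        using Q(1,2) prime_in_diff[OF assms(2,1), of 0 x] by auto
      moreover from this have "\<ominus>\<^bsub>subring_of D\<^esub> x = - x"
        using subring_set_closed[OF assms(1)] by (intro S.minus_equality) (auto simp: subring_of_simps)
      ultimately show "\<ominus>\<^bsub>subring_of D\<^esub> x \<in> Q" by simp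
    qed (use Q in \<open>auto simp: subring_of_simps\<close>)
  qed (use Q in \<open>auto simp: subring_of_simps\<close>)
qed

lemma squarefree_monomial_eq:
  assumes "\<And>i. lkp m i \<le> 1"
  shows "(sngl m 1 :: ('k::field) mpoly) = var_prod (supp m)"
proof -
  have "var_prod F = (sngl (\<Sum>i\<in>F. sngl i 1) 1 :: 'k mpoly)" if "finite F" for F
    using that by (induction F) (auto simp: var_prod_def var_def mult_single single_one)
  moreover have "(\<Sum>i\<in>supp m. sngl i 1) = m"
  proof (rule poly_mapping_eqI)
    fix k
    have "lkp m k = 1" if "k \<in> supp m" using that assms[of k] by (simp add: in_keys_iff)
    then show "lkp (\<Sum>i\<in>supp m. sngl i 1) k = lkp m k"
      by (cases "k \<in> supp m") (auto simp: lookup_sum lookup_single when_def in_keys_iff)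
  qed
  ultimately show ?thesis by (metis finite_keys)
qed

lemma mpoly_ring_eq: "mpoly_ring n = subring_of (polys_in {..<n})"
  by (simp add: mpoly_ring_def subring_of_def polys_in_def)

lemma squarefree_ideal_of_monomials:
  fixes M :: "('k::field) mpoly set"
  assumes M: "M \<subseteq> squarefree_monomials n"
  shows "squarefree_ideal {..<n} {supp m | m. sngl m 1 \<in> M} (Idl\<^bsub>mpoly_ring n\<^esub> M)"
proof
  define D :: "'k mpoly set" where "D = polys_in {..<n}"
  have sub: "subring_set D" unfolding D_def by (rule subring_polys_in)
  interpret S: cring "subring_of D" by (rule subring_of_cring[OF sub])
  have R: "mpoly_ring n = subring_of D" unfolding D_def by (rule mpoly_ring_eq)
  have MD: "M \<subseteq> carrier (subring_of D)"
    using M unfolding squarefree_monomials_def D_def by (auto simp: subring_of_simps)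
  have sq: "supp m \<subseteq> {..<n}" "sngl m 1 = (var_prod (supp m) :: 'k mpoly)" if m: "sngl m 1 \<in> M" for m
  proof -
    obtain m' where "(sngl m 1 :: 'k mpoly) = sngl m' 1" "supp m' \<subseteq> {..<n}" "\<forall>i. lkp m' i \<le> 1"
      using M m unfolding squarefree_monomials_def by blast
    moreover from this(1) have "m = m'"
      by (metis keys_single one_neq_zero singleton_inject)
    ultimately show "supp m \<subseteq> {..<n}" "sngl m 1 = (var_prod (supp m) :: 'k mpoly)"
      using squarefree_monomial_eq by auto
  qed
  define GG where "GG = {supp m | m. (sngl m 1 :: 'k mpoly) \<in> M}"
  have M_eq: "M = var_prod ` GG"
  proof (intro equalityI subsetI)
    fix f assume f: "f \<in> M"
    then obtain m where m: "f = sngl m 1" using M unfolding squarefree_monomials_def by blast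
    then have "f = var_prod (supp m)" "supp m \<in> GG" using sq(2)[of m] f unfolding GG_def by auto
    then show "f \<in> var_prod ` GG" by blast
  next
    fix f :: "'k mpoly" assume "f \<in> var_prod ` GG"
    then obtain m where "f = var_prod (supp m)" "sngl m 1 \<in> M" unfolding GG_def by blast
    then show "f \<in> M" using sq(2)[of m] by simp
  qed
  show "finite {..<n}" by simp
  show "G \<subseteq> {..<n}" if "G \<in> {supp m | m. sngl m 1 \<in> M}" for G
    using that sq(1) by blast
  show "Idl\<^bsub>mpoly_ring n\<^esub> M \<subseteq> Q \<longleftrightarrow> (\<forall>G\<in>{supp m | m. sngl m 1 \<in> M}. var_prod G \<in> Q)"
    if Q: "prime_in (polys_in {..<n}) Q" for Q :: "'k mpoly set"
  proof -
    have "ideal Q (subring_of D)" using Q sub unfolding D_def by (intro ideal_of_prime_in)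
    then have "Idl\<^bsub>mpoly_ring n\<^esub> M \<subseteq> Q \<longleftrightarrow> M \<subseteq> Q"
      unfolding R using S.genideal_self[OF MD] S.genideal_minimal by blast
    also have "\<dots> \<longleftrightarrow> (\<forall>G\<in>GG. var_prod G \<in> Q)"
      unfolding M_eq by (rule image_subset_iff)
    finally show ?thesis unfolding GG_def .
  qed
  show "f \<in> Idl\<^bsub>mpoly_ring n\<^esub> M"
    if f: "f \<in> polys_in {..<n}" "\<And>m. m \<in> supp f \<Longrightarrow> \<exists>G\<in>{supp m | m. sngl m 1 \<in> M}. G \<subseteq> supp m" for f
  proof -
    define J where "J = Idl\<^bsub>mpoly_ring n\<^esub> M"
    interpret J: ideal J "subring_of D" unfolding J_def R by (rule S.genideal_ideal[OF MD])
    have MJ: "M \<subseteq> J" unfolding J_def R by (rule S.genideal_self[OF MD])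
    have single: "sngl m c \<in> J" if m: "m \<in> supp f" for m c
    proof -
      obtain m0 where m0: "sngl m0 1 \<in> M" "supp m0 \<subseteq> supp m" using f(2)[OF m] by blast
      obtain m' where m': "(sngl m0 1 :: 'k mpoly) = sngl m' 1" "\<forall>i. lkp m' i \<le> 1"
        using M m0 unfolding squarefree_monomials_def by blast
      then have "m0 = m'" by (metis keys_single one_neq_zero singleton_inject)
      then have le: "lkp m0 i \<le> 1" for i using m' by simp
      \<comment> \<open>Subtraction of exponents truncates. It is exact here because
        \<open>m0\<close> is squarefree, so that inclusion of supports already means
        divisibility.\<close>
      have "m = (m - m0) + m0"
      proof (rule poly_mapping_eqI)
        fix k
        have "lkp m0 k \<le> lkp m k"
        proof (cases "k \<in> supp m0")
          case True
          then have "lkp m k \<noteq> 0" using m0(2) in_keys_iff by fastforce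
          then show ?thesis using le[of k] by simp
        qed (simp add: in_keys_iff)
        then show "lkp m k = lkp (m - m0 + m0) k" by (simp add: lookup_add lookup_minus)
      qed
      then have eq: "sngl m c = sngl (m - m0) c * sngl m0 1" unfolding mult_single by simp
      have "supp (m - m0) \<subseteq> supp m" by (auto simp: in_keys_iff lookup_minus)
      then have "sngl (m - m0) c \<in> carrier (subring_of D)"
        using m f(1) unfolding D_def polys_in_def by (auto simp: subring_of_simps)
      then have "sngl (m - m0) c * sngl m0 1 \<in> J"
        using J.I_l_closed[of "sngl m0 1" "sngl (m - m0) c"] MJ m0(1) by (auto simp: subring_of_simps)
      then show ?thesis unfolding eq .
    qed
    have "(\<Sum>m\<in>Y. sngl m (lkp f m)) \<in> J" if "finite Y" "Y \<subseteq> supp f" for Y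
      using that
    proof (induction Y)
      case empty
      then show ?case using J.zero_closed by (simp add: subring_of_simps)
    next
      case (insert m Y)
      then show ?case using J.a_closed[of "sngl m (lkp f m)" "\<Sum>m\<in>Y. sngl m (lkp f m)"] single
        by (simp add: subring_of_simps)
    qed
    from this[of "supp f"] show ?thesis using poly_mapping_sum_single[of f] unfolding J_def by simp
  qed
qed

locale squarefree_local = squarefree_ideal V GG I + local_frac "polys_in V" I P L h
  for V GG and I P :: "('k::field) mpoly set" and L :: "('l, 'm) ring_scheme" and h
begin

lemma h_eq_zero_iff: "c \<in> D \<Longrightarrow> h c = \<zero>\<^bsub>L\<^esub> \<longleftrightarrow> zero_at (vars P) c"
  using h_zero_iff local_zero_iff[OF prime_P] by (simp add: zero_at_def)

lemma P_D: "P \<subseteq> D" using prime_inD(1)[OF prime_P] .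

lemma one_le_local_depth:
  assumes "enat 1 \<le> krull_dim L"
  shows "enat 1 \<le> local_depth L"
proof -
  obtain a where a: "a \<in> P" "\<forall>c\<in>D. zero_at (vars P) (a * c) \<longrightarrow> zero_at (vars P) c"
    using regular_one_of_height[OF prime_P I_subset_P] assms unfolding krull_dim_eq regular_one_def by blast
  show ?thesis
  proof (rule one_le_local_depthI[OF a(1)])
    fix c assume c: "c \<in> D" "h (a * c) = \<zero>\<^bsub>L\<^esub>"
    then show "h c = \<zero>\<^bsub>L\<^esub>"
      using a h_eq_zero_iff[OF c(1)] h_eq_zero_iff[of "a * c"] P_D polys_in_mult by blast
  qed
qed

lemma two_le_local_depth_iff: "enat 2 \<le> local_depth L \<longleftrightarrow> regular_two P"
proof
  assume "enat 2 \<le> local_depth L"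
  then obtain a b where ab: "a \<in> P" "b \<in> P" "\<And>c. c \<in> D \<Longrightarrow> h (a * c) = \<zero>\<^bsub>L\<^esub> \<Longrightarrow> h c = \<zero>\<^bsub>L\<^esub>"
    "\<And>c e. c \<in> D \<Longrightarrow> e \<in> D \<Longrightarrow> h (b * c - a * e) = \<zero>\<^bsub>L\<^esub> \<Longrightarrow> \<exists>s\<in>D - P. \<exists>e\<in>D. h (s * c - a * e) = \<zero>\<^bsub>L\<^esub>"
    using two_le_local_depthE by blast
  have D: "x * c \<in> D" if "x \<in> P" "c \<in> D" for x c using that P_D polys_in_mult by blast
  have "zero_at (vars P) c" if "c \<in> D" "zero_at (vars P) (a * c)" for c
    using ab(3)[OF that(1)] that h_eq_zero_iff D[OF ab(1)] by simp
  moreover have "\<exists>s\<in>D - P. \<exists>e\<in>D. zero_at (vars P) (s * c - a * e)"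
    if c: "c \<in> D" "e \<in> D" "zero_at (vars P) (b * c - a * e)" for c e
  proof -
    have "b * c - a * e \<in> D" by (intro polys_in_diff D ab(1,2) c(1,2))
    then obtain s e' where s: "s \<in> D - P" "e' \<in> D" "h (s * c - a * e') = \<zero>\<^bsub>L\<^esub>"
      using ab(4)[OF c(1,2)] c(3) h_eq_zero_iff by auto
    then have "s * c - a * e' \<in> D" using c(1) by (intro polys_in_diff polys_in_mult D[OF ab(1)]) auto
    then show ?thesis using s h_eq_zero_iff by blast
  qed
  ultimately show "regular_two P" unfolding regular_two_def using ab(1,2) by blast
next
  assume "regular_two P"
  then obtain a b where ab: "a \<in> P" "b \<in> P" "\<And>c. c \<in> D \<Longrightarrow> zero_at (vars P) (a * c) \<Longrightarrow> zero_at (vars P) c"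
    "\<And>c e. c \<in> D \<Longrightarrow> e \<in> D \<Longrightarrow> zero_at (vars P) (b * c - a * e) \<Longrightarrow>
      \<exists>s\<in>D - P. \<exists>e\<in>D. zero_at (vars P) (s * c - a * e)"
    unfolding regular_two_def by blast
  have D: "x * c \<in> D" if "x \<in> P" "c \<in> D" for x c using that P_D polys_in_mult by blast
  show "enat 2 \<le> local_depth L"
  proof (rule two_le_local_depthI[OF ab(1,2)])
    show "h c = \<zero>\<^bsub>L\<^esub>" if "c \<in> D" "h (a * c) = \<zero>\<^bsub>L\<^esub>" for c
      using ab(3)[OF that(1)] that h_eq_zero_iff D[OF ab(1)] by simp
    fix c e assume c: "c \<in> D" "e \<in> D" "h (b * c - a * e) = \<zero>\<^bsub>L\<^esub>"
    have "b * c - a * e \<in> D" by (intro polys_in_diff D ab(1,2) c(1,2))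
    then obtain s e' where s: "s \<in> D - P" "e' \<in> D" "zero_at (vars P) (s * c - a * e')"
      using ab(4)[OF c(1,2)] c(3) h_eq_zero_iff by auto
    then have "s * c - a * e' \<in> D" using c(1) by (intro polys_in_diff polys_in_mult D[OF ab(1)]) auto
    then show "\<exists>s\<in>D - P. \<exists>e\<in>D. h (s * c - a * e) = \<zero>\<^bsub>L\<^esub>" using s h_eq_zero_iff by blast
  qed
qed

lemma serre_local_iff:
  "min (enat 2) (krull_dim L - enat j) \<le> local_depth L \<longleftrightarrow>
     (enat (j + 2) \<le> ht_over D I P \<longrightarrow> regular_two P)"
proof -
  have "enat 1 \<le> local_depth L" if "enat (j + 1) \<le> krull_dim L"
    using one_le_local_depth that by (metis enat_ord_simps(1) le_add2 order_trans)
  then show ?thesis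
    unfolding min_le_iff_enat two_le_local_depth_iff krull_dim_eq[symmetric] by blast
qed

lemma PV_below:
  assumes "C \<in> CC (vars P)"
  shows "PV C \<in> primes_below"
proof -
  have "I \<subseteq> PV C" using I_subset_var_ideal[OF CC_V[OF assms]] CC_cover[OF assms] by simp
  moreover have "PV C \<subseteq> P"
    using var_ideal_subset_iff_vars[OF CC_V[OF assms] prime_P] assms by (simp add: CC_def)
  ultimately show ?thesis unfolding primes_below_def using prime_var_ideal by simp
qed

lemma minimal_below_eq: "minimal_below = PV ` CC (vars P)"
proof (intro equalityI subsetI)
  fix Q assume Q: "Q \<in> minimal_below"
  then have "prime_in D Q \<and> I \<subseteq> Q \<and> (\<forall>Q'. prime_in D Q' \<longrightarrow> I \<subseteq> Q' \<longrightarrow> Q' \<subseteq> Q \<longrightarrow> Q' = Q)"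
    unfolding minimal_below_def primes_below_def by simp
  then have "\<exists>C. min_cover C \<and> Q = PV C" by (rule minimal_prime_iff[THEN iffD1])
  then obtain C where C: "min_cover C" "Q = PV C" by blast
  have "C \<subseteq> V" using C(1) unfolding min_cover_def cover_def by simp
  moreover have "Q \<subseteq> P" using Q unfolding minimal_below_def primes_below_def by simp
  ultimately have "C \<subseteq> vars P" using var_ideal_subset_iff_vars[OF _ prime_P] C(2) by simp
  then show "Q \<in> PV ` CC (vars P)" using C unfolding CC_def by simp
next
  fix Q assume "Q \<in> PV ` CC (vars P)"
  then obtain C where C: "C \<in> CC (vars P)" "Q = PV C" by blast
  then have "\<exists>C. min_cover C \<and> Q = PV C" unfolding CC_def by blast
  then show "Q \<in> minimal_below"
    unfolding minimal_prime_iff[symmetric] minimal_below_def using PV_below[OF C(1)] C(2) by simp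
qed

lemma height_pair:
  assumes "C \<in> CC (vars P)" "C' \<in> CC (vars P)"
  shows "height L (exten (PV C) <+>\<^bsub>L\<^esub> exten (PV C')) = ht_over D I (PV (C \<union> C'))"
proof (rule height_sum_eq[OF PV_below[OF assms(1)] PV_below[OF assms(2)]])
  have V: "C \<subseteq> V" "C' \<subseteq> V" "C \<union> C' \<subseteq> V" using assms CC_V by auto
  have sub: "PV C \<subseteq> PV (C \<union> C')" "PV C' \<subseteq> PV (C \<union> C')" by (auto intro!: var_ideal_mono)
  then show "PV C \<subseteq> PV (C \<union> C')" "PV C' \<subseteq> PV (C \<union> C')" by auto
  have "PV (C \<union> C') \<subseteq> P" using assms var_ideal_subset_iff_vars[OF V(3) prime_P] unfolding CC_def by simp
  then show "PV (C \<union> C') \<in> primes_below"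
    using PV_below[OF assms(1)] sub(1) prime_var_ideal unfolding primes_below_def by blast
  show "PV (C \<union> C') \<subseteq> T" if "prime_in D T" "PV C \<subseteq> T" "PV C' \<subseteq> T" for T
    using that var_ideal_subset_iff_vars V by simp
qed

lemma connected_iff:
  "Digraph_Component.connected (min_prime_graph k L) \<longleftrightarrow> conn_on (CC (vars P)) (height_graph k (vars P))"
proof -
  define \<phi> where "\<phi> C = exten (PV C)" for C
  let ?C = "CC (vars P)" and ?H = "height_graph k (vars P)"
  have inj: "inj_on \<phi> ?C"
  proof (rule inj_onI)
    fix C C' assume C: "C \<in> ?C" "C' \<in> ?C" "\<phi> C = \<phi> C'"
    then have "PV C = PV C'" using ext_inj[OF PV_below[OF C(1)] PV_below[OF C(2)]] unfolding \<phi>_def by simp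
    then show "C = C'" using var_ideal_inj[OF CC_V[OF C(1)] CC_V[OF C(2)], where 'k = 'k] by simp
  qed
  have HC: "?H \<subseteq> ?C \<times> ?C" unfolding height_graph_def by blast
  have mp: "minimal_primes L = \<phi> ` ?C"
    unfolding minimal_primes_eq minimal_below_eq \<phi>_def by (simp add: image_image)
  have parcs: "parcs (min_prime_graph k L) = map_prod \<phi> \<phi> ` ?H"
  proof (intro equalityI subrelI subsetI)
    fix p q assume "(p, q) \<in> parcs (min_prime_graph k L)"
    then have pq: "p \<in> \<phi> ` ?C" "q \<in> \<phi> ` ?C" "p \<noteq> q" "1 \<le> height L (p <+>\<^bsub>L\<^esub> q)" "height L (p <+>\<^bsub>L\<^esub> q) \<le> enat k"
      unfolding min_prime_graph_def mp by auto
    then obtain C C' where C: "C \<in> ?C" "C' \<in> ?C" "p = \<phi> C" "q = \<phi> C'" by blast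
    then have "(C, C') \<in> ?H" using pq(3-5) height_pair[OF C(1,2)] unfolding height_graph_def \<phi>_def by auto
    then show "(p, q) \<in> map_prod \<phi> \<phi> ` ?H" using C by force
  next
    fix e assume "e \<in> map_prod \<phi> \<phi> ` ?H"
    then obtain C C' where C: "(C, C') \<in> ?H" "e = (\<phi> C, \<phi> C')" by auto
    then have C': "C \<in> ?C" "C' \<in> ?C" "C \<noteq> C'" unfolding height_graph_def by auto
    then have "\<phi> C \<noteq> \<phi> C'" using inj unfolding inj_on_def by blast
    then show "e \<in> parcs (min_prime_graph k L)"
      using C C' height_pair[OF C'(1,2)] unfolding min_prime_graph_def mp height_graph_def \<phi>_def by auto
  qed
  have "sym ?H" unfolding height_graph_def sym_def by (auto simp: Un_commute)
  then have sym: "sym (parcs (min_prime_graph k L))" unfolding parcs sym_def by force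
  have pv: "pverts (min_prime_graph k L) = \<phi> ` ?C" unfolding min_prime_graph_def mp by simp
  \<comment> \<open>\<open>Digraph_Component.connected\<close> demands a vertex; one exists because
    \<open>I \<subseteq> P\<close> makes \<open>vars P\<close> a cover, which contains a minimal
    one.\<close>
  have "cover (vars P)" using I_subset_iff_cover[OF prime_P] I_subset_P by blast
  then have "?C \<noteq> {}" using exists_min_cover unfolding CC_def by blast
  moreover have "map_prod \<phi> \<phi> ` ?H \<subseteq> \<phi> ` ?C \<times> \<phi> ` ?C" using HC by force
  ultimately show ?thesis
    using connected_pair_digraph_iff[OF sym] conn_on_image[OF inj HC] unfolding pv parcs by auto
qed

end

context squarefree_ideal
begin

text \<open>From left to right only the primes \<open>PV B\<close> are consulted, but for one
  \<open>P\<close> possibly many of them. From right to left, connectedness at \<open>P\<close>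
  enters only if \<open>P\<close> is a variable ideal; it passes to the graph \<open>meet\<close>
  because the height is at least \<open>j + 2\<close>, one more than the edge bound.\<close>

lemma regular_two_iff_height_graph_conn:
  "(\<forall>P. prime_in D P \<longrightarrow> I \<subseteq> P \<longrightarrow> enat (j + 2) \<le> ht_over D I P \<longrightarrow> regular_two P) \<longleftrightarrow>
   (\<forall>P. prime_in D P \<longrightarrow> I \<subseteq> P \<longrightarrow> conn_on (CC (vars P)) (height_graph (j + 1) (vars P)))"
  (is "?S \<longleftrightarrow> ?C")
proof
  assume S: ?S
  show ?C
  proof (intro allI impI height_graph_conn vars_V)
    fix B assume B: "B \<subseteq> V" "cover B" "enat (j + 1 + 1) \<le> ht_over D I (PV B)"
    have "regular_two (PV B)"
      using S[rule_format, OF prime_var_ideal, of B] I_subset_var_ideal[OF B(1)] B(2,3) by simp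
    then show "conn_on (CC B) (meet B)" by (rule meet_conn_of_regular_two[OF B(1)])
  qed
next
  assume C: ?C
  show ?S
  proof (intro allI impI)
    fix P assume P: "prime_in D P" "I \<subseteq> P" "enat (j + 2) \<le> ht_over D I P"
    show "regular_two P"
    proof (rule regular_two_of_height[OF P(1,2)])
      have "enat 2 \<le> enat (j + 2)" by simp
      then show "enat 2 \<le> ht_over D I P" using P(3) by (rule order_trans)
      assume "P = PV (vars P)"
      then have "enat (j + 1 + 1) \<le> ht_over D I (PV (vars P))" using P(3) by simp
      then show "conn_on (CC (vars P)) (meet (vars P))"
        using C P(1,2) by (intro meet_conn_of_height_graph_conn[OF vars_V]) auto
    qed
  qed
qed

end

theorem theorem4p6:
  fixes n j :: nat
    and I :: "((nat \<Rightarrow>\<^sub>0 nat) \<Rightarrow>\<^sub>0 'k::field) set"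
  assumes "squarefree_monomial_ideal n I"
  shows "serre_condition 2 j (mpoly_ring n Quot I) \<longleftrightarrow> locally_connected (j + 1) (mpoly_ring n Quot I)"
proof -
  define D :: "'k mpoly set" where "D = polys_in {..<n}"
  obtain M where M: "M \<subseteq> squarefree_monomials n" "I = Idl\<^bsub>mpoly_ring n\<^esub> M"
    using assms unfolding squarefree_monomial_ideal_def by blast
  define GG where "GG = {supp m | m. (sngl m 1 :: 'k mpoly) \<in> M}"
  interpret squarefree_ideal "{..<n}" GG I
    unfolding GG_def M(2) by (rule squarefree_ideal_of_monomials[OF M(1)])
  have sub: "subring_set D" unfolding D_def by (rule subring_polys_in)
  have R: "mpoly_ring n = subring_of D" unfolding D_def by (rule mpoly_ring_eq)
  interpret Q: quotient_of_subring D I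
  proof (rule quotient_of_subring.intro)
    interpret S: cring "subring_of D" by (rule subring_of_cring[OF sub])
    show "ideal I (subring_of D)"
      unfolding M(2) R using M(1) unfolding squarefree_monomials_def D_def
      by (intro S.genideal_ideal[unfolded D_def]) (auto simp: subring_of_simps)
  qed (rule sub)
  have L: "squarefree_local {..<n} GG I (Q.preimage p) (localization_at Q.R p)
      (\<lambda>a. loc_frac Q.R (carrier Q.R - p) (Q.\<pi> a) \<one>\<^bsub>Q.R\<^esub>)" if "primeideal p Q.R" for p
    using Q.local_frac_localization[OF that] unfolding D_def
    by (intro squarefree_local.intro squarefree_ideal_axioms)
  \<comment> \<open>Both conditions see a prime of the quotient only through its preimage, and the
    preimages are exactly the primes of \<open>D\<close> that contain \<open>I\<close>.\<close>
  have all: "(\<forall>p. primeideal p Q.R \<longrightarrow> T (Q.preimage p)) \<longleftrightarrow> (\<forall>P. prime_in D P \<longrightarrow> I \<subseteq> P \<longrightarrow> T P)" for T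
    using Q.preimage_prime Q.exists_prime_preimage by metis
  have "serre_condition 2 j Q.R \<longleftrightarrow>
      (\<forall>p. primeideal p Q.R \<longrightarrow> enat (j + 2) \<le> ht_over D I (Q.preimage p) \<longrightarrow> regular_two (Q.preimage p))"
    unfolding serre_condition_def using squarefree_local.serre_local_iff[OF L] unfolding D_def by blast
  also have "\<dots> \<longleftrightarrow> (\<forall>P. prime_in D P \<longrightarrow> I \<subseteq> P \<longrightarrow> enat (j + 2) \<le> ht_over D I P \<longrightarrow> regular_two P)"
    by (rule all)
  also have "\<dots> \<longleftrightarrow> (\<forall>P. prime_in D P \<longrightarrow> I \<subseteq> P \<longrightarrow> conn_on (CC (vars P)) (height_graph (j + 1) (vars P)))"
    unfolding D_def by (rule regular_two_iff_height_graph_conn)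
  also have "\<dots> \<longleftrightarrow> (\<forall>p. primeideal p Q.R \<longrightarrow>
      conn_on (CC (vars (Q.preimage p))) (height_graph (j + 1) (vars (Q.preimage p))))"
    by (rule all[symmetric])
  also have "\<dots> \<longleftrightarrow> locally_connected (j + 1) Q.R"
    unfolding locally_connected_def using squarefree_local.connected_iff[OF L] by blast
  finally show ?thesis unfolding R .
qed

end
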